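(* Consider the $s$-stage modified two-derivative diagonally implicit Runge--Kutta method $$Y_i = y_n+\xi_i(\mu)c_{i} h f(y_n)+h^2\sum_{j=1}^{i} a_{ij}(\mu)g(Y_j),\ i=1,\ldots,s,\qquad y_{n+1} = y_n+h f(y_n)+h^2\sum_{i=1}^s b_i(\mu)g(Y_i),$$ with $g(y)=f'(y)f(y)$ and $\mu=\mathrm{i}\omega h$, whose coefficients have the expansions $a_{ij}(\mu)=a_{ij}^{(0)}+a_{ij}^{(2)}\mu^2+a_{ij}^{(4)}\mu^4+\cdots$, $b_i(\mu)=b_i^{(0)}+b_i^{(2)}\mu^2+b_i^{(4)}\mu^4+\cdots$, $\xi_i(\mu)=\xi_i^{(0)}+\xi_i^{(2)}\mu^2+\xi_i^{(4)}\mu^4+\cdots$. Assume $$\bm{\xi}^{(0)}=\bm{e},\qquad \bm{A}^{(0)}\bm{e}=\tfrac{1}{2}\bm{c}^2 .$$ Then the method is of order of consistency $p$ ($2\le p\le 6$) if the following conditions listed for all orders up to and including $p$ are fulfilled: Order 2: $\bm{b}^{(0)}\cdot\bm{e}=\frac12$. Order 3 (in addition): $\bm{b}^{(0)}\cdot\bm{c}=\frac16$. Order 4 (in addition): $\bm{b}^{(0)}\cdot\bm{c}^2=\frac1{12}$ and $\bm{b}^{(2)}\cdot\bm{e}=0$. Order 5 (in addition): $\bm{b}^{(0)}\cdot(\bm{A}^{(0)}\bm{c})=\frac1{120}$, $\bm{b}^{(0)}\cdot\bm{c}^3=\frac1{20}$, and $\bm{b}^{(0)}\cdot(\bm{\xi}^{(2)}*\bm{c})+\bm{b}^{(2)}\cdot\bm{c}=0$.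 Order 6 (in addition): $\bm{b}^{(0)}\cdot(\bm{A}^{(0)}\bm{c}^2)=\frac1{360}$, $\bm{b}^{(0)}\cdot(\bm{c}*(\bm{A}^{(0)}\bm{c}))=\frac1{180}$, $\bm{b}^{(0)}\cdot\bm{c}^4=\frac1{30}$, $\bm{b}^{(4)}\cdot\bm{e}=0$, $2\bm{b}^{(0)}\cdot\bm{A}^{(2)}\bm{e}+\bm{b}^{(2)}\cdot\bm{c}^2=0$, and $2\bm{b}^{(0)}\cdot(\bm{\xi}^{(2)}*\bm{c}^2)+\bm{b}^{(2)}\cdot\bm{c}^2=0$.
   Context: The method is applied to the autonomous initial value problem $y'=f(y)$, $y(x_0)=y_0$, with $f$ sufficiently differentiable and $y$ sufficiently smooth. $h>0$ is the stepsize, $\omega>0$ a fixed frequency, $\mathrm{i}^2=-1$; $c_1,\dots,c_s$ are real nodes; the coefficients $\xi_i(\mu),a_{ij}(\mu),b_i(\mu)$ are complex differentiable (near $0$) and even functions of $\mu$. For small $h$ the stages $Y_i$ are the solutions near $y_n$ of the implicit stage equations. Order of consistency $p$: with $y(x_n)=y_n$, the local truncation error $y(x_n+h)-y_{n+1}$ is $\mathcal{O}(h^{p+1})$ as $h\to0$. Notation: for $\sigma=0,2,4,\dots$, $\bm{A}^{(\sigma)}=[a_{ij}^{(\sigma)}]$ is the lower triangular $s\times s$ matrix (including the diagonal), $\bm{b}^{(\sigma)}=(b_1^{(\sigma)},\dots,b_s^{(\sigma)})^T$, $\bm{\xi}^{(\sigma)}=(\xi_1^{(\sigma)},\dots,\xi_s^{(\sigma)})^T$,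 $\bm{c}=(c_1,\dots,c_s)^T$, $\bm{e}=(1,\dots,1)^T$; $*$ is the componentwise product, powers of vectors are componentwise, and $\cdot$ is the (bilinear) dot product. *)

theory Defs
  imports "HOL-Complex_Analysis.Complex_Analysis" "HOL-Library.FuncSet"
    "HOL-Library.Landau_Symbols"
begin

text \<open>
  The definitions are parametrised by a scalar action \<open>sc\<close> of the field \<open>'k\<close> containing the method
  coefficients on the state space \<open>'a\<close>. It is used in two ways: \<open>sc = (*\<^sub>R)\<close> on a real Euclidean space,
  and \<open>sc = (*s)\<close> on \<^typ>\<open>complex ^ 'm\<close>. Time, stepsize and nodes are real in both.
\<close>

primrec Ck_on :: "nat \<Rightarrow> ('a::real_normed_vector \<Rightarrow> 'b::real_normed_vector) \<Rightarrow> 'a set \<Rightarrow> bool" where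
  "Ck_on 0 f U \<longleftrightarrow> continuous_on U f"
| "Ck_on (Suc k) f U \<longleftrightarrow> (\<forall>x\<in>U. f differentiable (at x)) \<and>
     (\<forall>v. Ck_on k (\<lambda>x. frechet_derivative f (at x) v) U)"

text \<open>
  The last condition is automatic for \<open>(*\<^sub>R)\<close>; for \<open>(*s)\<close> on \<^typ>\<open>complex ^ 'm\<close> it says that \<open>f\<close> is
  complex differentiable.
\<close>

definition smooth_field ::
    "('k \<Rightarrow> 'a \<Rightarrow> 'a) \<Rightarrow> nat \<Rightarrow> 'a::euclidean_space set \<Rightarrow> ('a \<Rightarrow> 'a) \<Rightarrow> bool" where
  "smooth_field sc k U f \<longleftrightarrow> open U \<and> Ck_on k f U \<and>
     (\<forall>x\<in>U. \<forall>z v. frechet_derivative f (at x) (sc z v) = sc z (frechet_derivative f (at x) v))"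

definition solves_ivp ::
    "('a::euclidean_space \<Rightarrow> 'a) \<Rightarrow> 'a set \<Rightarrow> real \<Rightarrow> real \<Rightarrow> 'a \<Rightarrow> (real \<Rightarrow> 'a) \<Rightarrow> bool" where
  "solves_ivp f U x0 X y0 y \<longleftrightarrow> y x0 = y0 \<and>
     (\<forall>x\<in>{x0..X}. y x \<in> U \<and> (y has_vector_derivative f (y x)) (at x within {x0..X}))"

definition second_derivative_field ::
    "('a::euclidean_space \<Rightarrow> 'a) \<Rightarrow> 'a \<Rightarrow> 'a" where
  "second_derivative_field f y = frechet_derivative f (at y) (f y)"

definition stage_equations ::
    "('k \<Rightarrow> 'a \<Rightarrow> 'a) \<Rightarrow> nat \<Rightarrow> (nat \<Rightarrow> real) \<Rightarrow> (nat \<Rightarrow> 'k) \<Rightarrow> (nat \<Rightarrow> nat \<Rightarrow> 'k) \<Rightarrow>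
     ('a::euclidean_space \<Rightarrow> 'a) \<Rightarrow> real \<Rightarrow> 'a \<Rightarrow> (nat \<Rightarrow> 'a) \<Rightarrow> bool" where
  "stage_equations sc s c \<xi> a f h yn Y \<longleftrightarrow> (\<forall>i\<in>{1..s}.
     Y i = yn + sc (\<xi> i) ((c i * h) *\<^sub>R f yn)
              + h\<^sup>2 *\<^sub>R (\<Sum>j=1..i. sc (a i j) (second_derivative_field f (Y j))))"

text \<open>Stage vectors are indexed by \<open>{1..s}\<close> and extensional, so that uniqueness makes sense.\<close>

definition stages_near ::
    "real \<Rightarrow> ('k \<Rightarrow> 'a \<Rightarrow> 'a) \<Rightarrow> nat \<Rightarrow> (nat \<Rightarrow> real) \<Rightarrow> (nat \<Rightarrow> 'k) \<Rightarrow> (nat \<Rightarrow> nat \<Rightarrow> 'k) \<Rightarrow>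
     ('a::euclidean_space \<Rightarrow> 'a) \<Rightarrow> real \<Rightarrow> 'a \<Rightarrow> (nat \<Rightarrow> 'a) \<Rightarrow> bool" where
  "stages_near r sc s c \<xi> a f h yn Y \<longleftrightarrow>
     Y \<in> {1..s} \<rightarrow>\<^sub>E ball yn r \<and> stage_equations sc s c \<xi> a f h yn Y"

definition next_value ::
    "('k \<Rightarrow> 'a \<Rightarrow> 'a) \<Rightarrow> nat \<Rightarrow> (nat \<Rightarrow> 'k) \<Rightarrow>
     ('a::euclidean_space \<Rightarrow> 'a) \<Rightarrow> real \<Rightarrow> 'a \<Rightarrow> (nat \<Rightarrow> 'a) \<Rightarrow> 'a" where
  "next_value sc s b f h yn Y =
     yn + h *\<^sub>R f yn + h\<^sup>2 *\<^sub>R (\<Sum>i=1..s. sc (b i) (second_derivative_field f (Y i)))"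

definition freq_arg :: "real \<Rightarrow> real \<Rightarrow> complex" where
  "freq_arg \<omega> h = \<i> * of_real \<omega> * of_real h"

text \<open>
  Order of consistency \<open>p\<close> along every exact solution, at every point \<open>xn\<close> of it: for small \<open>h > 0\<close>
  the stage equations have exactly one solution near \<open>y xn\<close>, and the step computed from it
  has local truncation error \<open>O(h ^ (p + 1))\<close>.
\<close>

definition consistent_of_order ::
    "('k \<Rightarrow> 'a \<Rightarrow> 'a) \<Rightarrow> nat \<Rightarrow> nat \<Rightarrow> real \<Rightarrow> (nat \<Rightarrow> real) \<Rightarrow> (nat \<Rightarrow> complex \<Rightarrow> 'k) \<Rightarrow>
     (nat \<Rightarrow> nat \<Rightarrow> complex \<Rightarrow> 'k) \<Rightarrow> (nat \<Rightarrow> complex \<Rightarrow> 'k) \<Rightarrow>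
     'a::euclidean_space set \<Rightarrow> ('a \<Rightarrow> 'a) \<Rightarrow> bool" where
  "consistent_of_order sc p s \<omega> c \<xi> a b U f \<longleftrightarrow>
     (\<forall>x0 X y0 y xn. solves_ivp f U x0 X y0 y \<longrightarrow> xn \<in> {x0..<X} \<longrightarrow>
       (\<exists>r>0. ball (y xn) r \<subseteq> U \<and>
         (let \<mu> = freq_arg \<omega>;
              St = (\<lambda>h. stages_near r sc s c (\<lambda>i. \<xi> i (\<mu> h)) (\<lambda>i j. a i j (\<mu> h)) f h (y xn))
          in (\<forall>\<^sub>F h in at_right 0. \<exists>!Y. St h Y) \<and>
             (\<lambda>h. norm (y (xn + h) - next_value sc s (\<lambda>i. b i (\<mu> h)) f h (y xn) (THE Y. St h Y)))
               \<in> O[at_right 0](\<lambda>h. h ^ (p + 1)))))"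

definition even_analytic_at_0 :: "(complex \<Rightarrow> complex) \<Rightarrow> bool" where
  "even_analytic_at_0 F \<longleftrightarrow> F analytic_on {0} \<and> (\<forall>\<^sub>F \<mu> in nhds 0. F (- \<mu>) = F \<mu>)"

text \<open>
  For even analytic \<open>F\<close>, the expansion is
  \<open>F \<mu> = taylor_coeff 0 F + taylor_coeff 2 F * \<mu>\<^sup>2 + taylor_coeff 4 F * \<mu> ^ 4 + \<dots>\<close>.
\<close>

definition taylor_coeff :: "nat \<Rightarrow> (complex \<Rightarrow> complex) \<Rightarrow> complex" where
  "taylor_coeff k F = fps_nth (fps_expansion F 0) k"

text \<open>Vectors in \<open>\<complex>\<^sup>s\<close> and \<open>s \<times> s\<close> matrices are functions of indices in \<open>{1..s}\<close>.\<close>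

definition vec_coeff :: "nat \<Rightarrow> (nat \<Rightarrow> complex \<Rightarrow> complex) \<Rightarrow> nat \<Rightarrow> complex" where
  "vec_coeff k v = (\<lambda>i. taylor_coeff k (v i))"

definition mat_coeff ::
    "nat \<Rightarrow> (nat \<Rightarrow> nat \<Rightarrow> complex \<Rightarrow> complex) \<Rightarrow> nat \<Rightarrow> nat \<Rightarrow> complex" where
  "mat_coeff k A = (\<lambda>i j. if j \<le> i then taylor_coeff k (A i j) else 0)"

definition mat_vec :: "nat \<Rightarrow> (nat \<Rightarrow> nat \<Rightarrow> complex) \<Rightarrow> (nat \<Rightarrow> complex) \<Rightarrow> nat \<Rightarrow> complex" where
  "mat_vec s A v = (\<lambda>i. \<Sum>j=1..s. A i j * v j)"

definition dot :: "nat \<Rightarrow> (nat \<Rightarrow> complex) \<Rightarrow> (nat \<Rightarrow> complex) \<Rightarrow> complex" where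
  "dot s u v = (\<Sum>i=1..s. u i * v i)"

definition order_conditions ::
    "nat \<Rightarrow> nat \<Rightarrow> (nat \<Rightarrow> real) \<Rightarrow> (nat \<Rightarrow> complex \<Rightarrow> complex) \<Rightarrow>
     (nat \<Rightarrow> nat \<Rightarrow> complex \<Rightarrow> complex) \<Rightarrow> (nat \<Rightarrow> complex \<Rightarrow> complex) \<Rightarrow> bool" where
  "order_conditions p s c \<xi> a b \<longleftrightarrow>
    (let e = (\<lambda>_. 1); cc = (\<lambda>i. complex_of_real (c i)); \<xi>2 = vec_coeff 2 \<xi>;
         b0 = vec_coeff 0 b; b2 = vec_coeff 2 b; b4 = vec_coeff 4 b;
         A0 = mat_vec s (mat_coeff 0 a); A2 = mat_vec s (mat_coeff 2 a)
     in
      (2 \<le> p \<longrightarrow>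
         dot s b0 e = 1/2) \<and>
      (3 \<le> p \<longrightarrow>
         dot s b0 cc = 1/6) \<and>
      (4 \<le> p \<longrightarrow>
         dot s b0 (\<lambda>i. cc i ^ 2) = 1/12 \<and>
         dot s b2 e = 0) \<and>
      (5 \<le> p \<longrightarrow>
         dot s b0 (A0 cc) = 1/120 \<and>
         dot s b0 (\<lambda>i. cc i ^ 3) = 1/20 \<and>
         dot s b0 (\<lambda>i. \<xi>2 i * cc i) + dot s b2 cc = 0) \<and>
      (6 \<le> p \<longrightarrow>
         dot s b0 (A0 (\<lambda>i. cc i ^ 2)) = 1/360 \<and>
         dot s b0 (\<lambda>i. cc i * A0 cc i) = 1/180 \<and>
         dot s b0 (\<lambda>i. cc i ^ 4) = 1/30 \<and>
         dot s b4 e = 0 \<and>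
         2 * dot s b0 (A2 e) + dot s b2 (\<lambda>i. cc i ^ 2) = 0 \<and>
         2 * dot s b0 (\<lambda>i. \<xi>2 i * cc i ^ 2) + dot s b2 (\<lambda>i. cc i ^ 2) = 0))"

text \<open>On a real state space the method makes sense only if its coefficients are real at \<open>\<mu> = \<i>\<omega>h\<close>.\<close>

definition real_at_freq :: "real \<Rightarrow> (complex \<Rightarrow> complex) \<Rightarrow> bool" where
  "real_at_freq \<omega> F \<longleftrightarrow> (\<forall>\<^sub>F h in at_right 0. F (freq_arg \<omega> h) \<in> \<real>)"

end

theory Submission
  imports Defs
begin

text \<open>
  Write \<open>L \<phi> x = \<phi>'(x) (f x)\<close> for the derivative along the flow, so that \<open>g = L f\<close> and \<open>y\<^sup>(\<^sup>k\<^sup>) = (L\<^sup>k id) \<circ> y\<close>.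
  Let \<open>q\<close> be the Taylor polynomial of the solution at \<open>x\<^sub>n\<close>. Under the simplifying assumptions the stages
  are \<open>Y\<^sub>i = q (c\<^sub>i h) + \<delta>\<^sub>i\<close> with \<open>\<delta>\<^sub>i = O(h\<^sup>3)\<close>, so \<open>g (Y\<^sub>i)\<close> equals \<open>g (q (c\<^sub>i h)) + g'(q (c\<^sub>i h)) \<delta>\<^sub>i\<close> up to
  \<open>O(h\<^sup>6)\<close>. Along \<open>q\<close> every function is expanded by iterating \<open>L\<close>, and only \<open>T1 = g'(y\<^sub>n)\<close> and
  \<open>T2 = g''(y\<^sub>n)(f y\<^sub>n, \<cdot>)\<close> enter explicitly: higher elementary differentials are never needed, and
  the order conditions remove all terms that involve \<open>\<delta>\<^sub>i\<close>, together with those produced by the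
  dependence of the weights on \<open>\<mu>\<close>.
\<close>

section \<open>Iterated directional derivatives\<close>

text \<open>The field is only C^p, so \<open>g\<close> is only C^(p-1). The factor h^2 in front of
  the weights requires \<open>g (Y i)\<close> to order p - 1 and no further, and this balance fixes
  the orders in most statements. Two obstacles shape the proof. All derivatives are real Frechet
  derivatives, also on the complex space, so a coefficient may be pulled out of g' and g''(f, .)
  only because the derivative of \<open>f\<close> commutes with the scalars; a locale with an
  abstract action \<open>sc\<close> treats both state spaces at once. Moreover the stages are
  implicit: at the start they are only known to lie in a fixed ball, and the order of \<delta> has
  to be gained by feeding each bound back into the stage equations. The numbers in the conditions
  have one origin: b0.c^k = 1/((k+1)(k+2)) is k!/(k+2)!, which matches the weighted Taylor series of
  \<open>g\<close> with that of the solution. The conditions with A0 say that A0 c and A0 c^2 may be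
  replaced by c^3/6 and c^4/12 inside the weighted sums that occur.\<close>

abbreviation dir_deriv :: "('a::real_normed_vector \<Rightarrow> 'b::real_normed_vector) \<Rightarrow> 'a \<Rightarrow> 'a \<Rightarrow> 'b" where
  "dir_deriv \<phi> v \<equiv> (\<lambda>x. frechet_derivative \<phi> (at x) v)"

lemma dir_deriv_eqI: "(\<phi> has_derivative \<phi>') (at x) \<Longrightarrow> dir_deriv \<phi> v x = \<phi>' v"
  using frechet_derivative_at by metis

lemma differentiable_has_derivative:
  "\<phi> differentiable (at x) \<Longrightarrow> (\<phi> has_derivative frechet_derivative \<phi> (at x)) (at x)"
  using frechet_derivative_works by blast

lemma Ck_on_differentiable: "Ck_on (Suc k) \<phi> U \<Longrightarrow> x \<in> U \<Longrightarrow> \<phi> differentiable (at x)"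
  by simp

lemma Ck_on_continuous: "Ck_on k \<phi> U \<Longrightarrow> continuous_on U \<phi>"
  by (cases k) (auto intro: continuous_at_imp_continuous_on differentiable_imp_continuous_within)

lemma Ck_on_Suc_lower: "Ck_on (Suc k) \<phi> U \<Longrightarrow> Ck_on k \<phi> U"
proof (induction k arbitrary: \<phi>)
  case 0
  then show ?case using Ck_on_continuous[of "Suc 0"] by simp
next
  case (Suc k)
  then show ?case by (auto simp del: Ck_on.simps(1))
qed

lemma Ck_on_mono: "Ck_on m \<phi> U \<Longrightarrow> k \<le> m \<Longrightarrow> Ck_on k \<phi> U"
  by (induction m) (auto simp: le_Suc_eq simp del: Ck_on.simps dest: Ck_on_Suc_lower)

lemma Ck_on_dir_deriv: "Ck_on (Suc k) \<phi> U \<Longrightarrow> Ck_on k (dir_deriv \<phi> v) U"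
  by simp

text \<open>At a point of an open set the Frechet derivative depends only on the values on that set.
  The closure lemmas below compute a derivative on \<open>U\<close> by the usual rule and pass from
  the resulting formula to \<open>dir_deriv\<close> in this way.\<close>

lemma Ck_on_cong:
  assumes "open U" "\<And>x. x \<in> U \<Longrightarrow> \<phi> x = \<psi> x" "Ck_on k \<phi> U"
  shows "Ck_on k \<psi> U"
  using assms(2,3)
proof (induction k arbitrary: \<phi> \<psi>)
  case 0
  then show ?case using continuous_on_cong[of U U \<phi> \<psi>] by simp
next
  case (Suc k)
  have d: "(\<psi> has_derivative frechet_derivative \<phi> (at x)) (at x)" if "x \<in> U" for x
    using Suc.prems that assms(1)
    by (intro has_derivative_transform_within_open[OF differentiable_has_derivative, of \<phi> x U]) auto
  have "Ck_on k (dir_deriv \<psi> v) U" for v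
    by (rule Suc.IH[of "dir_deriv \<phi> v"]) (use Suc.prems d[THEN dir_deriv_eqI] in auto)
  then show ?case using d by (auto simp: differentiable_def)
qed

lemma Ck_on_const [simp]: "Ck_on k (\<lambda>x. c) U"
  by (induction k arbitrary: c) auto

lemma Ck_on_id: "Ck_on k id U"
proof -
  have "id differentiable (at x)" for x :: 'a
    unfolding differentiable_def using has_derivative_id by blast
  then show ?thesis by (cases k) auto
qed

lemma Ck_on_add:
  assumes "open U" "Ck_on k \<phi> U" "Ck_on k \<psi> U"
  shows "Ck_on k (\<lambda>x. \<phi> x + \<psi> x) U"
  using assms(2,3)
proof (induction k arbitrary: \<phi> \<psi>)
  case 0
  then show ?case by (simp add: continuous_on_add continuous_on_scaleR)
next
  case (Suc k)
  have d: "((\<lambda>x. \<phi> x + \<psi> x) has_derivative (\<lambda>v. dir_deriv \<phi> v x + dir_deriv \<psi> v x)) (at x)"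
    if "x \<in> U" for x
    using Suc.prems that by (intro has_derivative_add differentiable_has_derivative) auto
  have "Ck_on k (dir_deriv (\<lambda>x. \<phi> x + \<psi> x) v) U" for v
    by (rule Ck_on_cong[OF assms(1), of "\<lambda>x. dir_deriv \<phi> v x + dir_deriv \<psi> v x"])
       (use Suc d[THEN dir_deriv_eqI] in auto)
  then show ?case using d by (auto simp: differentiable_def)
qed

lemma Ck_on_sum:
  assumes "open U" "\<And>i. i \<in> I \<Longrightarrow> Ck_on k (\<phi> i) U"
  shows "Ck_on k (\<lambda>x. \<Sum>i\<in>I. \<phi> i x) U"
  using assms(2)
  by (induction I rule: infinite_finite_induct) (auto intro: Ck_on_add assms(1))

lemma Ck_on_bounded_linear:
  assumes T: "bounded_linear T" and "open U" "Ck_on k \<phi> U"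
  shows "Ck_on k (\<lambda>x. T (\<phi> x)) U"
  using assms(3)
proof (induction k arbitrary: \<phi>)
  case 0
  then show ?case using bounded_linear.continuous_on[OF T] by auto
next
  case (Suc k)
  have d: "((\<lambda>x. T (\<phi> x)) has_derivative (\<lambda>v. T (dir_deriv \<phi> v x))) (at x)" if "x \<in> U" for x
    using Suc.prems that by (intro bounded_linear.has_derivative[OF T] differentiable_has_derivative) auto
  have "Ck_on k (dir_deriv (\<lambda>x. T (\<phi> x)) v) U" for v
    by (rule Ck_on_cong[OF assms(2), of "\<lambda>x. T (dir_deriv \<phi> v x)"])
       (use Suc d[THEN dir_deriv_eqI] in auto)
  then show ?case using d by (auto simp: differentiable_def)
qed

lemma Ck_on_scaleR:
  assumes "open U" "Ck_on k \<alpha> U" "Ck_on k \<phi> U"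
  shows "Ck_on k (\<lambda>x. \<alpha> x *\<^sub>R \<phi> x) U"
  using assms(2,3)
proof (induction k arbitrary: \<alpha> \<phi>)
  case 0
  then show ?case by (simp add: continuous_on_add continuous_on_scaleR)
next
  case (Suc k)
  have d: "((\<lambda>x. \<alpha> x *\<^sub>R \<phi> x) has_derivative
      (\<lambda>v. \<alpha> x *\<^sub>R dir_deriv \<phi> v x + dir_deriv \<alpha> v x *\<^sub>R \<phi> x)) (at x)"
    if "x \<in> U" for x
    using Suc.prems that by (intro has_derivative_scaleR differentiable_has_derivative) auto
  have "Ck_on k (dir_deriv (\<lambda>x. \<alpha> x *\<^sub>R \<phi> x) v) U" for v
    by (rule Ck_on_cong[OF assms(1), of "\<lambda>x. \<alpha> x *\<^sub>R dir_deriv \<phi> v x + dir_deriv \<alpha> v x *\<^sub>R \<phi> x"])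
       (use Suc.prems d[THEN dir_deriv_eqI] in \<open>auto intro!: Ck_on_add assms(1) Suc.IH dest: Ck_on_Suc_lower
          simp del: Ck_on.simps intro: Ck_on_dir_deriv\<close>)
  then show ?case using d by (auto simp: differentiable_def)
qed

lemma linear_dir_deriv:
  "\<phi> differentiable (at x) \<Longrightarrow> linear (\<lambda>v. dir_deriv \<phi> v x)"
  using linear_frechet_derivative by auto

text \<open>\<open>Ck_on\<close> speaks about fixed directions only. Expanding the direction in the
  basis turns a derivative along a varying vector, such as \<open>f x\<close>, into a finite sum of
  derivatives in fixed directions with scalar coefficients.\<close>

lemma dir_deriv_Basis:
  fixes \<phi> :: "'a::euclidean_space \<Rightarrow> 'b::real_normed_vector"
  assumes "\<phi> differentiable (at x)"
  shows "dir_deriv \<phi> v x = (\<Sum>e\<in>Basis. (v \<bullet> e) *\<^sub>R dir_deriv \<phi> e x)"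
  using linear_sum[OF linear_dir_deriv[OF assms], of "\<lambda>e. (v \<bullet> e) *\<^sub>R e" Basis]
  by (simp add: euclidean_representation linear_cmul[OF linear_dir_deriv[OF assms]])

section \<open>Symmetry of mixed second derivatives\<close>

lemma has_vector_derivative_line:
  assumes "\<phi> differentiable (at (p + s *\<^sub>R u))"
  shows "((\<lambda>s. \<phi> (p + s *\<^sub>R u)) has_vector_derivative dir_deriv \<phi> u (p + s *\<^sub>R u)) (at s within S)"
proof -
  have "((\<lambda>s. p + s *\<^sub>R u) has_vector_derivative u) (at s within S)"
    by (auto intro!: derivative_eq_intros)
  from vector_derivative_diff_chain_within[OF this has_derivative_at_withinI[OF differentiable_has_derivative[OF assms]]]
  show ?thesis by (simp add: o_def)
qed

text \<open>The mean value theorem is applied to the increment in direction \<open>v\<close>, viewed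
  as a function along \<open>u\<close>, and then to the resulting derivative along \<open>v\<close>.
  Real values are essential: they give an exact intermediate point.\<close>

lemma second_difference_real:
  fixes \<phi> :: "'a::euclidean_space \<Rightarrow> real"
  assumes C: "Ck_on 2 \<phi> U" and h: "h > 0"
    and U: "\<And>s t. s \<in> {0..h} \<Longrightarrow> t \<in> {0..h} \<Longrightarrow> x + s *\<^sub>R u + t *\<^sub>R v \<in> U"
  shows "\<exists>s\<in>{0..h}. \<exists>t\<in>{0..h}. \<phi> (x + h *\<^sub>R u + h *\<^sub>R v) - \<phi> (x + h *\<^sub>R u) - \<phi> (x + h *\<^sub>R v) + \<phi> x
     = h\<^sup>2 * dir_deriv (dir_deriv \<phi> u) v (x + s *\<^sub>R u + t *\<^sub>R v)"
proof -
  have d1: "\<phi> differentiable (at y)" if "y \<in> U" for y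
    using C that by (simp add: numeral_2_eq_2)
  have d2: "dir_deriv \<phi> u differentiable (at y)" if "y \<in> U" for y
    using C that by (simp add: numeral_2_eq_2)
  define k where "k s = \<phi> ((x + h *\<^sub>R v) + s *\<^sub>R u) - \<phi> (x + s *\<^sub>R u)" for s
  have "DERIV k s :> dir_deriv \<phi> u ((x + h *\<^sub>R v) + s *\<^sub>R u) - dir_deriv \<phi> u (x + s *\<^sub>R u)"
    if "0 \<le> s" "s \<le> h" for s
    unfolding k_def has_real_derivative_iff_has_vector_derivative
    using U[of s h] U[of s 0] that h
    by (intro has_vector_derivative_diff has_vector_derivative_line d1) (auto simp: ac_simps)
  from MVT2[of 0 h k, OF h this] obtain s where s: "0 < s" "s < h"
    "k h - k 0 = h * (dir_deriv \<phi> u ((x + h *\<^sub>R v) + s *\<^sub>R u) - dir_deriv \<phi> u (x + s *\<^sub>R u))"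
    by auto
  define l where "l t = dir_deriv \<phi> u ((x + s *\<^sub>R u) + t *\<^sub>R v)" for t
  have "DERIV l t :> dir_deriv (dir_deriv \<phi> u) v ((x + s *\<^sub>R u) + t *\<^sub>R v)"
    if "0 \<le> t" "t \<le> h" for t
    unfolding l_def has_real_derivative_iff_has_vector_derivative
    using U[of s t] that s
    by (intro has_vector_derivative_line d2) (auto simp: ac_simps)
  from MVT2[of 0 h l, OF h this] obtain t where t: "0 < t" "t < h"
    "l h - l 0 = h * dir_deriv (dir_deriv \<phi> u) v ((x + s *\<^sub>R u) + t *\<^sub>R v)"
    by auto
  have "k h - k 0 = h * (l h - l 0)"
    unfolding s(3) l_def by (simp add: ac_simps)
  with t(3) have "k h - k 0 = h\<^sup>2 * dir_deriv (dir_deriv \<phi> u) v ((x + s *\<^sub>R u) + t *\<^sub>R v)"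
    by (simp add: power2_eq_square)
  moreover have "k h - k 0 = \<phi> (x + h *\<^sub>R u + h *\<^sub>R v) - \<phi> (x + h *\<^sub>R u) - \<phi> (x + h *\<^sub>R v) + \<phi> x"
    by (simp add: k_def ac_simps)
  ultimately show ?thesis using s(1,2) t(1,2) by (intro bexI[of _ s] bexI[of _ t]) auto
qed

text \<open>The second difference over a parallelogram does not change when \<open>u\<close> and
  \<open>v\<close> are exchanged. Hence the two mixed derivatives take a common value at two points
  arbitrarily close to \<open>x\<close>, which continuity forbids if they differ at
  \<open>x\<close>.\<close>

lemma dir_deriv_commute_real:
  fixes \<phi> :: "'a::euclidean_space \<Rightarrow> real"
  assumes "open U" and C: "Ck_on 2 \<phi> U" and x: "x \<in> U"
  shows "dir_deriv (dir_deriv \<phi> u) v x = dir_deriv (dir_deriv \<phi> v) u x"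
proof (rule ccontr)
  define a where "a = dir_deriv (dir_deriv \<phi> u) v"
  define b where "b = dir_deriv (dir_deriv \<phi> v) u"
  assume "dir_deriv (dir_deriv \<phi> u) v x \<noteq> dir_deriv (dir_deriv \<phi> v) u x"
  \<comment> \<open>Values that stay within half the gap of \<open>a x\<close> and of
    \<open>b x\<close> respectively cannot coincide.\<close>
  then have e: "\<bar>a x - b x\<bar> / 2 > 0" (is "?e > 0") by (simp add: a_def b_def)
  have cont: "continuous (at x) a" "continuous (at x) b"
    using C x assms(1) unfolding a_def b_def
    by (simp_all add: numeral_2_eq_2 continuous_on_eq_continuous_at)
  have "\<forall>\<^sub>F y in nhds x. dist (a y) (a x) < ?e \<and> dist (b y) (b x) < ?e \<and> y \<in> U"
    using cont[unfolded continuous_at tendsto_at_iff_tendsto_nhds, THEN tendstoD, OF e] assms(1) x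
    by (intro eventually_conj eventually_nhds_in_open)
  then obtain d where d: "d > 0"
    "\<And>y. dist y x < d \<Longrightarrow> dist (a y) (a x) < ?e \<and> dist (b y) (b x) < ?e \<and> y \<in> U"
    unfolding eventually_nhds_metric by blast
  \<comment> \<open>With this size the whole parallelogram lies within distance \<open>d\<close> of
    \<open>x\<close>; the summand 1 keeps the denominator positive when \<open>u\<close> and
    \<open>v\<close> vanish.\<close>
  define h where "h = d / (2 * (norm u + norm v + 1))"
  have n: "norm u + norm v + 1 > 0" using norm_ge_zero[of u] norm_ge_zero[of v] by linarith
  then have h: "h > 0" using d(1) by (simp add: h_def)
  have near: "dist (x + s *\<^sub>R u + t *\<^sub>R v) x < d" if "s \<in> {0..h}" "t \<in> {0..h}" for s t
  proof -
    have "dist (x + s *\<^sub>R u + t *\<^sub>R v) x \<le> norm (s *\<^sub>R u) + norm (t *\<^sub>R v)"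
      by (simp add: dist_norm add.assoc norm_triangle_ineq del: norm_scaleR)
    also have "\<dots> \<le> h * norm u + h * norm v"
      using that by (intro add_mono) (auto intro!: mult_right_mono)
    also have "\<dots> < 2 * (h * (norm u + norm v + 1))"
      using h n by (simp add: algebra_simps) (smt (verit) mult_nonneg_nonneg norm_ge_zero)
    also have "\<dots> = d" using n by (simp add: h_def field_simps)
    finally show ?thesis .
  qed
  have inU: "x + s *\<^sub>R u + t *\<^sub>R v \<in> U" if "s \<in> {0..h}" "t \<in> {0..h}" for s t
    using d(2)[OF near[OF that]] by blast
  have inU': "x + s *\<^sub>R v + t *\<^sub>R u \<in> U" if "s \<in> {0..h}" "t \<in> {0..h}" for s t
    using inU[OF that(2,1)] by (simp add: ac_simps)
  obtain s t where 1: "s \<in> {0..h}" "t \<in> {0..h}"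
    "\<phi> (x + h *\<^sub>R u + h *\<^sub>R v) - \<phi> (x + h *\<^sub>R u) - \<phi> (x + h *\<^sub>R v) + \<phi> x
     = h\<^sup>2 * a (x + s *\<^sub>R u + t *\<^sub>R v)"
    using second_difference_real[OF C h inU] unfolding a_def by blast
  obtain s' t' where 2: "s' \<in> {0..h}" "t' \<in> {0..h}"
    "\<phi> (x + h *\<^sub>R v + h *\<^sub>R u) - \<phi> (x + h *\<^sub>R v) - \<phi> (x + h *\<^sub>R u) + \<phi> x
     = h\<^sup>2 * b (x + s' *\<^sub>R v + t' *\<^sub>R u)"
    using second_difference_real[OF C h inU'] unfolding b_def by blast
  have "h\<^sup>2 * a (x + s *\<^sub>R u + t *\<^sub>R v) = h\<^sup>2 * b (x + s' *\<^sub>R v + t' *\<^sub>R u)"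
    using 1(3) 2(3) by (simp add: algebra_simps)
  then have eq: "a (x + s *\<^sub>R u + t *\<^sub>R v) = b (x + t' *\<^sub>R u + s' *\<^sub>R v)"
    using h by (simp add: ac_simps)
  show False
    using d(2)[OF near[OF 1(1,2)]] d(2)[OF near[OF 2(2,1)]] eq
    unfolding dist_real_def by (smt (verit) field_sum_of_halves)
qed

text \<open>The inner product with a fixed vector is bounded linear and commutes with
  differentiation, which reduces the claim to real components.\<close>

lemma dir_deriv_commute:
  fixes \<phi> :: "'a::euclidean_space \<Rightarrow> 'b::euclidean_space"
  assumes "open U" and C: "Ck_on 2 \<phi> U" and x: "x \<in> U"
  shows "dir_deriv (dir_deriv \<phi> u) v x = dir_deriv (dir_deriv \<phi> v) u x"
proof (rule euclidean_eqI)
  fix e :: 'b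
  have bl: "bounded_linear (\<lambda>y. y \<bullet> e)" by (rule bounded_linear_inner_left)
  have 1: "dir_deriv (\<lambda>y. \<psi> y \<bullet> e) w y = dir_deriv \<psi> w y \<bullet> e" if "\<psi> differentiable (at y)"
    for \<psi> :: "'a \<Rightarrow> 'b" and w y
    using bounded_linear.has_derivative[OF bl differentiable_has_derivative[OF that]] dir_deriv_eqI
    by blast
  have d: "\<phi> differentiable (at y)" "dir_deriv \<phi> w differentiable (at y)" if "y \<in> U" for y w
    using C that by (simp_all add: numeral_2_eq_2)
  have 2: "dir_deriv (dir_deriv (\<lambda>y. \<phi> y \<bullet> e) w) w' x = dir_deriv (dir_deriv \<phi> w) w' x \<bullet> e" for w w'
  proof -
    have "frechet_derivative (\<lambda>y. dir_deriv \<phi> w y \<bullet> e) (at x) = frechet_derivative (dir_deriv (\<lambda>y. \<phi> y \<bullet> e) w) (at x)"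
      by (rule frechet_derivative_transform_within_open[OF _ assms(1) x])
         (use 1 d x in \<open>auto intro!: differentiable_inner\<close>)
    then show ?thesis using 1[OF d(2)[OF x], of w w'] by metis
  qed
  show "dir_deriv (dir_deriv \<phi> u) v x \<bullet> e = dir_deriv (dir_deriv \<phi> v) u x \<bullet> e"
    using dir_deriv_commute_real[OF assms(1) Ck_on_bounded_linear[OF bl assms(1) C] x, of u v] 2
    by metis
qed

section \<open>Taylor expansion along approximate solutions\<close>

definition lie_deriv :: "('a::real_normed_vector \<Rightarrow> 'a) \<Rightarrow> ('a \<Rightarrow> 'b::real_normed_vector) \<Rightarrow> 'a \<Rightarrow> 'b" where
  "lie_deriv f \<phi> = (\<lambda>x. dir_deriv \<phi> (f x) x)"

lemma lie_deriv_id: "lie_deriv f id = f"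
  by (simp add: lie_deriv_def)

lemma second_derivative_field_eq: "second_derivative_field f = lie_deriv f f"
  by (simp add: second_derivative_field_def lie_deriv_def fun_eq_iff)

lemma Ck_on_lie_deriv:
  fixes f :: "'a::euclidean_space \<Rightarrow> 'a"
  assumes "open U" "Ck_on k f U" "Ck_on (Suc k) \<phi> U"
  shows "Ck_on k (lie_deriv f \<phi>) U"
proof (rule Ck_on_cong[OF assms(1)])
  show "Ck_on k (\<lambda>x. \<Sum>e\<in>Basis. (f x \<bullet> e) *\<^sub>R dir_deriv \<phi> e x) U"
    using assms by (intro Ck_on_sum Ck_on_scaleR Ck_on_dir_deriv Ck_on_bounded_linear[OF bounded_linear_inner_left])
  show "(\<Sum>e\<in>Basis. (f x \<bullet> e) *\<^sub>R dir_deriv \<phi> e x) = lie_deriv f \<phi> x" if "x \<in> U" for x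
    unfolding lie_deriv_def using assms(3) that by (intro dir_deriv_Basis[symmetric]) auto
qed

text \<open>The product rule is applied to the basis expansion of \<open>lie_deriv f \<phi>\<close>.
  Symmetry of the second derivative then allows the second-order terms to be collected into one
  derivative of \<open>dir_deriv \<phi> v\<close> along \<open>f x\<close>.\<close>

lemma dir_deriv_lie_deriv:
  fixes f :: "'a::euclidean_space \<Rightarrow> 'a" and \<phi> :: "'a \<Rightarrow> 'b::euclidean_space"
  assumes "open U" "Ck_on 1 f U" "Ck_on 2 \<phi> U" "x \<in> U"
  shows "dir_deriv (lie_deriv f \<phi>) v x
    = dir_deriv \<phi> (dir_deriv f v x) x + dir_deriv (dir_deriv \<phi> v) (f x) x"
proof -
  have d: "\<phi> differentiable (at y)" "dir_deriv \<phi> w differentiable (at y)" "f differentiable (at y)"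
    if "y \<in> U" for y w
    using assms(2,3) that by (simp_all add: numeral_2_eq_2)
  let ?S = "\<lambda>y. \<Sum>e\<in>Basis. (f y \<bullet> e) *\<^sub>R dir_deriv \<phi> e y"
  let ?S' = "\<lambda>v. \<Sum>e\<in>Basis. (f x \<bullet> e) *\<^sub>R dir_deriv (dir_deriv \<phi> e) v x
      + (dir_deriv f v x \<bullet> e) *\<^sub>R dir_deriv \<phi> e x"
  have "(?S has_derivative ?S') (at x)"
    using d[OF assms(4)]
    by (intro has_derivative_sum has_derivative_scaleR bounded_linear.has_derivative[OF bounded_linear_inner_left]
        differentiable_has_derivative)
  then have "(lie_deriv f \<phi> has_derivative ?S') (at x)"
    by (rule has_derivative_transform_within_open[OF _ assms(1,4)])
       (auto simp only: lie_deriv_def intro!: dir_deriv_Basis[OF d(1), symmetric])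
  then have "dir_deriv (lie_deriv f \<phi>) v x = ?S' v" by (rule dir_deriv_eqI)
  also have "\<dots> = (\<Sum>e\<in>Basis. (f x \<bullet> e) *\<^sub>R dir_deriv (dir_deriv \<phi> v) e x)
      + (\<Sum>e\<in>Basis. (dir_deriv f v x \<bullet> e) *\<^sub>R dir_deriv \<phi> e x)"
    by (simp only: sum.distrib dir_deriv_commute[OF assms(1,3,4), of _ v])
  also have "\<dots> = dir_deriv (dir_deriv \<phi> v) (f x) x + dir_deriv \<phi> (dir_deriv f v x) x"
    using dir_deriv_Basis[OF d(1)[OF assms(4)], of "dir_deriv f v x"]
      dir_deriv_Basis[OF d(2)[OF assms(4)], of v "f x"] by simp
  finally show ?thesis by simp
qed

section \<open>Uniform estimates on compact sets\<close>

lemma dir_deriv_bound: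
  fixes \<phi> :: "'a::euclidean_space \<Rightarrow> 'b::real_normed_vector"
  assumes "Ck_on 1 \<phi> U" "compact S" "S \<subseteq> U"
  shows "\<exists>B\<ge>0. \<forall>y\<in>S. \<forall>v. norm (dir_deriv \<phi> v y) \<le> B * norm v"
proof -
  have "\<exists>B. \<forall>y\<in>S. norm (dir_deriv \<phi> e y) \<le> B" for e
  proof -
    have "continuous_on S (dir_deriv \<phi> e)"
      using assms(1) by (intro continuous_on_subset[OF _ assms(3)]) simp
    from compact_imp_bounded[OF compact_continuous_image[OF this assms(2)]]
    show ?thesis unfolding bounded_iff by blast
  qed
  then have "\<exists>B. \<forall>e. \<forall>y\<in>S. norm (dir_deriv \<phi> e y) \<le> B e" by (intro choice) blast
  then obtain B where B: "\<And>e y. y \<in> S \<Longrightarrow> norm (dir_deriv \<phi> e y) \<le> B e" by blast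
  have "norm (dir_deriv \<phi> v y) \<le> (\<Sum>e\<in>Basis. \<bar>B e\<bar>) * norm v" if y: "y \<in> S" for v y
  proof -
    have "\<phi> differentiable (at y)" using assms(1,3) y by auto
    then have "norm (dir_deriv \<phi> v y) = norm (\<Sum>e\<in>Basis. (v \<bullet> e) *\<^sub>R dir_deriv \<phi> e y)"
      using dir_deriv_Basis[of \<phi> y v] by simp
    also have "\<dots> \<le> (\<Sum>e\<in>Basis. norm v * \<bar>B e\<bar>)"
    proof (rule sum_norm_le)
      fix e :: 'a assume e: "e \<in> Basis"
      show "norm ((v \<bullet> e) *\<^sub>R dir_deriv \<phi> e y) \<le> norm v * \<bar>B e\<bar>"
        using Basis_le_norm[OF e, of v] B[OF y, of e] by (auto intro!: mult_mono)
    qed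
    finally show ?thesis by (simp add: sum_distrib_left mult.commute)
  qed
  then show ?thesis by (intro exI[of _ "\<Sum>e\<in>Basis. \<bar>B e\<bar>"]) (auto intro: sum_nonneg)
qed

lemma Ck_on_lipschitz:
  fixes \<phi> :: "'a::euclidean_space \<Rightarrow> 'b::real_normed_vector"
  assumes "Ck_on 1 \<phi> U" "compact S" "convex S" "S \<subseteq> U"
  shows "\<exists>B\<ge>0. \<forall>y\<in>S. \<forall>z\<in>S. norm (\<phi> y - \<phi> z) \<le> B * norm (y - z)"
proof -
  obtain B where B: "B \<ge> 0" "\<And>y v. y \<in> S \<Longrightarrow> norm (dir_deriv \<phi> v y) \<le> B * norm v"
    using dir_deriv_bound[OF assms(1,2,4)] by blast
  have "norm (\<phi> y - \<phi> z) \<le> B * norm (y - z)" if "y \<in> S" "z \<in> S" for y z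
  proof (rule differentiable_bound[OF assms(3) _ _ that])
    show "(\<phi> has_derivative frechet_derivative \<phi> (at x)) (at x within S)" if "x \<in> S" for x
      by (rule has_derivative_at_withinI[OF differentiable_has_derivative]) (use assms(1,4) that in auto)
    show "onorm (frechet_derivative \<phi> (at x)) \<le> B" if "x \<in> S" for x
      using B(2)[OF that] by (rule onorm_le)
  qed
  then show ?thesis using B(1) by blast
qed

text \<open>The Lipschitz bounds for the finitely many basis derivatives make the full derivative
  Lipschitz in operator norm; the mean value inequality for the linearization along the segment then
  produces the square.\<close>

lemma Ck_on_linear_remainder:
  fixes \<phi> :: "'a::euclidean_space \<Rightarrow> 'b::real_normed_vector"
  assumes "Ck_on 2 \<phi> U" "compact S" "convex S" "S \<subseteq> U"
  shows "\<exists>B\<ge>0. \<forall>y\<in>S. \<forall>z\<in>S. norm (\<phi> z - \<phi> y - dir_deriv \<phi> (z - y) y) \<le> B * (norm (z - y))\<^sup>2"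
proof -
  have "\<exists>B\<ge>0. \<forall>y\<in>S. \<forall>z\<in>S. norm (dir_deriv \<phi> e y - dir_deriv \<phi> e z) \<le> B * norm (y - z)" for e
    using assms by (intro Ck_on_lipschitz[of _ U]) (auto simp: numeral_2_eq_2)
  then have "\<exists>L. \<forall>e. L e \<ge> 0 \<and> (\<forall>y\<in>S. \<forall>z\<in>S.
      norm (dir_deriv \<phi> e y - dir_deriv \<phi> e z) \<le> L e * norm (y - z))"
    by (intro choice) blast
  then obtain L where L: "\<And>e. L e \<ge> 0" "\<And>e y z. y \<in> S \<Longrightarrow> z \<in> S \<Longrightarrow>
      norm (dir_deriv \<phi> e y - dir_deriv \<phi> e z) \<le> L e * norm (y - z)"
    by blast
  define B where "B = (\<Sum>e\<in>Basis. L e)"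
  have d: "\<phi> differentiable (at y)" if "y \<in> S" for y
    using assms that by (auto simp: numeral_2_eq_2)
  have lip: "norm (dir_deriv \<phi> v y - dir_deriv \<phi> v z) \<le> B * norm (y - z) * norm v" if yz: "y \<in> S" "z \<in> S" for v y z
  proof -
    have "norm (dir_deriv \<phi> v y - dir_deriv \<phi> v z)
        = norm (\<Sum>e\<in>Basis. (v \<bullet> e) *\<^sub>R (dir_deriv \<phi> e y - dir_deriv \<phi> e z))"
      unfolding dir_deriv_Basis[OF d[OF yz(1)], of v] dir_deriv_Basis[OF d[OF yz(2)], of v]
      by (simp only: scaleR_diff_right sum_subtractf)
    also have "\<dots> \<le> (\<Sum>e\<in>Basis. norm v * (L e * norm (y - z)))"
    proof (rule sum_norm_le)
      fix e :: 'a assume e: "e \<in> Basis"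
      show "norm ((v \<bullet> e) *\<^sub>R (dir_deriv \<phi> e y - dir_deriv \<phi> e z)) \<le> norm v * (L e * norm (y - z))"
        using Basis_le_norm[OF e, of v] L[of e] L(2)[OF yz, of e] by (auto intro!: mult_mono)
    qed
    finally show ?thesis by (simp add: B_def sum_distrib_left sum_distrib_right mult_ac)
  qed
  have "norm (\<phi> z - \<phi> y - dir_deriv \<phi> (z - y) y) \<le> B * (norm (z - y))\<^sup>2" if yz: "y \<in> S" "z \<in> S" for y z
  proof -
    have seg: "closed_segment y z \<subseteq> S" using yz assms(3) by (simp add: closed_segment_subset)
    have "norm (\<phi> z - \<phi> y - frechet_derivative \<phi> (at y) (z - y)) \<le> norm (z - y) * (B * norm (z - y))"
    proof (rule differentiable_bound_linearization[where S = "closed_segment y z" and ?x0.0 = y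
          and f' = "\<lambda>x. frechet_derivative \<phi> (at x)"])
      show "y + t *\<^sub>R (z - y) \<in> closed_segment y z" if "t \<in> {0..1}" for t
      proof -
        have "y + t *\<^sub>R (z - y) = (1 - t) *\<^sub>R y + t *\<^sub>R z" by (simp add: algebra_simps)
        then show ?thesis unfolding in_segment using that by (intro exI[of _ t]) simp
      qed
      show "(\<phi> has_derivative frechet_derivative \<phi> (at x)) (at x within closed_segment y z)"
        if "x \<in> closed_segment y z" for x
        by (rule has_derivative_at_withinI[OF differentiable_has_derivative[OF d[OF subsetD[OF seg that]]]])
      show "onorm (frechet_derivative \<phi> (at x) - frechet_derivative \<phi> (at y)) \<le> B * norm (z - y)"
        if "x \<in> closed_segment y z" for x
      proof (rule onorm_le)
        fix v
        have "norm (dir_deriv \<phi> v x - dir_deriv \<phi> v y) \<le> B * norm (x - y) * norm v"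
          by (rule lip[OF subsetD[OF seg that] yz(1)])
        also have "\<dots> \<le> B * norm (z - y) * norm v"
          using segment_bound1[OF that] L(1)
          by (intro mult_right_mono mult_left_mono) (auto simp: B_def norm_minus_commute sum_nonneg)
        finally show "norm ((frechet_derivative \<phi> (at x) - frechet_derivative \<phi> (at y)) v) \<le> B * norm (z - y) * norm v"
          by simp
      qed
    qed auto
    then show ?thesis by (simp add: power2_eq_square mult_ac)
  qed
  then show ?thesis using L(1) by (intro exI[of _ B]) (auto simp: B_def sum_nonneg)
qed

section \<open>Taylor expansion along a curve with small defect\<close>

lemma has_vector_derivative_exp_sum:
  "((\<lambda>t. \<Sum>k<Suc m. (t ^ k / fact k) *\<^sub>R w k) has_vector_derivative
     (\<Sum>k<m. (t ^ k / fact k) *\<^sub>R w (Suc k))) (at t within S)"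
proof (induction m)
  case 0
  then show ?case by simp
next
  case (Suc m)
  have "((\<lambda>t. t ^ Suc m / fact (Suc m)) has_real_derivative t ^ m / fact m) (at t within S)"
    using DERIV_cdivide[OF DERIV_pow[of "Suc m" t S], of "fact (Suc m)"] by (simp del: power_Suc of_nat_Suc)
  then have "((\<lambda>t. (t ^ Suc m / fact (Suc m)) *\<^sub>R w (Suc m)) has_vector_derivative (t ^ m / fact m) *\<^sub>R w (Suc m))
      (at t within S)"
    using has_vector_derivative_scaleR[OF _ has_vector_derivative_const, of "\<lambda>t. t ^ Suc m / fact (Suc m)" "t ^ m / fact m" t S "w (Suc m)"]
    by simp
  from has_vector_derivative_add[OF Suc this] show ?case by (simp del: power_Suc fact_Suc)
qed

text \<open>The mean value inequality on the segment from 0 to \<open>t\<close> gains one power.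
  Absolute values are needed because the interval may extend to both sides of 0.\<close>

lemma norm_le_power_Suc:
  fixes E :: "real \<Rightarrow> 'b::real_normed_vector"
  assumes ab: "a \<le> 0" "0 \<le> b" and E0: "E 0 = 0"
    and E: "\<And>t. t \<in> {a..b} \<Longrightarrow> (E has_vector_derivative E' t) (at t within {a..b})"
    and E': "\<And>t. t \<in> {a..b} \<Longrightarrow> norm (E' t) \<le> K * \<bar>t\<bar> ^ m" and K: "K \<ge> 0"
    and t: "t \<in> {a..b}"
  shows "norm (E t) \<le> K * \<bar>t\<bar> ^ Suc m"
proof -
  have seg: "closed_segment 0 t \<subseteq> {a..b}"
    using ab t by (intro closed_segment_subset) auto
  have "norm (E t - E 0) \<le> (K * \<bar>t\<bar> ^ m) * norm (t - 0)"
  proof (rule differentiable_bound[where S = "closed_segment 0 t" and f' = "\<lambda>x h. h *\<^sub>R E' x"])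
    show "(E has_derivative (\<lambda>h. h *\<^sub>R E' x)) (at x within closed_segment 0 t)"
      if "x \<in> closed_segment 0 t" for x
      using E[of x] seg that has_derivative_subset unfolding has_vector_derivative_def by blast
    show "onorm (\<lambda>h. h *\<^sub>R E' x) \<le> K * \<bar>t\<bar> ^ m" if x: "x \<in> closed_segment 0 t" for x
    proof (rule onorm_le)
      fix h :: real
      have "norm (E' x) \<le> K * \<bar>x\<bar> ^ m" using E' seg x by blast
      also have "\<dots> \<le> K * \<bar>t\<bar> ^ m"
        using segment_bound1[OF x] K by (intro mult_left_mono power_mono) auto
      finally show "norm (h *\<^sub>R E' x) \<le> K * \<bar>t\<bar> ^ m * norm h"
        by (simp add: mult.commute mult_left_mono)
    qed
  qed auto
  then show ?thesis by (simp add: E0 mult_ac)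
qed

text \<open>Induction on \<open>m\<close>: the derivative of the error for \<open>\<phi>\<close> is
  the error of one order less for \<open>lie_deriv f \<phi>\<close>, plus the derivative of
  \<open>\<phi>\<close> applied to the defect of \<open>u\<close>. Integrating gains one order, so a
  defect of order \<open>n\<close> supports expansions up to \<open>m = n + 1\<close>. Every step
  costs one derivative of \<open>\<phi>\<close>, and \<open>f\<close> needs one derivative fewer
  than \<open>\<phi>\<close>.\<close>

lemma flow_taylor:
  fixes u :: "real \<Rightarrow> 'a::euclidean_space" and \<phi> :: "'a \<Rightarrow> 'b::real_normed_vector"
  assumes U: "open U" and ab: "-1 \<le> a" "a \<le> 0" "0 \<le> b" "b \<le> 1" and u0: "u 0 = x"
    and uU: "\<And>t. t \<in> {a..b} \<Longrightarrow> u t \<in> U"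
    and u: "\<And>t. t \<in> {a..b} \<Longrightarrow> (u has_vector_derivative u' t) (at t within {a..b})"
    and u': "\<And>t. t \<in> {a..b} \<Longrightarrow> norm (u' t - f (u t)) \<le> C * \<bar>t\<bar> ^ n"
    and "Ck_on m \<phi> U" "Ck_on (m - 1) f U" "m \<le> Suc n"
  shows "\<exists>K\<ge>0. \<forall>t\<in>{a..b}. norm (\<phi> (u t) - (\<Sum>k<m. (t ^ k / fact k) *\<^sub>R (lie_deriv f ^^ k) \<phi> x)) \<le> K * \<bar>t\<bar> ^ m"
proof -
  have cu: "continuous_on {a..b} u"
    unfolding continuous_on_eq_continuous_within using has_vector_derivative_continuous[OF u] by simp
  show ?thesis using assms(10-12)
  proof (induction m arbitrary: \<phi>)
    case 0
    have "continuous_on U \<phi>" using 0(1) by simp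
    moreover have "u ` {a..b} \<subseteq> U" using uU by auto
    ultimately have "continuous_on {a..b} (\<lambda>t. \<phi> (u t))" by (rule continuous_on_compose2[OF _ cu])
    from compact_imp_bounded[OF compact_continuous_image[OF this]]
    obtain B where "\<And>t. t \<in> {a..b} \<Longrightarrow> norm (\<phi> (u t)) \<le> B" unfolding bounded_iff by fastforce
    then show ?case by (intro exI[of _ "max B 0"]) (auto simp: le_max_iff_disj)
  next
    case (Suc m)
    have f: "Ck_on m f U" using Suc.prems(2) by simp
    have "Ck_on m (lie_deriv f \<phi>) U" using Ck_on_lie_deriv[OF U f Suc.prems(1)] .
    moreover have "Ck_on (m - 1) f U" using f by (rule Ck_on_mono) simp
    ultimately obtain K where K: "K \<ge> 0" "\<And>t. t \<in> {a..b} \<Longrightarrow>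
        norm (lie_deriv f \<phi> (u t) - (\<Sum>k<m. (t ^ k / fact k) *\<^sub>R (lie_deriv f ^^ k) (lie_deriv f \<phi>) x)) \<le> K * \<bar>t\<bar> ^ m"
      using Suc.IH[of "lie_deriv f \<phi>"] Suc_leD[OF Suc.prems(3)] by blast
    have "\<exists>B\<ge>0. \<forall>y\<in>u ` {a..b}. \<forall>v. norm (dir_deriv \<phi> v y) \<le> B * norm v"
    proof (rule dir_deriv_bound)
      show "Ck_on 1 \<phi> U" using Suc.prems(1) by (rule Ck_on_mono) simp
      show "compact (u ` {a..b})" by (rule compact_continuous_image[OF cu]) simp
      show "u ` {a..b} \<subseteq> U" using uU by auto
    qed
    then obtain B where B: "B \<ge> 0" "\<And>t v. t \<in> {a..b} \<Longrightarrow> norm (dir_deriv \<phi> v (u t)) \<le> B * norm v"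
      by auto
    define w where "w k = (lie_deriv f ^^ k) \<phi> x" for k
    define E where "E t = \<phi> (u t) - (\<Sum>k<Suc m. (t ^ k / fact k) *\<^sub>R w k)" for t
    define E' where "E' t = dir_deriv \<phi> (u' t) (u t) - (\<Sum>k<m. (t ^ k / fact k) *\<^sub>R w (Suc k))" for t
    have d: "\<phi> differentiable (at (u t))" if "t \<in> {a..b}" for t
      using Suc.prems(1) uU[OF that] by auto
    have E: "(E has_vector_derivative E' t) (at t within {a..b})" if "t \<in> {a..b}" for t
      unfolding E_def E'_def
      using vector_derivative_diff_chain_within[OF u[OF that] has_derivative_at_withinI[OF differentiable_has_derivative[OF d[OF that]]]]
      by (intro has_vector_derivative_diff has_vector_derivative_exp_sum) (simp add: o_def)
    have E': "norm (E' t) \<le> (K + B * \<bar>C\<bar>) * \<bar>t\<bar> ^ m" if t: "t \<in> {a..b}" for t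
    proof -
      have 1: "E' t = (lie_deriv f \<phi> (u t) - (\<Sum>k<m. (t ^ k / fact k) *\<^sub>R w (Suc k))) + dir_deriv \<phi> (u' t - f (u t)) (u t)"
        unfolding E'_def lie_deriv_def by (simp add: linear_diff[OF linear_dir_deriv[OF d[OF t]]])
      have 2: "norm (lie_deriv f \<phi> (u t) - (\<Sum>k<m. (t ^ k / fact k) *\<^sub>R w (Suc k))) \<le> K * \<bar>t\<bar> ^ m"
        using K(2)[OF t] by (simp add: w_def funpow_Suc_right del: funpow.simps)
      have 3: "norm (dir_deriv \<phi> (u' t - f (u t)) (u t)) \<le> B * \<bar>C\<bar> * \<bar>t\<bar> ^ m"
      proof -
        \<comment> \<open>The defect has order \<open>n\<close> with \<open>m \<le> n\<close>;
          weakening it to order \<open>m\<close> is where the restriction to [-1, 1] enters.\<close>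
        have "\<bar>t\<bar> \<le> 1" using t ab by auto
        then have "C * \<bar>t\<bar> ^ n \<le> \<bar>C\<bar> * \<bar>t\<bar> ^ m"
          using Suc.prems(3) by (intro mult_mono power_decreasing) auto
        then have "norm (u' t - f (u t)) \<le> \<bar>C\<bar> * \<bar>t\<bar> ^ m" using u'[OF t] by linarith
        then have "B * norm (u' t - f (u t)) \<le> B * (\<bar>C\<bar> * \<bar>t\<bar> ^ m)"
          using B(1) by (intro mult_left_mono) auto
        then show ?thesis using B(2)[OF t, of "u' t - f (u t)"] by (simp add: mult.assoc)
      qed
      show ?thesis unfolding 1 distrib_right by (rule norm_triangle_mono[OF 2 3])
    qed
    have E0: "E 0 = 0" by (simp add: E_def w_def u0 sum.lessThan_Suc_shift del: sum.lessThan_Suc)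
    have "norm (E t) \<le> (K + B * \<bar>C\<bar>) * \<bar>t\<bar> ^ Suc m" if "t \<in> {a..b}" for t
      by (rule norm_le_power_Suc[OF ab(2,3) E0 E E' _ that]) (use K(1) B(1) in auto)
    moreover have "K + B * \<bar>C\<bar> \<ge> 0" using K(1) B(1) by auto
    ultimately show ?case unfolding E_def w_def by blast
  qed
qed

section \<open>Asymptotic expansions in the stepsize\<close>

definition vanishes :: "nat \<Rightarrow> (real \<Rightarrow> 'a::real_normed_vector) \<Rightarrow> bool" where
  "vanishes n u \<longleftrightarrow> (\<exists>K. \<forall>\<^sub>F h in at_right 0. norm (u h) \<le> K * h ^ n)"

text \<open>Only the values \<open>G k\<close> with \<open>k < n\<close> matter, so a coefficient
  sequence may be written by any formula that is right on this range.\<close>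

definition expands :: "nat \<Rightarrow> (real \<Rightarrow> 'a::real_normed_vector) \<Rightarrow> (nat \<Rightarrow> 'a) \<Rightarrow> bool" where
  "expands n u G \<longleftrightarrow> vanishes n (\<lambda>h. u h - (\<Sum>k<n. h ^ k *\<^sub>R G k))"

lemma eventually_small: "c > 0 \<Longrightarrow> \<forall>\<^sub>F h in at_right 0. 0 < h \<and> h < (c::real)"
  by (rule eventually_at_rightI[of 0 c]) auto

lemma vanishesI: "\<forall>\<^sub>F h in at_right 0. norm (u h) \<le> K * h ^ n \<Longrightarrow> vanishes n u"
  unfolding vanishes_def by blast

lemma vanishesD:
  assumes "vanishes n u"
  shows "\<exists>K>0. \<forall>\<^sub>F h in at_right 0. h > 0 \<and> norm (u h) \<le> K * h ^ n"
proof -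
  obtain K where "\<forall>\<^sub>F h in at_right 0. norm (u h) \<le> K * h ^ n" using assms unfolding vanishes_def by blast
  then have "\<forall>\<^sub>F h in at_right 0. h > 0 \<and> norm (u h) \<le> (\<bar>K\<bar> + 1) * h ^ n"
    using eventually_small[of 1, simplified]
  proof eventually_elim
    case (elim h)
    then have "K * h ^ n \<le> (\<bar>K\<bar> + 1) * h ^ n" by (intro mult_right_mono) auto
    with elim show ?case by linarith
  qed
  then show ?thesis by (intro exI[of _ "\<bar>K\<bar> + 1"]) auto
qed

lemma vanishes_zero [simp]: "vanishes n (\<lambda>h. 0)"
  by (rule vanishesI[of _ 0]) simp

lemma vanishes_add:
  assumes "vanishes n u" "vanishes n v"
  shows "vanishes n (\<lambda>h. u h + v h)"
proof -
  obtain K L where "\<forall>\<^sub>F h in at_right 0. h > 0 \<and> norm (u h) \<le> K * h ^ n"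
    "\<forall>\<^sub>F h in at_right 0. h > 0 \<and> norm (v h) \<le> L * h ^ n"
    using vanishesD[OF assms(1)] vanishesD[OF assms(2)] by blast
  then have "\<forall>\<^sub>F h in at_right 0. norm (u h + v h) \<le> (K + L) * h ^ n"
    by eventually_elim (auto simp: distrib_right intro: order_trans[OF norm_triangle_ineq])
  then show ?thesis by (rule vanishesI)
qed

lemma vanishes_sum: "(\<And>i. i \<in> I \<Longrightarrow> vanishes n (u i)) \<Longrightarrow> vanishes n (\<lambda>h. \<Sum>i\<in>I. u i h)"
  by (induction I rule: infinite_finite_induct) (auto intro: vanishes_add)

lemma vanishes_bilinear:
  assumes "bounded_bilinear B" "vanishes m u" "vanishes n v"
  shows "vanishes (m + n) (\<lambda>h. B (u h) (v h))"
proof -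
  interpret bounded_bilinear B by fact
  obtain C where C: "C > 0" "\<And>x y. norm (B x y) \<le> norm x * norm y * C" using pos_bounded by blast
  obtain K L where "K > 0" "L > 0" "\<forall>\<^sub>F h in at_right 0. h > 0 \<and> norm (u h) \<le> K * h ^ m"
    "\<forall>\<^sub>F h in at_right 0. h > 0 \<and> norm (v h) \<le> L * h ^ n"
    using vanishesD[OF assms(2)] vanishesD[OF assms(3)] by blast
  from this(3,4) have "\<forall>\<^sub>F h in at_right 0. norm (B (u h) (v h)) \<le> (K * L * C) * h ^ (m + n)"
  proof eventually_elim
    case (elim h)
    have "norm (B (u h) (v h)) \<le> norm (u h) * norm (v h) * C" by (rule C(2))
    also have "\<dots> \<le> (K * h ^ m) * (L * h ^ n) * C"
      using elim C(1) \<open>K > 0\<close> by (intro mult_right_mono mult_mono) auto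
    finally show ?case by (simp add: power_add mult_ac)
  qed
  then show ?thesis by (rule vanishesI)
qed

lemma vanishes_bounded_linear:
  assumes "bounded_linear T" "vanishes n u"
  shows "vanishes n (\<lambda>h. T (u h))"
proof -
  interpret bounded_linear T by fact
  obtain C where C: "C > 0" "\<And>x. norm (T x) \<le> norm x * C" using pos_bounded by blast
  obtain K where "\<forall>\<^sub>F h in at_right 0. h > 0 \<and> norm (u h) \<le> K * h ^ n"
    using vanishesD[OF assms(2)] by blast
  then have "\<forall>\<^sub>F h in at_right 0. norm (T (u h)) \<le> (K * C) * h ^ n"
  proof eventually_elim
    case (elim h)
    have "norm (T (u h)) \<le> norm (u h) * C" by (rule C(2))
    also have "\<dots> \<le> (K * h ^ n) * C"
      using elim C(1) by (intro mult_right_mono) auto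
    finally show ?case by (simp add: mult_ac)
  qed
  then show ?thesis by (rule vanishesI)
qed

lemma vanishes_minus: "vanishes n u \<Longrightarrow> vanishes n (\<lambda>h. - u h)"
  by (rule vanishes_bounded_linear[OF bounded_linear_minus[OF bounded_linear_ident]])

lemma vanishes_diff: "vanishes n u \<Longrightarrow> vanishes n v \<Longrightarrow> vanishes n (\<lambda>h. u h - v h)"
  using vanishes_add[OF _ vanishes_minus, of n u v] by simp

lemma vanishes_mono:
  assumes "vanishes m u" "n \<le> m"
  shows "vanishes n u"
proof -
  obtain K where K: "K > 0" "\<forall>\<^sub>F h in at_right 0. h > 0 \<and> norm (u h) \<le> K * h ^ m"
    using vanishesD[OF assms(1)] by blast
  from K(2) eventually_small[of 1, simplified] have "\<forall>\<^sub>F h in at_right 0. norm (u h) \<le> K * h ^ n"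
  proof eventually_elim
    case (elim h)
    then have "h ^ m \<le> h ^ n" using assms(2) by (intro power_decreasing) auto
    then have "K * h ^ m \<le> K * h ^ n" using K(1) by (intro mult_left_mono) auto
    with elim show ?case by linarith
  qed
  then show ?thesis by (rule vanishesI)
qed

lemma vanishes_power: "n \<le> k \<Longrightarrow> vanishes n (\<lambda>h. h ^ k *\<^sub>R w)"
proof (rule vanishes_mono)
  show "vanishes k (\<lambda>h. h ^ k *\<^sub>R w)"
    by (rule vanishesI[of _ "norm w"], rule eventually_mono[OF eventually_small[of 1]]) auto
qed

lemma vanishes_scale: "vanishes n u \<Longrightarrow> vanishes (k + n) (\<lambda>h. h ^ k *\<^sub>R u h)"
  using vanishes_bilinear[OF bounded_bilinear_scaleR vanishes_power[of k k "1::real"], of n u] by simp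

lemma vanishes_eventually:
  assumes "vanishes n u" "\<forall>\<^sub>F h in at_right 0. u h = v h"
  shows "vanishes n v"
proof -
  obtain K where "\<forall>\<^sub>F h in at_right 0. h > 0 \<and> norm (u h) \<le> K * h ^ n"
    using vanishesD[OF assms(1)] by blast
  with assms(2) have "\<forall>\<^sub>F h in at_right 0. norm (v h) \<le> K * h ^ n" by eventually_elim auto
  then show ?thesis by (rule vanishesI)
qed

lemma vanishes_Suc_tendsto:
  assumes "vanishes (Suc n) u"
  shows "(u \<longlongrightarrow> 0) (at_right 0)"
proof -
  have "vanishes 1 u" using assms by (rule vanishes_mono) simp
  from vanishesD[OF this] obtain K where "\<forall>\<^sub>F h in at_right 0. h > 0 \<and> norm (u h) \<le> K * h ^ 1"
    by blast
  then have "\<forall>\<^sub>F h in at_right 0. norm (u h) \<le> K * h" by eventually_elim simp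
  moreover have "((\<lambda>h. K * h) \<longlongrightarrow> K * 0) (at_right 0)" by (intro tendsto_intros)
  ultimately show ?thesis by (intro Lim_null_comparison[of u "\<lambda>h. K * h"]) simp_all
qed

lemma vanishes_divide:
  assumes "vanishes (k + n) (\<lambda>h. h ^ k *\<^sub>R u h)"
  shows "vanishes n u"
proof -
  obtain K where "\<forall>\<^sub>F h in at_right 0. h > 0 \<and> norm (h ^ k *\<^sub>R u h) \<le> K * h ^ (k + n)"
    using vanishesD[OF assms] by blast
  then have "\<forall>\<^sub>F h in at_right 0. norm (u h) \<le> K * h ^ n"
    by eventually_elim (auto simp: power_add mult.left_commute[of _ "_ ^ k"])
  then show ?thesis by (rule vanishesI)
qed

section \<open>Algebra of truncated expansions\<close>

lemma expands_cong: "expands n u G \<Longrightarrow> (\<And>k. k < n \<Longrightarrow> G k = H k) \<Longrightarrow> expands n u H"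
  by (simp add: expands_def)

lemma expands_eventually:
  assumes "expands n u G" "\<forall>\<^sub>F h in at_right 0. u h = v h"
  shows "expands n v G"
  unfolding expands_def
  by (rule vanishes_eventually[OF assms(1)[unfolded expands_def] eventually_mono[OF assms(2)]]) simp

lemma expands_0_iff: "expands 0 u G \<longleftrightarrow> vanishes 0 u"
  by (simp add: expands_def)

lemma expands_zero_iff: "expands n u (\<lambda>k. 0) \<longleftrightarrow> vanishes n u"
  by (simp add: expands_def)

lemma expands_add: "expands n u G \<Longrightarrow> expands n v H \<Longrightarrow> expands n (\<lambda>h. u h + v h) (\<lambda>k. G k + H k)"
  unfolding expands_def
  by (drule (1) vanishes_add) (simp add: scaleR_add_right sum.distrib algebra_simps)

lemma expands_bounded_linear:
  assumes "bounded_linear T" "expands n u G"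
  shows "expands n (\<lambda>h. T (u h)) (\<lambda>k. T (G k))"
proof -
  interpret bounded_linear T by fact
  show ?thesis
    using vanishes_bounded_linear[OF assms(1) assms(2)[unfolded expands_def]]
    by (simp add: expands_def diff sum scaleR)
qed

lemma expands_diff: "expands n u G \<Longrightarrow> expands n v H \<Longrightarrow> expands n (\<lambda>h. u h - v h) (\<lambda>k. G k - H k)"
  unfolding expands_def
  by (drule (1) vanishes_diff) (simp add: scaleR_diff_right sum_subtractf algebra_simps)

lemma expands_sum:
  "(\<And>i. i \<in> I \<Longrightarrow> expands n (u i) (G i)) \<Longrightarrow> expands n (\<lambda>h. \<Sum>i\<in>I. u i h) (\<lambda>k. \<Sum>i\<in>I. G i k)"
  by (induction I rule: infinite_finite_induct) (auto simp: expands_zero_iff intro: expands_add)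

lemma expands_mono:
  assumes "expands m u G" "n \<le> m"
  shows "expands n u G"
proof -
  have "vanishes n (\<lambda>h. (u h - (\<Sum>k<m. h ^ k *\<^sub>R G k)) + (\<Sum>k\<in>{n..<m}. h ^ k *\<^sub>R G k))"
    using assms unfolding expands_def
    by (intro vanishes_add vanishes_sum vanishes_power) (auto elim: vanishes_mono)
  moreover have "(\<Sum>k<m. h ^ k *\<^sub>R G k) = (\<Sum>k<n. h ^ k *\<^sub>R G k) + (\<Sum>k\<in>{n..<m}. h ^ k *\<^sub>R G k)" for h :: real
    using assms(2) by (metis (no_types) lessThan_atLeast0 sum.atLeastLessThan_concat zero_le)
  ultimately show ?thesis by (simp add: expands_def)
qed

lemma expands_vanishes_diff: "expands n u G \<Longrightarrow> expands n v G \<Longrightarrow> vanishes n (\<lambda>h. u h - v h)"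
  by (drule (1) expands_diff) (simp add: expands_zero_iff)

lemma expands_add_vanishes: "expands n u G \<Longrightarrow> vanishes n (\<lambda>h. v h - u h) \<Longrightarrow> expands n v G"
  using expands_add[of n u G "\<lambda>h. v h - u h" "\<lambda>_. 0"] by (simp add: expands_zero_iff)

lemma expands_const: "expands n (\<lambda>h. w) (\<lambda>k. if k = 0 then w else 0)"
proof (cases n)
  case 0
  then show ?thesis by (auto simp: expands_def intro!: vanishesI[of _ "norm w"])
next
  case (Suc m)
  have "(\<Sum>k<Suc m. h ^ k *\<^sub>R (if k = 0 then w else 0)) = w" for h :: real
    by (simp add: sum.lessThan_Suc_shift del: sum.lessThan_Suc)
  then show ?thesis unfolding expands_def Suc by simp
qed

lemma expands_scale:
  assumes "expands n u G"
  shows "expands (Suc n) (\<lambda>h. h *\<^sub>R u h) (case_nat 0 G)"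
  using vanishes_scale[OF assms[unfolded expands_def], of 1]
  by (simp add: expands_def sum.lessThan_Suc_shift scaleR_sum_right scaleR_diff_right del: sum.lessThan_Suc)

lemma expands_vanishes_0: "expands n u G \<Longrightarrow> vanishes 0 u"
  using expands_mono[of n u G 0] by (simp add: expands_0_iff)

text \<open>Cauchy product. With the truncations P of \<open>u\<close> and Q of \<open>v\<close>,
  the error consists of B(u - P, v), B(P, v - Q) and the terms of B(P, Q) of total degree at least
  \<open>n\<close>.\<close>

lemma expands_bilinear:
  assumes B: "bounded_bilinear B" and u: "expands n u G" and v: "expands n v H"
  shows "expands n (\<lambda>h. B (u h) (v h)) (\<lambda>k. \<Sum>i\<le>k. B (G i) (H (k - i)))"
proof -
  interpret bounded_bilinear B by fact
  let ?P = "\<lambda>h::real. \<Sum>k<n. h ^ k *\<^sub>R G k" and ?Q = "\<lambda>h::real. \<Sum>k<n. h ^ k *\<^sub>R H k"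
  let ?T = "\<lambda>h::real. \<lambda>(i, j). h ^ (i + j) *\<^sub>R B (G i) (H j)"
  let ?R = "({..<n} \<times> {..<n}) - {(i, j). i + j < n}"
  have P0: "vanishes 0 ?P" by (intro vanishes_sum vanishes_power) auto
  have "vanishes n (\<lambda>h. B (u h - ?P h) (v h))"
    using vanishes_bilinear[OF B u[unfolded expands_def] expands_vanishes_0[OF v]] by simp
  moreover have "vanishes n (\<lambda>h. B (?P h) (v h - ?Q h))"
    using vanishes_bilinear[OF B P0 v[unfolded expands_def]] by simp
  moreover have "vanishes n (\<lambda>h. sum (?T h) ?R)"
    by (intro vanishes_sum) (auto intro!: vanishes_power)
  ultimately have *: "vanishes n (\<lambda>h. B (u h - ?P h) (v h) + B (?P h) (v h - ?Q h) + sum (?T h) ?R)"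
    by (intro vanishes_add)
  have "B (u h - ?P h) (v h) + B (?P h) (v h - ?Q h) + sum (?T h) ?R
      = B (u h) (v h) - (\<Sum>k<n. h ^ k *\<^sub>R (\<Sum>i\<le>k. B (G i) (H (k - i))))" for h
  proof -
    have fin: "finite {(i, j). i + j < n}" "{(i, j). i + j < n} \<subseteq> {..<n} \<times> {..<n}"
      by (auto intro: finite_subset[of _ "{..<n} \<times> {..<n}"])
    have "B (?P h) (?Q h) = (\<Sum>i<n. \<Sum>j<n. h ^ (i + j) *\<^sub>R B (G i) (H j))"
      unfolding sum_left unfolding sum_right
      by (simp add: scaleR_left scaleR_right power_add mult.commute)
    also have "\<dots> = sum (?T h) ({..<n} \<times> {..<n})" by (rule sum.cartesian_product)
    also have "\<dots> = sum (?T h) ?R + sum (?T h) {(i, j). i + j < n}"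
      using fin by (intro sum.subset_diff) auto
    also have "sum (?T h) {(i, j). i + j < n} = (\<Sum>k<n. \<Sum>i\<le>k. h ^ (i + (k - i)) *\<^sub>R B (G i) (H (k - i)))"
      by (rule sum.triangle_reindex)
    also have "\<dots> = (\<Sum>k<n. h ^ k *\<^sub>R (\<Sum>i\<le>k. B (G i) (H (k - i))))"
      by (simp add: scaleR_sum_right)
    finally show ?thesis by (simp add: diff_left diff_right)
  qed
  with * show ?thesis by (simp add: expands_def)
qed

text \<open>Once the lower coefficients are known to vanish, dividing by \<open>h ^ k\<close> and
  letting \<open>h\<close> tend to 0 isolates \<open>G k\<close>. This later turns evenness and
  realness of a coefficient function into statements about its Taylor coefficients.\<close>

lemma expands_unique:
  assumes "expands n (\<lambda>h. 0) G" "k < n"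
  shows "G k = 0"
  using assms(2)
proof (induction k rule: less_induct)
  case (less k)
  have "expands (k + 1) (\<lambda>h. 0) G" using assms(1) less.prems by (auto intro: expands_mono)
  then have "vanishes (k + 1) (\<lambda>h. - (h ^ k *\<^sub>R G k))"
    using less by (simp add: expands_def)
  then have "vanishes (k + 1) (\<lambda>h. h ^ k *\<^sub>R G k)" using vanishes_minus by fastforce
  then have "((\<lambda>h::real. G k) \<longlongrightarrow> 0) (at_right 0)"
    using vanishes_Suc_tendsto[of 0] vanishes_divide[of k 1 "\<lambda>h. G k"] by simp
  then show ?case by (simp add: tendsto_const_iff)
qed

text \<open>The bound is required for both signs of \<open>t\<close> because the factor
  \<open>c\<close> will be an arbitrary real node.\<close>

lemma expands_dilate:
  assumes "\<epsilon> > 0" "\<And>t. \<bar>t\<bar> \<le> \<epsilon> \<Longrightarrow> norm (u t - (\<Sum>k<n. t ^ k *\<^sub>R G k)) \<le> K * \<bar>t\<bar> ^ n"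
  shows "expands n (\<lambda>h. u (c * h)) (\<lambda>k. c ^ k *\<^sub>R G k)"
proof -
  have "\<epsilon> / (\<bar>c\<bar> + 1) > 0" using assms(1) by auto
  from eventually_small[OF this]
  have "\<forall>\<^sub>F h in at_right 0. norm (u (c * h) - (\<Sum>k<n. h ^ k *\<^sub>R (c ^ k *\<^sub>R G k))) \<le> (K * \<bar>c\<bar> ^ n) * h ^ n"
  proof eventually_elim
    case (elim h)
    have "\<bar>c * h\<bar> \<le> (\<bar>c\<bar> + 1) * h" using elim by (auto simp: abs_mult)
    also have "\<dots> \<le> \<epsilon>" using elim by (simp add: field_simps)
    finally show ?case using assms(2)[of "c * h"] elim
      by (simp add: power_mult_distrib abs_mult mult_ac)
  qed
  then show ?thesis unfolding expands_def by (rule vanishesI)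
qed

lemma expands_scale_power:
  assumes "expands n u G"
  shows "expands (n + j) (\<lambda>h. h ^ j *\<^sub>R u h) (\<lambda>k. if k < j then 0 else G (k - j))"
proof (induction j)
  case 0
  then show ?case using assms by simp
next
  case (Suc j)
  have "expands (n + Suc j) (\<lambda>h. h ^ Suc j *\<^sub>R u h) (case_nat 0 (\<lambda>k. if k < j then 0 else G (k - j)))"
    using expands_scale[OF Suc] by simp
  then show ?case by (rule expands_cong) (simp split: nat.split)
qed

lemma expands_polynomial:
  "n \<le> N \<Longrightarrow> expands n (\<lambda>h. \<Sum>k<N. (c * h) ^ k *\<^sub>R w k) (\<lambda>k. c ^ k *\<^sub>R w k)"
  by (rule expands_mono[of N]) (simp_all add: expands_def power_mult_distrib mult.commute)

section \<open>Expansions along the exact solution and along its Taylor polynomial\<close>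

text \<open>An exact solution has zero defect, so \<open>flow_taylor\<close> applies with constant
  0. The interval lies to the right of \<open>xn\<close>, since \<open>xn\<close> may be the left
  end of the interval on which the solution is given.\<close>

lemma expands_flow:
  fixes f :: "'a::euclidean_space \<Rightarrow> 'a" and \<phi> :: "'a \<Rightarrow> 'b::real_normed_vector"
  assumes "open U" and sol: "solves_ivp f U x0 X y0 y" and xn: "xn \<in> {x0..<X}"
    and "Ck_on m \<phi> U" "Ck_on (m - 1) f U"
  shows "expands m (\<lambda>h. \<phi> (y (xn + h))) (\<lambda>k. (1 / fact k) *\<^sub>R (lie_deriv f ^^ k) \<phi> (y xn))"
proof -
  define \<epsilon> where "\<epsilon> = min 1 (X - xn)"
  have e: "0 < \<epsilon>" "\<epsilon> \<le> 1" "xn + \<epsilon> \<le> X" using xn by (auto simp: \<epsilon>_def)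
  have y: "y z \<in> U" "(y has_vector_derivative f (y z)) (at z within {x0..X})" if "z \<in> {x0..X}" for z
    using sol that unfolding solves_ivp_def by blast+
  have d: "((\<lambda>t. y (xn + t)) has_vector_derivative f (y (xn + t))) (at t within {0..\<epsilon>})"
    if "t \<in> {0..\<epsilon>}" for t
  proof -
    have im: "(\<lambda>t. xn + t) ` {0..\<epsilon>} \<subseteq> {x0..X}" using xn e by auto
    have "((\<lambda>t. xn + t) has_vector_derivative 1) (at t within {0..\<epsilon>})"
      by (auto intro!: derivative_eq_intros)
    moreover have "(y has_derivative (\<lambda>h. h *\<^sub>R f (y (xn + t)))) (at (xn + t) within (\<lambda>t. xn + t) ` {0..\<epsilon>})"
    proof (rule has_derivative_subset[OF _ im])
      have "xn + t \<in> {x0..X}" using im that by blast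
      then show "(y has_derivative (\<lambda>h. h *\<^sub>R f (y (xn + t)))) (at (xn + t) within {x0..X})"
        using y(2) unfolding has_vector_derivative_def by simp
    qed
    ultimately show ?thesis
      using vector_derivative_diff_chain_within[of "\<lambda>t. xn + t" 1 t "{0..\<epsilon>}" y "\<lambda>h. h *\<^sub>R f (y (xn + t))"]
      by (simp add: o_def)
  qed
  have "\<exists>K\<ge>0. \<forall>t\<in>{0..\<epsilon>}. norm (\<phi> (y (xn + t)) - (\<Sum>k<m. (t ^ k / fact k) *\<^sub>R (lie_deriv f ^^ k) \<phi> (y xn)))
      \<le> K * \<bar>t\<bar> ^ m"
    by (rule flow_taylor[OF assms(1) _ _ _ _ _ _ d, where C = 0 and n = m])
       (use assms(4,5) e xn y(1) in auto)
  then obtain K where K: "\<And>t. t \<in> {0..\<epsilon>} \<Longrightarrow>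
      norm (\<phi> (y (xn + t)) - (\<Sum>k<m. (t ^ k / fact k) *\<^sub>R (lie_deriv f ^^ k) \<phi> (y xn))) \<le> K * \<bar>t\<bar> ^ m"
    by blast
  have "\<forall>\<^sub>F h in at_right 0. norm (\<phi> (y (xn + h)) - (\<Sum>k<m. h ^ k *\<^sub>R (1 / fact k) *\<^sub>R (lie_deriv f ^^ k) \<phi> (y xn))) \<le> K * h ^ m"
    using eventually_small[OF e(1)] by eventually_elim (use K in auto)
  then show ?thesis unfolding expands_def by (rule vanishesI)
qed

text \<open>
  The nodes may be negative, where the exact solution need not exist; its Taylor polynomial exists on
  both sides and is a sufficiently good substitute. The bound on the defect improves by one order each time
  it is inserted into the Taylor expansion along the polynomial.
\<close>

lemma taylor_polynomial_defect:
  fixes f :: "'a::euclidean_space \<Rightarrow> 'a"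
  assumes U: "open U" "x \<in> U" and f: "Ck_on p f U" and "p \<le> N"
  defines "q \<equiv> (\<lambda>t::real. \<Sum>k<Suc N. (t ^ k / fact k) *\<^sub>R (lie_deriv f ^^ k) id x)"
    and "q' \<equiv> (\<lambda>t::real. \<Sum>k<N. (t ^ k / fact k) *\<^sub>R (lie_deriv f ^^ Suc k) id x)"
  shows "\<exists>\<epsilon>>0. \<epsilon> \<le> 1 \<and> (\<forall>t\<in>{-\<epsilon>..\<epsilon>}. q t \<in> U) \<and> (\<exists>C. \<forall>t\<in>{-\<epsilon>..\<epsilon>}. norm (q' t - f (q t)) \<le> C * \<bar>t\<bar> ^ p)"
proof -
  have q0: "q 0 = x" by (simp add: q_def sum.lessThan_Suc_shift del: sum.lessThan_Suc)
  have dq: "(q has_vector_derivative q' t) (at t within S)" for t S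
    unfolding q_def q'_def by (rule has_vector_derivative_exp_sum)
  have cq: "continuous_on S q" for S
    unfolding q_def by (intro continuous_intros) auto
  have cq': "continuous_on S q'" for S
    unfolding q'_def by (intro continuous_intros) auto
  have "open (q -` U)" using cq[of UNIV] U(1) by (simp add: open_vimage)
  moreover have "0 \<in> q -` U" using q0 U(2) by simp
  ultimately obtain e where e: "e > 0" "cball 0 e \<subseteq> q -` U" using open_contains_cball by blast
  define \<epsilon> where "\<epsilon> = min e 1"
  have \<epsilon>: "\<epsilon> > 0" "\<epsilon> \<le> 1" using e by (auto simp: \<epsilon>_def)
  have qU: "q t \<in> U" if "t \<in> {-\<epsilon>..\<epsilon>}" for t
  proof -
    have "t \<in> cball 0 e" using that by (auto simp: \<epsilon>_def)
    then show ?thesis using e(2) by blast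
  qed
  have "\<exists>C. \<forall>t\<in>{-\<epsilon>..\<epsilon>}. norm (q' t - f (q t)) \<le> C * \<bar>t\<bar> ^ n" if "n \<le> p" for n
    using that
  proof (induction n)
    case 0
    have "q ` {-\<epsilon>..\<epsilon>} \<subseteq> U" using qU by auto
    then have "continuous_on {-\<epsilon>..\<epsilon>} (\<lambda>t. f (q t))"
      by (rule continuous_on_compose2[OF Ck_on_continuous[OF f] cq])
    then have "continuous_on {-\<epsilon>..\<epsilon>} (\<lambda>t. q' t - f (q t))"
      by (rule continuous_on_diff[OF cq'])
    from compact_imp_bounded[OF compact_continuous_image[OF this]]
    show ?case unfolding bounded_iff by fastforce
  next
    case (Suc n)
    from Suc.IH[OF Suc_leD[OF Suc.prems]]
    obtain C where C: "\<And>t. t \<in> {-\<epsilon>..\<epsilon>} \<Longrightarrow> norm (q' t - f (q t)) \<le> C * \<bar>t\<bar> ^ n" by blast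
    \<comment> \<open>Here an order is gained: \<open>flow_taylor\<close> for \<open>f\<close>
      itself turns a defect of order \<open>n\<close> into an expansion of \<open>f (q t)\<close> to
      order n + 1, and its coefficients are exactly those of \<open>q'\<close>.\<close>
    have "Ck_on (Suc n) f U" "Ck_on (Suc n - 1) f U" 
      using Ck_on_mono[OF f Suc.prems] Ck_on_mono[OF f Suc_leD[OF Suc.prems]] by simp_all
    then have "\<exists>K\<ge>0. \<forall>t\<in>{-\<epsilon>..\<epsilon>}. norm (f (q t) - (\<Sum>k<Suc n. (t ^ k / fact k) *\<^sub>R (lie_deriv f ^^ k) f x)) \<le> K * \<bar>t\<bar> ^ Suc n"
      using \<epsilon> by (intro flow_taylor[OF U(1) _ _ _ _ q0 qU dq C]) auto
    then obtain K where K: "\<And>t. t \<in> {-\<epsilon>..\<epsilon>} \<Longrightarrow> norm (f (q t) - (\<Sum>k<Suc n. (t ^ k / fact k) *\<^sub>R (lie_deriv f ^^ k) f x)) \<le> K * \<bar>t\<bar> ^ Suc n"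
      by blast
    define w where "w k = (lie_deriv f ^^ Suc k) id x" for k
    have w: "(lie_deriv f ^^ k) f x = w k" for k
      by (simp add: w_def funpow_Suc_right lie_deriv_id del: funpow.simps)
    \<comment> \<open>All coefficients of \<open>q'\<close> above degree \<open>n\<close> go into
      one constant. Above degree \<open>p\<close> they may be arbitrary values of
      \<open>frechet_derivative\<close>; it only matters that they are fixed vectors.\<close>
    define D where "D = (\<Sum>k\<in>{Suc n..<N}. norm (w k))"
    have "norm (q' t - f (q t)) \<le> (K + D) * \<bar>t\<bar> ^ Suc n" if t: "t \<in> {-\<epsilon>..\<epsilon>}" for t
    proof -
      have t1: "\<bar>t\<bar> \<le> 1" using t \<epsilon> by auto
      have "(\<Sum>k<N. (t ^ k / fact k) *\<^sub>R w k)
          = (\<Sum>k<Suc n. (t ^ k / fact k) *\<^sub>R w k) + (\<Sum>k\<in>{Suc n..<N}. (t ^ k / fact k) *\<^sub>R w k)"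
        using Suc.prems assms(4) by (metis (no_types) lessThan_atLeast0 sum.atLeastLessThan_concat zero_le le_trans)
      then have eq: "q' t - f (q t) = (\<Sum>k\<in>{Suc n..<N}. (t ^ k / fact k) *\<^sub>R w k)
          - (f (q t) - (\<Sum>k<Suc n. (t ^ k / fact k) *\<^sub>R w k))"
        unfolding q'_def w_def[symmetric] by simp
      have "norm (\<Sum>k\<in>{Suc n..<N}. (t ^ k / fact k) *\<^sub>R w k) \<le> (\<Sum>k\<in>{Suc n..<N}. norm (w k) * \<bar>t\<bar> ^ Suc n)"
      proof (rule sum_norm_le)
        fix k assume k: "k \<in> {Suc n..<N}"
        have "\<bar>t\<bar> ^ k / fact k \<le> \<bar>t\<bar> ^ k / 1" by (intro divide_left_mono) auto
        also have "\<dots> \<le> \<bar>t\<bar> ^ Suc n" using k t1 by (simp only: div_by_1) (intro power_decreasing, auto)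
        finally have "\<bar>t\<bar> ^ k / fact k * norm (w k) \<le> \<bar>t\<bar> ^ Suc n * norm (w k)" by (rule mult_right_mono) auto
        then show "norm ((t ^ k / fact k) *\<^sub>R w k) \<le> norm (w k) * \<bar>t\<bar> ^ Suc n"
          by (simp add: power_abs mult.commute)
      qed
      then have "norm (\<Sum>k\<in>{Suc n..<N}. (t ^ k / fact k) *\<^sub>R w k) \<le> D * \<bar>t\<bar> ^ Suc n"
        unfolding D_def sum_distrib_right .
      moreover have "norm (f (q t) - (\<Sum>k<Suc n. (t ^ k / fact k) *\<^sub>R w k)) \<le> K * \<bar>t\<bar> ^ Suc n"
        using K[OF t] unfolding w .
      ultimately show ?thesis
        unfolding eq distrib_right using norm_triangle_ineq4 by (smt (verit))
    qed
    then show ?case by blast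
  qed
  from this[of p] show ?thesis using \<epsilon> qU by (intro exI[of _ \<epsilon>]) auto
qed

text \<open>A defect of order \<open>p\<close> lets \<open>flow_taylor\<close> reach order p + 1.
  The degree \<open>N\<close> only has to be at least \<open>p\<close>, so that a single polynomial
  of degree 6 can serve every admissible \<open>p\<close>.\<close>

lemma expands_taylor_polynomial:
  fixes f :: "'a::euclidean_space \<Rightarrow> 'a" and \<phi> :: "'a \<Rightarrow> 'b::real_normed_vector"
  assumes U: "open U" "x \<in> U" and f: "Ck_on p f U" and "p \<le> N"
    and \<phi>: "Ck_on m \<phi> U" and m: "m \<le> Suc p"
  shows "expands m (\<lambda>h. \<phi> (\<Sum>k<Suc N. ((c * h) ^ k / fact k) *\<^sub>R (lie_deriv f ^^ k) id x))
    (\<lambda>k. c ^ k *\<^sub>R (1 / fact k) *\<^sub>R (lie_deriv f ^^ k) \<phi> x)"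
proof -
  define q where "q t = (\<Sum>k<Suc N. (t ^ k / fact k) *\<^sub>R (lie_deriv f ^^ k) id x)" for t :: real
  define q' where "q' t = (\<Sum>k<N. (t ^ k / fact k) *\<^sub>R (lie_deriv f ^^ Suc k) id x)" for t :: real
  obtain \<epsilon> C where \<epsilon>: "\<epsilon> > 0" "\<epsilon> \<le> 1" "\<And>t. t \<in> {-\<epsilon>..\<epsilon>} \<Longrightarrow> q t \<in> U"
    "\<And>t. t \<in> {-\<epsilon>..\<epsilon>} \<Longrightarrow> norm (q' t - f (q t)) \<le> C * \<bar>t\<bar> ^ p"
    using taylor_polynomial_defect[OF U f assms(4)] unfolding q_def q'_def by blast
  have q0: "q 0 = x" by (simp add: q_def sum.lessThan_Suc_shift del: sum.lessThan_Suc)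
  have dq: "(q has_vector_derivative q' t) (at t within S)" for t S
    unfolding q_def q'_def by (rule has_vector_derivative_exp_sum)
  have f': "Ck_on (m - 1) f U" by (rule Ck_on_mono[OF f]) (use m in auto)
  have "\<exists>K\<ge>0. \<forall>t\<in>{-\<epsilon>..\<epsilon>}. norm (\<phi> (q t) - (\<Sum>k<m. (t ^ k / fact k) *\<^sub>R (lie_deriv f ^^ k) \<phi> x)) \<le> K * \<bar>t\<bar> ^ m"
    using \<epsilon>(1,2) by (intro flow_taylor[OF U(1) _ _ _ _ q0 \<epsilon>(3) dq \<epsilon>(4) \<phi> f' m]) auto
  then obtain K where K: "\<And>t. t \<in> {-\<epsilon>..\<epsilon>} \<Longrightarrow> norm (\<phi> (q t) - (\<Sum>k<m. (t ^ k / fact k) *\<^sub>R (lie_deriv f ^^ k) \<phi> x)) \<le> K * \<bar>t\<bar> ^ m"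
    by blast
  have "expands m (\<lambda>h. \<phi> (q (c * h))) (\<lambda>k. c ^ k *\<^sub>R (1 / fact k) *\<^sub>R (lie_deriv f ^^ k) \<phi> x)"
    by (rule expands_dilate[OF \<epsilon>(1), where K = K]) (use K in \<open>simp add: abs_le_iff minus_le_iff\<close>)
  then show ?thesis unfolding q_def .
qed

section \<open>Unique solvability of lower triangular systems\<close>

text \<open>Equation \<open>i\<close> contains only the unknowns up to \<open>i\<close>, so the
  stages are found one at a time, each as the fixed point of a contraction with constant 1/2.
  Existence is obtained in the closed ball of radius r/2, with r/4 allotted to \<open>v\<close> and
  r/4 to the sum. The contraction estimate holds on the full radius, which gives uniqueness
  there.\<close>

lemma diagonal_system:
  fixes g :: "'a::euclidean_space \<Rightarrow> 'a" and \<alpha> :: "nat \<Rightarrow> nat \<Rightarrow> 'a \<Rightarrow> 'a"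
  assumes r: "r > 0" and L: "L \<ge> 0"
    and lip: "\<And>y z. y \<in> cball x r \<Longrightarrow> z \<in> cball x r \<Longrightarrow> norm (g y - g z) \<le> L * norm (y - z)"
    and bnd: "\<And>y. y \<in> cball x r \<Longrightarrow> norm (g y) \<le> M"
    and \<kappa>: "\<kappa> \<ge> 0"
    and \<alpha>: "\<And>i j w. i \<in> {1..s} \<Longrightarrow> j \<in> {1..i} \<Longrightarrow> norm (\<alpha> i j w) \<le> \<kappa> * norm w"
    and \<alpha>_diff: "\<And>i j w w'. \<alpha> i j (w - w') = \<alpha> i j w - \<alpha> i j w'"
    and v: "\<And>i. i \<in> {1..s} \<Longrightarrow> norm (v i - x) \<le> r / 4"
    and small: "\<kappa> * L \<le> 1 / 2" "s * (\<kappa> * M) \<le> r / 4"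
  shows "\<exists>!Y. Y \<in> {1..s} \<rightarrow>\<^sub>E ball x r \<and> (\<forall>i\<in>{1..s}. Y i = v i + (\<Sum>j=1..i. \<alpha> i j (g (Y j))))"
proof -
  have half: "y \<in> cball x r" if "y \<in> cball x (r / 2)" for y using that r by auto
  have M: "M \<ge> 0" using bnd[of x] r norm_ge_zero[of "g x"] by (auto simp del: norm_ge_zero)
  have contr: "norm (\<alpha> i i (g y) - \<alpha> i i (g z)) \<le> 1 / 2 * norm (y - z)"
    if "i \<in> {1..s}" "y \<in> cball x r" "z \<in> cball x r" for i y z
  proof -
    have "norm (\<alpha> i i (g y) - \<alpha> i i (g z)) \<le> \<kappa> * norm (g y - g z)"
      unfolding \<alpha>_diff[symmetric] using that(1) by (intro \<alpha>) auto
    also have "\<dots> \<le> \<kappa> * (L * norm (y - z))"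
      using lip[OF that(2,3)] \<kappa> by (rule mult_left_mono)
    also have "\<dots> \<le> 1 / 2 * norm (y - z)"
      using mult_right_mono[OF small(1), of "norm (y - z)"] by (simp add: mult.assoc)
    finally show ?thesis .
  qed
  have "\<exists>Y. \<forall>i\<in>{1..n}. Y i \<in> cball x (r / 2) \<and> Y i = v i + (\<Sum>j=1..i. \<alpha> i j (g (Y j)))" if "n \<le> s" for n
    using that
  proof (induction n)
    case 0
    then show ?case by auto
  next
    case (Suc n)
    then obtain Y where Y: "\<And>i. i \<in> {1..n} \<Longrightarrow> Y i \<in> cball x (r / 2)"
      "\<And>i. i \<in> {1..n} \<Longrightarrow> Y i = v i + (\<Sum>j=1..i. \<alpha> i j (g (Y j)))"
      using Suc_leD[OF Suc.prems] by blast
    let ?i = "Suc n"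
    have i: "?i \<in> {1..s}" using Suc.prems by auto
    define \<Phi> where "\<Phi> z = v ?i + (\<Sum>j=1..n. \<alpha> ?i j (g (Y j))) + \<alpha> ?i ?i (g z)" for z
    have maps: "\<Phi> z \<in> cball x (r / 2)" if z: "z \<in> cball x (r / 2)" for z
    proof -
      have aM: "norm (\<alpha> ?i j (g y)) \<le> \<kappa> * M" if "j \<in> {1..?i}" "y \<in> cball x (r / 2)" for j y
        using order_trans[OF \<alpha>[OF i that(1)] mult_left_mono[OF bnd[OF half[OF that(2)]] \<kappa>]] .
      have "norm (\<Sum>j=1..n. \<alpha> ?i j (g (Y j))) \<le> (\<Sum>j=1..n. \<kappa> * M)"
        by (rule sum_norm_le) (auto intro!: aM Y(1))
      moreover have "norm (\<alpha> ?i ?i (g z)) \<le> \<kappa> * M" using z by (intro aM) auto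
      moreover have "real n * (\<kappa> * M) + \<kappa> * M \<le> s * (\<kappa> * M)"
      proof -
        have "real (Suc n) * (\<kappa> * M) \<le> s * (\<kappa> * M)"
          using Suc.prems \<kappa> M by (intro mult_right_mono) auto
        then show ?thesis by (simp add: algebra_simps)
      qed
      moreover have "\<Phi> z - x = (v ?i - x) + (\<Sum>j=1..n. \<alpha> ?i j (g (Y j))) + \<alpha> ?i ?i (g z)"
        by (simp add: \<Phi>_def)
      then have "norm (\<Phi> z - x) \<le> norm (v ?i - x) + norm (\<Sum>j=1..n. \<alpha> ?i j (g (Y j))) + norm (\<alpha> ?i ?i (g z))"
        by (simp only:) (intro norm_triangle_mono order_refl)
      ultimately have "norm (\<Phi> z - x) \<le> r / 2" using v[OF i] small(2) by simp
      then show ?thesis by (simp add: dist_norm norm_minus_commute)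
    qed
    have "\<exists>!z. z \<in> cball x (r / 2) \<and> \<Phi> z = z"
    proof (rule Banach_fix[where c = "1/2"])
      show "dist (\<Phi> y) (\<Phi> z) \<le> 1 / 2 * dist y z" if "y \<in> cball x (r / 2)" "z \<in> cball x (r / 2)" for y z
        using contr[OF i half[OF that(1)] half[OF that(2)]] by (simp add: \<Phi>_def dist_norm)
    qed (use maps r in \<open>auto simp: complete_eq_closed\<close>)
    then obtain z where z: "z \<in> cball x (r / 2)" "\<Phi> z = z" by blast
    let ?Y = "Y(?i := z)"
    have old: "(\<Sum>j=1..k. \<alpha> i j (g (?Y j))) = (\<Sum>j=1..k. \<alpha> i j (g (Y j)))" if "k \<le> n" for i k
      using that by (intro sum.cong) auto
    have "?Y i \<in> cball x (r / 2) \<and> ?Y i = v i + (\<Sum>j=1..i. \<alpha> i j (g (?Y j)))" if "i \<in> {1..?i}" for i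
    proof (cases "i = ?i")
      case True
      then show ?thesis using z old[of n] by (simp add: \<Phi>_def add.assoc)
    next
      case False
      then have "i \<in> {1..n}" using that by auto
      then show ?thesis using Y[of i] old[of i] False by simp
    qed
    then show ?case by blast
  qed
  from this[of s] obtain Y where Y: "\<And>i. i \<in> {1..s} \<Longrightarrow> Y i \<in> cball x (r / 2)"
    "\<And>i. i \<in> {1..s} \<Longrightarrow> Y i = v i + (\<Sum>j=1..i. \<alpha> i j (g (Y j)))" by blast
  show ?thesis
  proof (rule ex_ex1I)
    \<comment> \<open>The constructed solution is made extensional, as required for it to be the
      only function of its kind.\<close>
    have "restrict Y {1..s} \<in> {1..s} \<rightarrow>\<^sub>E ball x r" using Y(1) r by fastforce
    moreover have "(\<Sum>j=1..i. \<alpha> i j (g (restrict Y {1..s} j))) = (\<Sum>j=1..i. \<alpha> i j (g (Y j)))" if "i \<in> {1..s}" for i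
      using that by (intro sum.cong) auto
    ultimately show "\<exists>Y. Y \<in> {1..s} \<rightarrow>\<^sub>E ball x r \<and> (\<forall>i\<in>{1..s}. Y i = v i + (\<Sum>j=1..i. \<alpha> i j (g (Y j))))"
      using Y(2) by (intro exI[of _ "restrict Y {1..s}"]) simp
  next
    fix Y Z
    assume "Y \<in> {1..s} \<rightarrow>\<^sub>E ball x r \<and> (\<forall>i\<in>{1..s}. Y i = v i + (\<Sum>j=1..i. \<alpha> i j (g (Y j))))"
      and "Z \<in> {1..s} \<rightarrow>\<^sub>E ball x r \<and> (\<forall>i\<in>{1..s}. Z i = v i + (\<Sum>j=1..i. \<alpha> i j (g (Z j))))"
    then have Y: "Y \<in> {1..s} \<rightarrow>\<^sub>E ball x r" "\<And>i. i \<in> {1..s} \<Longrightarrow> Y i = v i + (\<Sum>j=1..i. \<alpha> i j (g (Y j)))"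
      and Z: "Z \<in> {1..s} \<rightarrow>\<^sub>E ball x r" "\<And>i. i \<in> {1..s} \<Longrightarrow> Z i = v i + (\<Sum>j=1..i. \<alpha> i j (g (Z j)))"
      by blast+
    have "i \<in> {1..s} \<longrightarrow> Y i = Z i" for i
    proof (induction i rule: less_induct)
      case (less i)
      show ?case
      proof
        assume i: "i \<in> {1..s}"
        then have I: "{1..i} = insert i {1..<i}" by auto
        \<comment> \<open>Earlier stages agree by induction, so only the diagonal terms remain in
          the difference, and a contraction admits at most one solution.\<close>
        have "(\<Sum>j\<in>{1..<i}. \<alpha> i j (g (Y j))) = (\<Sum>j\<in>{1..<i}. \<alpha> i j (g (Z j)))"
          using less i by (intro sum.cong) auto
        then have "(v i + (\<Sum>j=1..i. \<alpha> i j (g (Y j)))) - (v i + (\<Sum>j=1..i. \<alpha> i j (g (Z j))))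
            = \<alpha> i i (g (Y i)) - \<alpha> i i (g (Z i))"
          unfolding I by simp
        then have "Y i - Z i = \<alpha> i i (g (Y i)) - \<alpha> i i (g (Z i))"
          unfolding Y(2)[OF i, symmetric] Z(2)[OF i, symmetric] .
        moreover have "Y i \<in> cball x r" "Z i \<in> cball x r"
          using PiE_mem[OF Y(1) i] PiE_mem[OF Z(1) i] by auto
        ultimately have "norm (Y i - Z i) \<le> 1 / 2 * norm (Y i - Z i)" using contr[OF i] by metis
        then show "Y i = Z i" by simp
      qed
    qed
    then show "Y = Z" using Y(1) Z(1) by (intro PiE_ext) auto
  qed
qed

section \<open>Expansion of the stages\<close>

text \<open>Real scaling and complex scaling of coordinate vectors are the two instances. The axioms
  say that \<open>sc\<close> extends the real scaling and is multiplicative, which suffices to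
  collect scalar weights in front of each vector.\<close>

locale scalar_action = bounded_bilinear sc
  for sc :: "'k::real_normed_field \<Rightarrow> 'a::euclidean_space \<Rightarrow> 'a" +
  assumes sc_of_real: "sc (of_real r) v = r *\<^sub>R v"
    and sc_mult: "sc (z * w) v = sc z (sc w v)"
begin

definition homogeneous_on :: "'a set \<Rightarrow> ('a \<Rightarrow> 'a) \<Rightarrow> bool" where
  "homogeneous_on U \<phi> \<longleftrightarrow> (\<forall>y\<in>U. \<forall>z v. dir_deriv \<phi> (sc z v) y = sc z (dir_deriv \<phi> v y))"

lemma sc_one: "sc 1 v = v"
  using sc_of_real[of 1] by simp

lemma sc_scaleR: "sc z (r *\<^sub>R v) = sc (z * of_real r) v"
  by (simp add: sc_mult sc_of_real)

text \<open>Homogeneity holds on all of the open set and can therefore be differentiated in the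
  outer direction \<open>w\<close>. It yields a factor from the inner direction only.\<close>

lemma dir_deriv_dir_deriv_sc:
  assumes "open U" "Ck_on 2 \<phi> U" "homogeneous_on U \<phi>" "x \<in> U"
  shows "dir_deriv (dir_deriv \<phi> (sc z v)) w x = sc z (dir_deriv (dir_deriv \<phi> v) w x)"
proof -
  have "dir_deriv \<phi> v differentiable (at x)" using assms by (simp add: numeral_2_eq_2)
  from bounded_linear.has_derivative[OF bounded_linear_right differentiable_has_derivative[OF this]]
  have "((\<lambda>y. sc z (dir_deriv \<phi> v y)) has_derivative (\<lambda>w. sc z (dir_deriv (dir_deriv \<phi> v) w x))) (at x)" .
  then have "(dir_deriv \<phi> (sc z v) has_derivative (\<lambda>w. sc z (dir_deriv (dir_deriv \<phi> v) w x))) (at x)"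
    by (rule has_derivative_transform_within_open[OF _ assms(1,4)])
       (use assms(3) in \<open>simp add: homogeneous_on_def\<close>)
  then show ?thesis by (rule dir_deriv_eqI)
qed

text \<open>This is where the symmetry of the second derivative matters: \<open>f''(sc z v, f x)\<close> has to be turned into \<open>f''(f x, sc z v)\<close>.\<close>

lemma homogeneous_on_lie_deriv:
  assumes "open U" "Ck_on 2 f U" "homogeneous_on U f"
  shows "homogeneous_on U (lie_deriv f f)"
proof -
  have 1: "Ck_on 1 f U" by (rule Ck_on_mono[OF assms(2)]) simp
  show ?thesis
    unfolding homogeneous_on_def
    using assms(3) dir_deriv_lie_deriv[OF assms(1) 1 assms(2)] dir_deriv_dir_deriv_sc[OF assms]
    by (simp add: homogeneous_on_def add_right)
qed

end

text \<open>
  Here \<open>X i k\<close>, \<open>A i j k\<close>, \<open>B i k\<close> are the coefficients of \<open>h ^ k\<close>, not of \<open>\<mu> ^ k\<close>: powers of \<open>\<i>\<omega>\<close> are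
  absorbed, which the conditions permit since each is homogeneous in the upper index.
\<close>

definition step_conditions :: "nat \<Rightarrow> nat \<Rightarrow> (nat \<Rightarrow> real) \<Rightarrow> (nat \<Rightarrow> nat \<Rightarrow> 'k::real_normed_field) \<Rightarrow>
    (nat \<Rightarrow> nat \<Rightarrow> nat \<Rightarrow> 'k) \<Rightarrow> (nat \<Rightarrow> nat \<Rightarrow> 'k) \<Rightarrow> bool" where
  "step_conditions p s c X A B \<longleftrightarrow>
    (\<forall>i\<in>{1..s}. X i 0 = 1 \<and> X i 1 = 0 \<and> X i 3 = 0 \<and> B i 1 = 0 \<and> B i 3 = 0 \<and> (\<forall>j\<in>{1..i}. A i j 1 = 0) \<and>
       (\<Sum>j=1..i. A i j 0) = of_real ((c i)\<^sup>2 / 2)) \<and>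
    (\<Sum>i=1..s. B i 0) = of_real (1/2) \<and>
    (3 \<le> p \<longrightarrow> (\<Sum>i=1..s. B i 0 * of_real (c i)) = of_real (1/6)) \<and>
    (4 \<le> p \<longrightarrow> (\<Sum>i=1..s. B i 0 * of_real (c i ^ 2)) = of_real (1/12) \<and>
      (\<Sum>i=1..s. B i 2) = 0) \<and>
    (5 \<le> p \<longrightarrow> (\<Sum>i=1..s. B i 0 * (\<Sum>j=1..i. A i j 0 * of_real (c j))) = of_real (1/120) \<and>
      (\<Sum>i=1..s. B i 0 * of_real (c i ^ 3)) = of_real (1/20) \<and>
      (\<Sum>i=1..s. B i 0 * (X i 2 * of_real (c i))) + (\<Sum>i=1..s. B i 2 * of_real (c i)) = 0) \<and>
    (6 \<le> p \<longrightarrow> (\<Sum>i=1..s. B i 0 * (\<Sum>j=1..i. A i j 0 * of_real (c j ^ 2))) = of_real (1/360) \<and>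
      (\<Sum>i=1..s. B i 0 * (of_real (c i) * (\<Sum>j=1..i. A i j 0 * of_real (c j)))) = of_real (1/180) \<and>
      (\<Sum>i=1..s. B i 0 * of_real (c i ^ 4)) = of_real (1/30) \<and>
      (\<Sum>i=1..s. B i 4) = 0 \<and>
      2 * (\<Sum>i=1..s. B i 0 * (\<Sum>j=1..i. A i j 2)) + (\<Sum>i=1..s. B i 2 * of_real (c i ^ 2)) = 0 \<and>
      2 * (\<Sum>i=1..s. B i 0 * (X i 2 * of_real (c i ^ 2))) + (\<Sum>i=1..s. B i 2 * of_real (c i ^ 2)) = 0)"

text \<open>The coefficients are functions of \<open>h\<close> here. Order 5 suffices for their
  expansions: with p at most 6, the weighted sum is needed only up to the power
  \<open>h ^ 4\<close>.\<close>

locale two_derivative_method = scalar_action sc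
  for sc :: "'k::real_normed_field \<Rightarrow> 'a::euclidean_space \<Rightarrow> 'a" +
  fixes U :: "'a set" and f :: "'a \<Rightarrow> 'a" and p s :: nat and c :: "nat \<Rightarrow> real"
    and \<xi> b :: "nat \<Rightarrow> real \<Rightarrow> 'k" and a :: "nat \<Rightarrow> nat \<Rightarrow> real \<Rightarrow> 'k"
    and X B :: "nat \<Rightarrow> nat \<Rightarrow> 'k" and A :: "nat \<Rightarrow> nat \<Rightarrow> nat \<Rightarrow> 'k"
  assumes smooth: "smooth_field sc p U f" and p: "2 \<le> p" "p \<le> 6"
    and \<xi>: "\<And>i. i \<in> {1..s} \<Longrightarrow> expands 5 (\<xi> i) (X i)"
    and a: "\<And>i j. i \<in> {1..s} \<Longrightarrow> j \<in> {1..i} \<Longrightarrow> expands 5 (a i j) (A i j)"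
    and b: "\<And>i. i \<in> {1..s} \<Longrightarrow> expands 5 (b i) (B i)"
    and conditions: "step_conditions p s c X A B"
begin

lemma X: "i \<in> {1..s} \<Longrightarrow> X i 0 = 1 \<and> X i 1 = 0 \<and> X i 3 = 0"
  and B: "i \<in> {1..s} \<Longrightarrow> B i 1 = 0 \<and> B i 3 = 0"
  and A: "i \<in> {1..s} \<Longrightarrow> j \<in> {1..i} \<Longrightarrow> A i j 1 = 0"
  and A0: "i \<in> {1..s} \<Longrightarrow> (\<Sum>j=1..i. A i j 0) = of_real ((c i)\<^sup>2 / 2)"
  using conditions unfolding step_conditions_def by blast+

lemma order2: "(\<Sum>i=1..s. B i 0) = of_real (1/2)"
  and order3: "3 \<le> p \<Longrightarrow> (\<Sum>i=1..s. B i 0 * of_real (c i)) = of_real (1/6)"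
  and order4: "4 \<le> p \<Longrightarrow> (\<Sum>i=1..s. B i 0 * of_real (c i ^ 2)) = of_real (1/12)"
    "4 \<le> p \<Longrightarrow> (\<Sum>i=1..s. B i 2) = 0"
  and order5: "5 \<le> p \<Longrightarrow> (\<Sum>i=1..s. B i 0 * (\<Sum>j=1..i. A i j 0 * of_real (c j))) = of_real (1/120)"
    "5 \<le> p \<Longrightarrow> (\<Sum>i=1..s. B i 0 * of_real (c i ^ 3)) = of_real (1/20)"
    "5 \<le> p \<Longrightarrow> (\<Sum>i=1..s. B i 0 * (X i 2 * of_real (c i))) + (\<Sum>i=1..s. B i 2 * of_real (c i)) = 0"
  and order6: "6 \<le> p \<Longrightarrow> (\<Sum>i=1..s. B i 0 * (\<Sum>j=1..i. A i j 0 * of_real (c j ^ 2))) = of_real (1/360)"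
    "6 \<le> p \<Longrightarrow> (\<Sum>i=1..s. B i 0 * (of_real (c i) * (\<Sum>j=1..i. A i j 0 * of_real (c j)))) = of_real (1/180)"
    "6 \<le> p \<Longrightarrow> (\<Sum>i=1..s. B i 0 * of_real (c i ^ 4)) = of_real (1/30)"
    "6 \<le> p \<Longrightarrow> (\<Sum>i=1..s. B i 4) = 0"
    "6 \<le> p \<Longrightarrow> 2 * (\<Sum>i=1..s. B i 0 * (\<Sum>j=1..i. A i j 2)) + (\<Sum>i=1..s. B i 2 * of_real (c i ^ 2)) = 0"
    "6 \<le> p \<Longrightarrow> 2 * (\<Sum>i=1..s. B i 0 * (X i 2 * of_real (c i ^ 2))) + (\<Sum>i=1..s. B i 2 * of_real (c i ^ 2)) = 0"
  using conditions unfolding step_conditions_def by blast+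

abbreviation g :: "'a \<Rightarrow> 'a" where "g \<equiv> lie_deriv f f"

lemma openU: "open U" and Ck_f: "Ck_on p f U" and hom_f: "homogeneous_on U f"
  using smooth by (auto simp: smooth_field_def homogeneous_on_def)

lemma Ck_f': "k \<le> p \<Longrightarrow> Ck_on k f U"
  using Ck_f by (rule Ck_on_mono)

lemma Ck_g: "k \<le> p - 1 \<Longrightarrow> Ck_on k g U"
  using p by (intro Ck_on_lie_deriv openU Ck_f') auto

lemma hom_g: "homogeneous_on U g"
  using p by (intro homogeneous_on_lie_deriv openU Ck_f' hom_f)

end

text \<open>\<open>Y\<close> is any family that solves the stage equations in a fixed ball for all
  small \<open>h\<close>; its values at other \<open>h\<close> are unconstrained.\<close>

locale method_step = two_derivative_method +
  fixes x :: 'b and r :: real and Y :: "real \<Rightarrow> nat \<Rightarrow> 'b"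
  assumes r: "r > 0" "cball x r \<subseteq> U"
    and stages: "\<forall>\<^sub>F h in at_right 0. \<forall>i\<in>{1..s}. Y h i \<in> ball x r \<and>
      Y h i = x + sc (\<xi> i h) ((c i * h) *\<^sub>R f x) + h\<^sup>2 *\<^sub>R (\<Sum>j=1..i. sc (a i j h) (g (Y h j)))"
begin

definition d :: "nat \<Rightarrow> 'b" where "d k = (lie_deriv f ^^ k) id x"

definition q :: "nat \<Rightarrow> real \<Rightarrow> 'b" where "q i h = (\<Sum>k<Suc 6. ((c i * h) ^ k / fact k) *\<^sub>R d k)"

lemma xU: "x \<in> U"
  using r by auto

lemma d_0: "d 0 = x" and d_Suc0: "d (Suc 0) = f x" and d_2: "d 2 = g x"
  by (simp_all add: d_def lie_deriv_id numeral_2_eq_2)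

lemma lie_deriv_iter_g: "(lie_deriv f ^^ k) g x = d (k + 2)"
  by (simp add: d_def numeral_2_eq_2 funpow_Suc_right lie_deriv_id del: funpow.simps)

lemma q_expands: "n \<le> 7 \<Longrightarrow> expands n (q i) (\<lambda>k. c i ^ k *\<^sub>R (1 / fact k) *\<^sub>R d k)"
  using expands_polynomial[of n 7 "c i" "\<lambda>k. (1 / fact k) *\<^sub>R d k"]
  by (simp add: q_def[abs_def])

lemma along_q_expands:
  assumes "Ck_on m \<phi> U" "m \<le> Suc p"
  shows "expands m (\<lambda>h. \<phi> (q i h)) (\<lambda>k. c i ^ k *\<^sub>R (1 / fact k) *\<^sub>R (lie_deriv f ^^ k) \<phi> x)"
  unfolding q_def d_def by (rule expands_taylor_polynomial[OF openU xU Ck_f p(2) assms])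

lemma g_q_expands:
  "m \<le> p - 1 \<Longrightarrow> expands m (\<lambda>h. g (q i h)) (\<lambda>k. c i ^ k *\<^sub>R (1 / fact k) *\<^sub>R d (k + 2))"
  using along_q_expands[OF Ck_g, of m i] by (simp add: lie_deriv_iter_g)

lemma q_near: "\<forall>\<^sub>F h in at_right 0. q i h \<in> cball x r"
proof -
  have "vanishes 1 (\<lambda>h. q i h - x)"
    using q_expands[of 1 i] by (simp add: expands_def d_0)
  then have "((\<lambda>h. q i h - x) \<longlongrightarrow> 0) (at_right 0)"
    using vanishes_Suc_tendsto[of 0] by simp
  from tendstoD[OF this r(1)] show ?thesis
    by eventually_elim (simp add: dist_norm norm_minus_commute)
qed

lemma Y_near:
  assumes "i \<in> {1..s}"
  shows "\<forall>\<^sub>F h in at_right 0. Y h i \<in> cball x r"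
  using stages
proof eventually_elim
  case (elim h)
  with assms have "Y h i \<in> ball x r" by blast
  then show ?case by simp
qed

lemma g_bounded: "\<exists>M. \<forall>y\<in>cball x r. norm (g y) \<le> M"
proof -
  have "continuous_on (cball x r) g"
    using continuous_on_subset[OF Ck_on_continuous[OF Ck_g[of 0]] r(2)] by simp
  from compact_imp_bounded[OF compact_continuous_image[OF this]]
  show ?thesis unfolding bounded_iff by fastforce
qed

text \<open>Comparison of coefficients in the stage equation, where the \<open>\<xi>\<close> term is
  shifted by one power and the \<open>A\<close> term by two, and the odd coefficients vanish. The
  last branch is meant for \<open>k = 4\<close> only.\<close>

definition S :: "nat \<Rightarrow> nat \<Rightarrow> 'b" where
  "S i k = (if k = 0 then x else if k = 1 then c i *\<^sub>R f x else
      if k = 2 then ((c i)\<^sup>2 / 2) *\<^sub>R d 2 else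
      if k = 3 then sc (X i 2 * of_real (c i)) (f x) + sc (\<Sum>j=1..i. A i j 0 * of_real (c j)) (d 3)
      else sc (\<Sum>j=1..i. A i j 0 * of_real (c j ^ 2)) ((1/2) *\<^sub>R d 4) + sc (\<Sum>j=1..i. A i j 2) (d 2))"

text \<open>The factor \<open>h\<^sup>2\<close> turns an expansion of \<open>g\<close> at the stages
  to order \<open>n\<close> into one of the stages to order n + 2. This gain drives the bootstrap
  below, where it is used with \<open>n\<close> equal to 0, 1 and finally 3.\<close>

lemma stage_expands:
  assumes n: "n \<le> 3"
    and g: "\<And>j. j \<in> {1..s} \<Longrightarrow> expands n (\<lambda>h. g (Y h j)) (\<lambda>k. c j ^ k *\<^sub>R (1 / fact k) *\<^sub>R d (k + 2))"
    and i: "i \<in> {1..s}"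
  shows "expands (n + 2) (\<lambda>h. Y h i) (S i)"
proof -
  let ?C = "\<lambda>k. if k = 0 then c i *\<^sub>R f x else 0"
  let ?G = "\<lambda>j k. c j ^ k *\<^sub>R (1 / fact k) *\<^sub>R d (k + 2)"
  let ?H = "\<lambda>k. (if k = 0 then x else 0) + (if k < 1 then 0 else \<Sum>l\<le>k - 1. sc (X i l) (?C (k - 1 - l)))
    + (if k < 2 then 0 else \<Sum>j=1..i. \<Sum>l\<le>k - 2. sc (A i j l) (?G j (k - 2 - l)))"
  have "expands (n + 1 + 1) (\<lambda>h. h ^ 1 *\<^sub>R sc (\<xi> i h) (c i *\<^sub>R f x))
      (\<lambda>k. if k < 1 then 0 else \<Sum>l\<le>k - 1. sc (X i l) (?C (k - 1 - l)))"
    using n by (intro expands_scale_power expands_bilinear[OF bounded_bilinear_axioms] expands_const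
        expands_mono[OF \<xi>[OF i]]) auto
  moreover have "expands (n + 2) (\<lambda>h. h ^ 2 *\<^sub>R (\<Sum>j=1..i. sc (a i j h) (g (Y h j))))
      (\<lambda>k. if k < 2 then 0 else \<Sum>j=1..i. \<Sum>l\<le>k - 2. sc (A i j l) (?G j (k - 2 - l)))"
    using n i by (intro expands_scale_power expands_sum expands_bilinear[OF bounded_bilinear_axioms] g
        expands_mono[OF a[OF i]]) auto
  ultimately have "expands (n + 2) (\<lambda>h. x + h ^ 1 *\<^sub>R sc (\<xi> i h) (c i *\<^sub>R f x)
      + h ^ 2 *\<^sub>R (\<Sum>j=1..i. sc (a i j h) (g (Y h j)))) ?H"
    using expands_const[of "n + 2" x] by (intro expands_add) simp_all
  then have "expands (n + 2) (\<lambda>h. Y h i) ?H"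
  proof (rule expands_eventually)
    show "\<forall>\<^sub>F h in at_right 0. x + h ^ 1 *\<^sub>R sc (\<xi> i h) (c i *\<^sub>R f x)
        + h ^ 2 *\<^sub>R (\<Sum>j=1..i. sc (a i j h) (g (Y h j))) = Y h i"
      using stages
    proof eventually_elim
      case (elim h)
      then have "Y h i = x + sc (\<xi> i h) ((c i * h) *\<^sub>R f x) + h\<^sup>2 *\<^sub>R (\<Sum>j=1..i. sc (a i j h) (g (Y h j)))"
        using i by blast
      then show ?case by (simp add: scaleR_right mult.commute)
    qed
  qed
  then show ?thesis
  proof (rule expands_cong)
    fix k assume "k < n + 2"
    then consider "k = 0" | "k = 1" | "k = 2" | "k = 3" | "k = 4" using n by linarith
    then show "?H k = S i k"
    proof cases
      case 3
      \<comment> \<open>The simplifying assumption on the row sums of A0 makes the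
        \<open>h\<^sup>2\<close> coefficient of the stage equal to that of the Taylor
        polynomial.\<close>
      have "(\<Sum>j=1..i. sc (A i j 0) (d 2)) = ((c i)\<^sup>2 / 2) *\<^sub>R d 2"
        by (simp only: sum_left[symmetric] A0[OF i] sc_of_real)
      then show ?thesis using X[OF i] 3 by (simp add: S_def numeral_2_eq_2 zero_left zero_right)
    next
      case 4
      have "(\<Sum>j=1..i. sc (A i j 0) (c j *\<^sub>R d 3)) = sc (\<Sum>j=1..i. A i j 0 * of_real (c j)) (d 3)"
        by (simp only: sum_left sc_scaleR)
      moreover have "(\<Sum>j=1..i. sc (A i j 1) (d 2)) = 0"
        using A[OF i] by (intro sum.neutral) (simp add: zero_left)
      ultimately show ?thesis using X[OF i] 4
        by (simp add: S_def sum.distrib eval_nat_numeral sc_scaleR zero_left zero_right)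
    next
      case 5
      have "(\<Sum>j=1..i. sc (A i j 0) (c j ^ 2 *\<^sub>R (1/2) *\<^sub>R d 4))
          = sc (\<Sum>j=1..i. A i j 0 * of_real (c j ^ 2)) ((1/2) *\<^sub>R d 4)"
        by (simp only: sum_left sc_scaleR sum_distrib_right)
      moreover have "(\<Sum>j=1..i. sc (A i j 1) (c j *\<^sub>R d 3)) = 0"
        using A[OF i] by (intro sum.neutral) (simp add: zero_left)
      ultimately show ?thesis using X[OF i] 5
        by (simp add: S_def sum.distrib eval_nat_numeral sum_left zero_left zero_right)
    qed (use X[OF i] in \<open>simp_all add: S_def sc_one\<close>)
  qed
qed

lemma S_low: "k < 3 \<Longrightarrow> S i k = c i ^ k *\<^sub>R (1 / fact k) *\<^sub>R d k"
proof -
  assume "k < 3"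
  then consider "k = 0" | "k = 1" | "k = 2" by linarith
  then show ?thesis by cases (simp_all add: S_def d_0 d_Suc0)
qed

lemma g_transfer:
  assumes i: "i \<in> {1..s}" and n: "vanishes n (\<lambda>h. Y h i - q i h)"
  shows "vanishes n (\<lambda>h. g (Y h i) - g (q i h))"
proof -
  have "Ck_on 1 g U" using p by (intro Ck_g) simp
  from Ck_on_lipschitz[OF this compact_cball convex_cball r(2)]
  obtain L where L: "L \<ge> 0" "\<And>y z. y \<in> cball x r \<Longrightarrow> z \<in> cball x r \<Longrightarrow> norm (g y - g z) \<le> L * norm (y - z)"
    by blast
  obtain K where "\<forall>\<^sub>F h in at_right 0. h > 0 \<and> norm (Y h i - q i h) \<le> K * h ^ n"
    using vanishesD[OF n] by blast
  then have "\<forall>\<^sub>F h in at_right 0. norm (g (Y h i) - g (q i h)) \<le> L * K * h ^ n"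
    using Y_near[OF i] q_near[of i]
  proof eventually_elim
    case (elim h)
    have "norm (g (Y h i) - g (q i h)) \<le> L * norm (Y h i - q i h)" using L(2) elim by blast
    also have "\<dots> \<le> L * (K * h ^ n)" using elim L(1) by (intro mult_left_mono) auto
    finally show ?case by (simp add: mult.assoc)
  qed
  then show ?thesis by (rule vanishesI)
qed

text \<open>The bound on \<open>n\<close> keeps all coefficients below \<open>h ^ 3\<close>, where
  stage and Taylor polynomial agree.\<close>

lemma stage_defect:
  assumes "n \<le> 1"
    and "\<And>j. j \<in> {1..s} \<Longrightarrow> expands n (\<lambda>h. g (Y h j)) (\<lambda>k. c j ^ k *\<^sub>R (1 / fact k) *\<^sub>R d (k + 2))"
    and i: "i \<in> {1..s}"
  shows "vanishes (n + 2) (\<lambda>h. Y h i - q i h)"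
proof (rule expands_vanishes_diff)
  show "expands (n + 2) (q i) (\<lambda>k. c i ^ k *\<^sub>R (1 / fact k) *\<^sub>R d k)"
    using assms(1) by (intro q_expands) simp
  show "expands (n + 2) (\<lambda>h. Y h i) (\<lambda>k. c i ^ k *\<^sub>R (1 / fact k) *\<^sub>R d k)"
    by (rule expands_cong[OF stage_expands[OF _ assms(2) i]]) (use assms(1) S_low in auto)
qed

text \<open>Bootstrap in two rounds. Boundedness of \<open>g\<close> on the ball gives a defect of
  order 2; by the Lipschitz bound \<open>g\<close> then has the right expansion to order 1 at the
  stages, which gives a defect of order 3. Here the bootstrap stops, since the \<open>h ^ 3\<close>
  coefficients differ in general.\<close>

lemma stage_defect_3:
  assumes i: "i \<in> {1..s}"
  shows "vanishes 3 (\<lambda>h. Y h i - q i h)"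
proof -
  obtain M where M: "\<And>y. y \<in> cball x r \<Longrightarrow> norm (g y) \<le> M" using g_bounded by blast
  have 0: "expands 0 (\<lambda>h. g (Y h j)) G" if "j \<in> {1..s}" for j G
    unfolding expands_0_iff
    by (rule vanishesI[of _ M], rule eventually_mono[OF Y_near[OF that]]) (use M in auto)
  have 1: "expands 1 (\<lambda>h. g (Y h j)) (\<lambda>k. c j ^ k *\<^sub>R (1 / fact k) *\<^sub>R d (k + 2))" if j: "j \<in> {1..s}" for j
  proof (rule expands_add_vanishes)
    show "expands 1 (\<lambda>h. g (q j h)) (\<lambda>k. c j ^ k *\<^sub>R (1 / fact k) *\<^sub>R d (k + 2))"
      using p by (intro g_q_expands) simp
    show "vanishes 1 (\<lambda>h. g (Y h j) - g (q j h))"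
      using g_transfer[OF j stage_defect[OF _ 0 j]] vanishes_mono by fastforce
  qed
  show ?thesis using stage_defect[OF _ 1 i] by (simp add: numeral_3_eq_3)
qed

lemma g_stage_expands_3:
  assumes "m \<le> 3" "m \<le> p - 1" and i: "i \<in> {1..s}"
  shows "expands m (\<lambda>h. g (Y h i)) (\<lambda>k. c i ^ k *\<^sub>R (1 / fact k) *\<^sub>R d (k + 2))"
  by (rule expands_add_vanishes[OF g_q_expands[OF assms(2)] vanishes_mono[OF g_transfer[OF i stage_defect_3[OF i]] assms(1)]])

end

section \<open>Local truncation error\<close>

context method_step
begin

section \<open>First and second derivative of \<open>g\<close> acting on the stage defect\<close>

definition T1 :: "'b \<Rightarrow> 'b" where "T1 v = dir_deriv g v x"
definition T2 :: "'b \<Rightarrow> 'b" where "T2 v = lie_deriv f (dir_deriv g v) x"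

lemma T1_linear: "linear T1"
  unfolding T1_def[abs_def] using p
  by (intro linear_dir_deriv Ck_on_differentiable[OF Ck_g[of "Suc 0"] xU]) simp

lemma T1_sc: "T1 (sc z v) = sc z (T1 v)"
  using hom_g xU by (simp add: T1_def homogeneous_on_def)

lemma T2_eq: "T2 v = dir_deriv (dir_deriv g v) (f x) x"
  by (simp add: T2_def lie_deriv_def[of f "dir_deriv g v"])

lemma T2_sc:
  assumes "3 \<le> p"
  shows "T2 (sc z v) = sc z (T2 v)"
  unfolding T2_eq
  by (rule dir_deriv_dir_deriv_sc[OF openU Ck_g hom_g xU]) (use assms in simp)

lemma T2_add:
  assumes "3 \<le> p"
  shows "T2 (v + w) = T2 v + T2 w"
proof -
  have C: "Ck_on 2 g U" using assms by (intro Ck_g) simp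
  then have d: "g differentiable (at y)" "dir_deriv g u differentiable (at y)" if "y \<in> U" for y u
    using that by (simp_all add: numeral_2_eq_2)
  have "((\<lambda>y. dir_deriv g v y + dir_deriv g w y) has_derivative
      (\<lambda>u. dir_deriv (dir_deriv g v) u x + dir_deriv (dir_deriv g w) u x)) (at x)"
    by (intro has_derivative_add differentiable_has_derivative d xU)
  then have "(dir_deriv g (v + w) has_derivative
      (\<lambda>u. dir_deriv (dir_deriv g v) u x + dir_deriv (dir_deriv g w) u x)) (at x)"
    by (rule has_derivative_transform_within_open[OF _ openU xU])
       (simp add: linear_add[OF linear_dir_deriv[OF d(1)]])
  then show ?thesis unfolding T2_eq by (rule dir_deriv_eqI)
qed

lemma T2_linear: "3 \<le> p \<Longrightarrow> linear T2"
  using T2_sc[of "of_real _"] by (intro linearI T2_add) (simp_all add: sc_of_real)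

lemma d_3: "d 3 = T1 (f x)"
  using lie_deriv_iter_g[of 1] by (simp add: T1_def lie_deriv_def eval_nat_numeral)

text \<open>In classical terms the fourth derivative of the solution is g'(g) + g''(f, f). This
  splitting is what lets the last two conditions of order 6 cooperate.\<close>

lemma d_4:
  assumes "3 \<le> p"
  shows "d 4 = T1 (d 2) + T2 (f x)"
proof -
  have "Ck_on 2 g U" using assms by (intro Ck_g) simp
  from dir_deriv_lie_deriv[OF openU Ck_f' this xU, of "f x"]
  have "dir_deriv (lie_deriv f g) (f x) x = T1 (dir_deriv f (f x) x) + T2 (f x)"
    using p by (simp add: T1_def T2_eq)
  moreover have "d 4 = dir_deriv (lie_deriv f g) (f x) x"
    using lie_deriv_iter_g[of 2] by (simp add: lie_deriv_def[of f "lie_deriv f g"] eval_nat_numeral)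
  moreover have "dir_deriv f (f x) x = d 2" by (simp add: d_2 lie_deriv_def)
  ultimately show ?thesis by simp
qed

text \<open>Two terms are enough because the result is multiplied by at least \<open>h ^ 3\<close>.
  They require the derivative of \<open>g\<close> to be C^2, hence p at least 4.\<close>

lemma dir_deriv_g_q_expands:
  assumes "4 \<le> p"
  shows "expands 2 (\<lambda>h. dir_deriv g v (q i h)) (\<lambda>k. if k = 0 then T1 v else c i *\<^sub>R T2 v)"
proof -
  have "Ck_on (Suc 2) g U" using assms by (intro Ck_g) simp
  then have "Ck_on 2 (dir_deriv g v) U" by (rule Ck_on_dir_deriv)
  then have "expands 2 (\<lambda>h. dir_deriv g v (q i h))
      (\<lambda>k. c i ^ k *\<^sub>R (1 / fact k) *\<^sub>R (lie_deriv f ^^ k) (dir_deriv g v) x)"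
    using p by (intro along_q_expands) simp_all
  then show ?thesis
    by (rule expands_cong) (auto simp: less_2_cases_iff T1_def T2_def)
qed

text \<open>\<open>w3\<close> and \<open>w4\<close> are the coefficients of \<open>h ^ 3\<close> and \<open>h ^ 4\<close> in \<open>\<delta>\<^sub>i\<close>.\<close>

definition w3 :: "nat \<Rightarrow> 'b" where
  "w3 i = sc (X i 2 * of_real (c i)) (f x) + sc (\<Sum>j=1..i. A i j 0 * of_real (c j)) (d 3)
     - (c i ^ 3 / 6) *\<^sub>R d 3"

definition w4 :: "nat \<Rightarrow> 'b" where
  "w4 i = sc (\<Sum>j=1..i. A i j 0 * of_real (c j ^ 2)) ((1/2) *\<^sub>R d 4) + sc (\<Sum>j=1..i. A i j 2) (d 2)
     - (c i ^ 4 / 24) *\<^sub>R d 4"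

lemma stage_defect_expands:
  assumes "4 \<le> p" and i: "i \<in> {1..s}"
  shows "expands 5 (\<lambda>h. Y h i - q i h) (\<lambda>k. if k = 3 then w3 i else if k = 4 then w4 i else 0)"
proof -
  have "expands 3 (\<lambda>h. g (Y h j)) (\<lambda>k. c j ^ k *\<^sub>R (1 / fact k) *\<^sub>R d (k + 2))" if "j \<in> {1..s}" for j
    using assms(1) by (intro g_stage_expands_3 that) auto
  from stage_expands[OF order_refl this i] have "expands 5 (\<lambda>h. Y h i) (S i)" by simp
  from expands_diff[OF this q_expands[of 5 i]]
  have "expands 5 (\<lambda>h. Y h i - q i h) (\<lambda>k. S i k - c i ^ k *\<^sub>R (1 / fact k) *\<^sub>R d k)" by simp
  then show ?thesis
  proof (rule expands_cong)
    fix k :: nat assume "k < 5"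
    then consider "k < 3" | "k = 3" | "k = 4" by linarith
    then show "S i k - c i ^ k *\<^sub>R (1 / fact k) *\<^sub>R d k = (if k = 3 then w3 i else if k = 4 then w4 i else 0)"
    proof cases
      case 1
      then show ?thesis by (simp add: S_low)
    next
      case 2
      have "fact 3 = (6::real)" by (simp add: eval_nat_numeral)
      with 2 show ?thesis by (simp add: w3_def S_def)
    next
      case 3
      have "fact 4 = (24::real)" by (simp add: eval_nat_numeral)
      with 3 show ?thesis by (simp add: w4_def S_def)
    qed
  qed
qed

text \<open>Coefficients of \<open>g\<close> at a stage: the Taylor part along \<open>q\<close>, and
  the product of the expansion of g' along \<open>q\<close> with that of the defect.\<close>

definition \<Gamma> :: "nat \<Rightarrow> nat \<Rightarrow> 'b" where
  "\<Gamma> i k = c i ^ k *\<^sub>R (1 / fact k) *\<^sub>R d (k + 2)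
     + (if k = 3 then T1 (w3 i) else if k = 4 then c i *\<^sub>R T2 (w3 i) + T1 (w4 i) else 0)"

text \<open>For p at most 4 the correction, which starts at \<open>h ^ 3\<close>, lies beyond the
  required order. Otherwise \<open>g\<close> is linearized at \<open>q i h\<close>; since the defect
  has order 3, the quadratic remainder has order 6.\<close>

lemma g_stage_expands:
  assumes i: "i \<in> {1..s}"
  shows "expands (p - 1) (\<lambda>h. g (Y h i)) (\<Gamma> i)"
proof (cases "p \<le> 4")
  case True
  have "expands (p - 1) (\<lambda>h. g (Y h i)) (\<lambda>k. c i ^ k *\<^sub>R (1 / fact k) *\<^sub>R d (k + 2))"
    using True by (intro g_stage_expands_3 i) auto
  then show ?thesis by (rule expands_cong) (use True in \<open>auto simp: \<Gamma>_def\<close>)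
next
  case False
  let ?\<delta> = "\<lambda>h. Y h i - q i h" and ?D = "\<lambda>h. frechet_derivative g (at (q i h))"
  have \<delta>: "expands 5 ?\<delta> (\<lambda>k. if k = 3 then w3 i else if k = 4 then w4 i else 0)"
    using False by (intro stage_defect_expands i) auto
  \<comment> \<open>The derivative of \<open>g\<close> along \<open>q\<close> is expanded in fixed
    directions only. Therefore the leading part of the defect is written with the fixed vectors
    \<open>w3 i\<close> and \<open>w4 i\<close>, and the rest is only estimated.\<close>
  define \<rho> where "\<rho> h = ?\<delta> h - (h ^ 3 *\<^sub>R w3 i + h ^ 4 *\<^sub>R w4 i)" for h
  have \<rho>: "vanishes 5 \<rho>"
    using \<delta> by (simp add: expands_def \<rho>_def[abs_def] eval_nat_numeral)
  have C1: "Ck_on 1 g U" by (rule Ck_g) (use False in simp)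
  have C2: "Ck_on 2 g U" by (rule Ck_g) (use False in simp)
  have dg: "g differentiable (at y)" if "y \<in> cball x r" for y
    using C1 that r(2) by auto
  have rem: "vanishes 5 (\<lambda>h. g (Y h i) - g (q i h) - ?D h (?\<delta> h))"
  proof -
    obtain L where L: "L \<ge> 0" "\<And>y z. y \<in> cball x r \<Longrightarrow> z \<in> cball x r \<Longrightarrow>
        norm (g z - g y - dir_deriv g (z - y) y) \<le> L * (norm (z - y))\<^sup>2"
      using Ck_on_linear_remainder[OF C2 compact_cball convex_cball r(2)] by blast
    obtain K where "\<forall>\<^sub>F h in at_right 0. h > 0 \<and> norm (?\<delta> h) \<le> K * h ^ 3"
      using vanishesD[OF stage_defect_3[OF i]] by blast
    then have "\<forall>\<^sub>F h in at_right 0. norm (g (Y h i) - g (q i h) - ?D h (?\<delta> h)) \<le> (L * K\<^sup>2) * h ^ 6"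
      using Y_near[OF i] q_near[of i]
    proof eventually_elim
      case (elim h)
      have "norm (g (Y h i) - g (q i h) - ?D h (?\<delta> h)) \<le> L * (norm (?\<delta> h))\<^sup>2" using L(2) elim by blast
      also have "\<dots> \<le> L * (K * h ^ 3)\<^sup>2" using elim L(1) by (intro mult_left_mono power_mono) auto
      finally show ?case by (simp add: power_mult_distrib mult.assoc flip: power_mult)
    qed
    then have "vanishes 6 (\<lambda>h. g (Y h i) - g (q i h) - ?D h (?\<delta> h))" by (rule vanishesI)
    then show ?thesis by (rule vanishes_mono) simp
  qed
  have D\<rho>: "vanishes 5 (\<lambda>h. ?D h (\<rho> h))"
  proof -
    obtain M where M: "M \<ge> 0" "\<And>y v. y \<in> cball x r \<Longrightarrow> norm (dir_deriv g v y) \<le> M * norm v"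
      using dir_deriv_bound[OF C1 compact_cball r(2)] by blast
    obtain K where "\<forall>\<^sub>F h in at_right 0. h > 0 \<and> norm (\<rho> h) \<le> K * h ^ 5"
      using vanishesD[OF \<rho>] by blast
    then have "\<forall>\<^sub>F h in at_right 0. norm (?D h (\<rho> h)) \<le> M * K * h ^ 5"
      using q_near[of i]
    proof eventually_elim
      case (elim h)
      have "norm (?D h (\<rho> h)) \<le> M * norm (\<rho> h)" using M(2) elim by blast
      also have "\<dots> \<le> M * (K * h ^ 5)" using elim M(1) by (intro mult_left_mono) auto
      finally show ?case by (simp add: mult.assoc)
    qed
    then show ?thesis by (rule vanishesI)
  qed
  have p4: "4 \<le> p" using False by simp
  let ?E = "\<lambda>v k. if k = 0 then T1 v else c i *\<^sub>R T2 v"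
  \<comment> \<open>To reach order 5, the \<open>w3\<close> term needs two coefficients of the
    derivative and the \<open>w4\<close> term one.\<close>
  have "expands (2 + 3) (\<lambda>h. h ^ 3 *\<^sub>R ?D h (w3 i)) (\<lambda>k. if k < 3 then 0 else ?E (w3 i) (k - 3))"
    by (intro expands_scale_power dir_deriv_g_q_expands p4)
  moreover have "expands (1 + 4) (\<lambda>h. h ^ 4 *\<^sub>R ?D h (w4 i)) (\<lambda>k. if k < 4 then 0 else ?E (w4 i) (k - 4))"
    by (intro expands_scale_power expands_mono[OF dir_deriv_g_q_expands[OF p4]]) simp
  ultimately have "expands 5 (\<lambda>h. h ^ 3 *\<^sub>R ?D h (w3 i) + h ^ 4 *\<^sub>R ?D h (w4 i))
      (\<lambda>k. (if k < 3 then 0 else ?E (w3 i) (k - 3)) + (if k < 4 then 0 else ?E (w4 i) (k - 4)))"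
    by (intro expands_add) simp_all
  moreover have "vanishes 5 (\<lambda>h. (g (Y h i) - g (q i h)) - (h ^ 3 *\<^sub>R ?D h (w3 i) + h ^ 4 *\<^sub>R ?D h (w4 i)))"
  proof (rule vanishes_eventually[OF vanishes_add[OF rem D\<rho>]])
    show "\<forall>\<^sub>F h in at_right 0. g (Y h i) - g (q i h) - ?D h (?\<delta> h) + ?D h (\<rho> h)
        = (g (Y h i) - g (q i h)) - (h ^ 3 *\<^sub>R ?D h (w3 i) + h ^ 4 *\<^sub>R ?D h (w4 i))"
      using q_near[of i]
    proof eventually_elim
      case (elim h)
      have lin: "linear (?D h)" using linear_dir_deriv[OF dg[OF elim]] by simp
      have "?\<delta> h = \<rho> h + (h ^ 3 *\<^sub>R w3 i + h ^ 4 *\<^sub>R w4 i)" by (simp add: \<rho>_def)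
      then have "?D h (?\<delta> h) = ?D h (\<rho> h) + (h ^ 3 *\<^sub>R ?D h (w3 i) + h ^ 4 *\<^sub>R ?D h (w4 i))"
        by (simp only: linear_add[OF lin] linear_cmul[OF lin])
      then show ?case by simp
    qed
  qed
  ultimately have "expands 5 (\<lambda>h. g (Y h i) - g (q i h))
      (\<lambda>k. (if k < 3 then 0 else ?E (w3 i) (k - 3)) + (if k < 4 then 0 else ?E (w4 i) (k - 4)))"
    by (rule expands_add_vanishes)
  then have "expands (p - 1) (\<lambda>h. g (Y h i) - g (q i h))
      (\<lambda>k. (if k < 3 then 0 else ?E (w3 i) (k - 3)) + (if k < 4 then 0 else ?E (w4 i) (k - 4)))"
    by (rule expands_mono) (use p in simp)
  from expands_add[OF g_q_expands[OF order_refl] this, of i]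
  have "expands (p - 1) (\<lambda>h. g (Y h i)) (\<lambda>k. c i ^ k *\<^sub>R (1 / fact k) *\<^sub>R d (k + 2) +
      ((if k < 3 then 0 else ?E (w3 i) (k - 3)) + (if k < 4 then 0 else ?E (w4 i) (k - 4))))"
    by simp
  then show ?thesis
  proof (rule expands_cong)
    fix k assume "k < p - 1"
    then have "k < 3 \<or> k = 3 \<or> k = 4" using p by linarith
    then show "c i ^ k *\<^sub>R (1 / fact k) *\<^sub>R d (k + 2) +
      ((if k < 3 then 0 else ?E (w3 i) (k - 3)) + (if k < 4 then 0 else ?E (w4 i) (k - 4))) = \<Gamma> i k"
      unfolding \<Gamma>_def by auto
  qed
qed

lemma sc_sum_scaleR: "(\<Sum>i\<in>I. sc (\<beta> i) (t i *\<^sub>R v)) = sc (\<Sum>i\<in>I. \<beta> i * of_real (t i)) v"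
  by (simp only: sc_scaleR sum_left)

lemma T1_w3: "T1 (w3 i) = sc (X i 2 * of_real (c i)) (d 3)
    + sc (\<Sum>j=1..i. A i j 0 * of_real (c j)) (T1 (d 3)) - sc (of_real (c i ^ 3)) ((1/6) *\<^sub>R T1 (d 3))"
  by (simp add: w3_def linear_add[OF T1_linear] linear_diff[OF T1_linear] linear_cmul[OF T1_linear] T1_sc
      d_3[symmetric] sc_of_real del: of_real_power)

lemma T2_w3: "3 \<le> p \<Longrightarrow> T2 (w3 i) = sc (X i 2 * of_real (c i)) (T2 (f x))
    + sc (\<Sum>j=1..i. A i j 0 * of_real (c j)) (T2 (d 3)) - sc (of_real (c i ^ 3)) ((1/6) *\<^sub>R T2 (d 3))"
  by (simp add: w3_def linear_add[OF T2_linear] linear_diff[OF T2_linear] linear_cmul[OF T2_linear] T2_sc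
      sc_of_real del: of_real_power)

lemma T1_w4: "T1 (w4 i) = sc (\<Sum>j=1..i. A i j 0 * of_real (c j ^ 2)) ((1/2) *\<^sub>R T1 (d 4))
    + sc (\<Sum>j=1..i. A i j 2) (T1 (d 2)) - sc (of_real (c i ^ 4)) ((1/24) *\<^sub>R T1 (d 4))"
  by (simp add: w4_def linear_add[OF T1_linear] linear_diff[OF T1_linear] linear_cmul[OF T1_linear] T1_sc
      sc_of_real del: of_real_power)

section \<open>Matching the weighted sum with the Taylor series of the solution\<close>

definition Z :: "nat \<Rightarrow> 'b" where
  "Z k = (\<Sum>i=1..s. \<Sum>l\<le>k. sc (B i l) (\<Gamma> i (k - l)))"

lemma Z_0: "Z 0 = (1/2) *\<^sub>R d 2"
proof -
  have "Z 0 = sc (\<Sum>i=1..s. B i 0) (d 2)" by (simp add: Z_def \<Gamma>_def sum_left numeral_2_eq_2)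
  then show ?thesis by (simp only: order2 sc_of_real)
qed

lemma Z_1: "3 \<le> p \<Longrightarrow> Z 1 = (1/6) *\<^sub>R d 3"
proof -
  assume p: "3 \<le> p"
  have "Z 1 = (\<Sum>i=1..s. sc (B i 0) (c i *\<^sub>R d 3))"
    unfolding Z_def by (rule sum.cong) (use B in \<open>auto simp: \<Gamma>_def zero_left eval_nat_numeral\<close>)
  then show ?thesis by (simp only: sc_sum_scaleR order3[OF p] sc_of_real)
qed

lemma Z_2: "4 \<le> p \<Longrightarrow> Z 2 = (1/24) *\<^sub>R d 4"
proof -
  assume p: "4 \<le> p"
  have "Z 2 = (\<Sum>i=1..s. sc (B i 0) (c i ^ 2 *\<^sub>R (1/2) *\<^sub>R d 4) + sc (B i 2) (d 2))"
    unfolding Z_def by (rule sum.cong) (use B in \<open>auto simp: \<Gamma>_def zero_left eval_nat_numeral\<close>)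
  then show ?thesis by (simp only: sum.distrib sc_sum_scaleR order4[OF p] sc_of_real sum_left[symmetric] zero_left) simp
qed

text \<open>The multiples of \<open>T1 (d 3)\<close> cancel because 1/120 is one sixth of 1/20. The
  \<open>\<xi>\<close> part of the defect contributes a multiple of T1 (f x), which is
  \<open>d 3\<close>, and so cancels against the second-order part of the weights by the mixed
  condition.\<close>

lemma Z_3:
  assumes p: "5 \<le> p"
  shows "Z 3 = (1/120) *\<^sub>R d 5"
proof -
  let ?AC = "\<lambda>i. \<Sum>j=1..i. A i j 0 * of_real (c j)"
  have "Z 3 = (\<Sum>i=1..s. sc (B i 0) (c i ^ 3 *\<^sub>R (1/6) *\<^sub>R d 5 + T1 (w3 i)) + sc (B i 2) (c i *\<^sub>R d 3))"
    unfolding Z_def by (rule sum.cong) (use B in \<open>auto simp: \<Gamma>_def zero_left eval_nat_numeral\<close>)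
  also have "\<dots> = (\<Sum>i=1..s. sc (B i 0 * of_real (c i ^ 3)) ((1/6) *\<^sub>R d 5)
      + sc (B i 0 * (X i 2 * of_real (c i))) (d 3) + sc (B i 0 * ?AC i) (T1 (d 3))
      - sc (B i 0 * of_real (c i ^ 3)) ((1/6) *\<^sub>R T1 (d 3)) + sc (B i 2 * of_real (c i)) (d 3))"
    by (rule sum.cong) (simp_all only: T1_w3 add_right diff_right sc_mult sc_of_real, simp_all)
  also have "\<dots> = sc (\<Sum>i=1..s. B i 0 * of_real (c i ^ 3)) ((1/6) *\<^sub>R d 5)
      + sc ((\<Sum>i=1..s. B i 0 * (X i 2 * of_real (c i))) + (\<Sum>i=1..s. B i 2 * of_real (c i))) (d 3)
      + (sc (\<Sum>i=1..s. B i 0 * ?AC i) (T1 (d 3))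
      - sc (\<Sum>i=1..s. B i 0 * of_real (c i ^ 3)) ((1/6) *\<^sub>R T1 (d 3)))"
    by (simp only: sum.distrib sum_subtractf sum_left add_left) (simp only: algebra_simps)
  also have "\<dots> = (1/120) *\<^sub>R d 5"
    by (simp only: order5[OF p] sc_of_real zero_left) simp
  finally show ?thesis .
qed

text \<open>The multiples of \<open>T2 (d 3)\<close> cancel because 1/180 is one sixth of 1/30, and
  those of \<open>T1 (d 4)\<close> because half of 1/360 is 1/30 divided by 24. What remains lies
  along \<open>T2 (f x)\<close>, \<open>T1 (d 2)\<close> and \<open>d 4\<close>, with weights
  \<open>P\<close>, \<open>Q\<close> and half of \<open>R\<close>.\<close>

lemma Z_4:
  assumes p: "6 \<le> p"
  shows "Z 4 = (1/720) *\<^sub>R d 6"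
proof -
  let ?AC = "\<lambda>i. \<Sum>j=1..i. A i j 0 * of_real (c j)"
  let ?ACC = "\<lambda>i. \<Sum>j=1..i. A i j 0 * of_real (c j ^ 2)"
  let ?AE = "\<lambda>i. \<Sum>j=1..i. A i j 2"
  define P Q R where "P = (\<Sum>i=1..s. B i 0 * (X i 2 * of_real (c i ^ 2)))"
    and "Q = (\<Sum>i=1..s. B i 0 * ?AE i)" and "R = (\<Sum>i=1..s. B i 2 * of_real (c i ^ 2))"
  have d4: "d 4 = T1 (d 2) + T2 (f x)" using p by (intro d_4) simp
  have "Z 4 = (\<Sum>i=1..s. sc (B i 0) (c i ^ 4 *\<^sub>R (1/24) *\<^sub>R d 6 + (c i *\<^sub>R T2 (w3 i) + T1 (w4 i)))
      + sc (B i 2) (c i ^ 2 *\<^sub>R (1/2) *\<^sub>R d 4) + sc (B i 4) (d 2))"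
    unfolding Z_def by (rule sum.cong) (use B in \<open>auto simp: \<Gamma>_def zero_left eval_nat_numeral\<close>)
  also have "\<dots> = (\<Sum>i=1..s. sc (B i 0 * of_real (c i ^ 4)) ((1/24) *\<^sub>R d 6)
      + sc (B i 0 * (X i 2 * of_real (c i ^ 2))) (T2 (f x)) + sc (B i 0 * (of_real (c i) * ?AC i)) (T2 (d 3))
      - sc (B i 0 * of_real (c i ^ 4)) ((1/6) *\<^sub>R T2 (d 3)) + sc (B i 0 * ?ACC i) ((1/2) *\<^sub>R T1 (d 4))
      + sc (B i 0 * ?AE i) (T1 (d 2)) - sc (B i 0 * of_real (c i ^ 4)) ((1/24) *\<^sub>R T1 (d 4))
      + sc (B i 2 * of_real (c i ^ 2)) ((1/2) *\<^sub>R d 4) + sc (B i 4) (d 2))"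
  proof (rule sum.cong)
    fix i
    have 1: "c i *\<^sub>R T2 (w3 i) = sc (X i 2 * of_real (c i ^ 2)) (T2 (f x)) + sc (of_real (c i) * ?AC i) (T2 (d 3))
        - sc (of_real (c i ^ 4)) ((1/6) *\<^sub>R T2 (d 3))"
    proof -
      have "c i *\<^sub>R T2 (w3 i) = sc (of_real (c i)) (T2 (w3 i))" by (simp only: sc_of_real)
      also have "\<dots> = sc (of_real (c i) * (X i 2 * of_real (c i))) (T2 (f x))
          + sc (of_real (c i) * ?AC i) (T2 (d 3))
          - sc (of_real (c i) * of_real (c i ^ 3)) ((1/6) *\<^sub>R T2 (d 3))"
        using p by (simp only: T2_w3 add_right diff_right sc_mult)
      finally show ?thesis by (simp add: power2_eq_square eval_nat_numeral mult_ac)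
    qed
    show "sc (B i 0) (c i ^ 4 *\<^sub>R (1/24) *\<^sub>R d 6 + (c i *\<^sub>R T2 (w3 i) + T1 (w4 i)))
      + sc (B i 2) (c i ^ 2 *\<^sub>R (1/2) *\<^sub>R d 4) + sc (B i 4) (d 2)
      = sc (B i 0 * of_real (c i ^ 4)) ((1/24) *\<^sub>R d 6)
      + sc (B i 0 * (X i 2 * of_real (c i ^ 2))) (T2 (f x)) + sc (B i 0 * (of_real (c i) * ?AC i)) (T2 (d 3))
      - sc (B i 0 * of_real (c i ^ 4)) ((1/6) *\<^sub>R T2 (d 3)) + sc (B i 0 * ?ACC i) ((1/2) *\<^sub>R T1 (d 4))
      + sc (B i 0 * ?AE i) (T1 (d 2)) - sc (B i 0 * of_real (c i ^ 4)) ((1/24) *\<^sub>R T1 (d 4))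
      + sc (B i 2 * of_real (c i ^ 2)) ((1/2) *\<^sub>R d 4) + sc (B i 4) (d 2)"
      unfolding 1 T1_w4 by (simp only: add_right diff_right sc_mult[of "B i _"] sc_of_real) simp
  qed simp
  also have "\<dots> = sc (\<Sum>i=1..s. B i 0 * of_real (c i ^ 4)) ((1/24) *\<^sub>R d 6)
      + (sc (\<Sum>i=1..s. B i 0 * (of_real (c i) * ?AC i)) (T2 (d 3))
        - sc (\<Sum>i=1..s. B i 0 * of_real (c i ^ 4)) ((1/6) *\<^sub>R T2 (d 3)))
      + (sc (\<Sum>i=1..s. B i 0 * ?ACC i) ((1/2) *\<^sub>R T1 (d 4))
        - sc (\<Sum>i=1..s. B i 0 * of_real (c i ^ 4)) ((1/24) *\<^sub>R T1 (d 4)))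
      + (sc P (T2 (f x)) + sc Q (T1 (d 2)) + sc R ((1/2) *\<^sub>R d 4)) + sc (\<Sum>i=1..s. B i 4) (d 2)"
    unfolding P_def Q_def R_def
    by (simp only: sum.distrib sum_subtractf sum_left) (simp only: algebra_simps)
  also have "\<dots> = (1/720) *\<^sub>R d 6 + (sc P (T2 (f x)) + sc Q (T1 (d 2)) + sc R ((1/2) *\<^sub>R d 4))"
    by (simp only: order6[OF p] sc_of_real zero_left) simp
  \<comment> \<open>The two mixed conditions amount to P = Q = -R/2, and the three vectors are
    related by \<open>d 4 = T1 (d 2) + T2 (f x)\<close>.\<close>
  also have "sc P (T2 (f x)) + sc Q (T1 (d 2)) + sc R ((1/2) *\<^sub>R d 4) = 0"
  proof -
    have "2 * P + R = 0" "2 * Q + R = 0" unfolding P_def Q_def R_def using order6(5,6)[OF p] by auto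
    then have R: "R = - (2 * P)" and "2 * P = 2 * Q"
      by (simp add: eq_neg_iff_add_eq_0 add.commute) (metis \<open>2 * P + R = 0\<close> \<open>2 * Q + R = 0\<close> add_right_cancel)
    then have "Q = P" by simp
    have "sc R ((1/2) *\<^sub>R d 4) = - sc P (d 4)"
      unfolding R sc_scaleR by (simp add: minus_left)
    with \<open>Q = P\<close> show ?thesis unfolding d4 by (simp add: add_right)
  qed
  finally show ?thesis by simp
qed

lemma Z_eq:
  assumes "k < p - 1"
  shows "Z k = (1 / fact (k + 2)) *\<^sub>R d (k + 2)"
proof -
  have "k = 0 \<or> k = 1 \<and> 3 \<le> p \<or> k = 2 \<and> 4 \<le> p \<or> k = 3 \<and> 5 \<le> p \<or> k = 4 \<and> 6 \<le> p"
    using assms p by linarith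
  moreover have "fact 3 = (6::real)" "fact 4 = (24::real)" "fact 5 = (120::real)" "fact 6 = (720::real)"
    by (simp_all add: eval_nat_numeral)
  ultimately show ?thesis using Z_0 Z_1 Z_2 Z_3 Z_4 by (elim disjE) (simp_all add: eval_nat_numeral)
qed

text \<open>The weighted sum is known to order p - 1 and the factor \<open>h\<^sup>2\<close> shifts
  this to p + 1; the coefficients 0 and 1 come from the explicit part of the step.\<close>

lemma step_expands:
  "expands (p + 1) (\<lambda>h. x + h *\<^sub>R f x + h\<^sup>2 *\<^sub>R (\<Sum>i=1..s. sc (b i h) (g (Y h i)))) (\<lambda>k. (1 / fact k) *\<^sub>R d k)"
proof -
  have "expands (p - 1) (\<lambda>h. \<Sum>i=1..s. sc (b i h) (g (Y h i))) Z"
    unfolding Z_def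
    by (intro expands_sum expands_bilinear[OF bounded_bilinear_axioms] g_stage_expands expands_mono[OF b]) (use p in auto)
  then have "expands (p - 1) (\<lambda>h. \<Sum>i=1..s. sc (b i h) (g (Y h i))) (\<lambda>k. (1 / fact (k + 2)) *\<^sub>R d (k + 2))"
    by (rule expands_cong) (rule Z_eq)
  from expands_scale_power[OF this, of 2]
  have "expands (p + 1) (\<lambda>h. h\<^sup>2 *\<^sub>R (\<Sum>i=1..s. sc (b i h) (g (Y h i))))
      (\<lambda>k. if k < 2 then 0 else (1 / fact (k - 2 + 2)) *\<^sub>R d (k - 2 + 2))"
    using p by simp
  moreover have "expands (p + 1) (\<lambda>h. h ^ 1 *\<^sub>R f x) (\<lambda>k. if k < 1 then 0 else if k - 1 = 0 then f x else 0)"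
    by (intro expands_scale_power expands_const)
  ultimately have "expands (p + 1) (\<lambda>h. x + h ^ 1 *\<^sub>R f x + h\<^sup>2 *\<^sub>R (\<Sum>i=1..s. sc (b i h) (g (Y h i))))
      (\<lambda>k. (if k = 0 then x else 0) + (if k < 1 then 0 else if k - 1 = 0 then f x else 0)
         + (if k < 2 then 0 else (1 / fact (k - 2 + 2)) *\<^sub>R d (k - 2 + 2)))"
    by (intro expands_add expands_const)
  then have "expands (p + 1) (\<lambda>h. x + h ^ 1 *\<^sub>R f x + h\<^sup>2 *\<^sub>R (\<Sum>i=1..s. sc (b i h) (g (Y h i)))) (\<lambda>k. (1 / fact k) *\<^sub>R d k)"
  proof (rule expands_cong)
    fix k :: nat
    consider "k = 0" | "k = 1" | "2 \<le> k" by linarith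
    then show "(if k = 0 then x else 0) + (if k < 1 then 0 else if k - 1 = 0 then f x else 0)
         + (if k < 2 then 0 else (1 / fact (k - 2 + 2)) *\<^sub>R d (k - 2 + 2)) = (1 / fact k) *\<^sub>R d k"
    proof cases
      case 3
      then have "k - 2 + 2 = k" by simp
      with 3 show ?thesis by simp
    qed (simp_all add: d_0 d_Suc0)
  qed
  then show ?thesis by simp
qed

end

section \<open>Order of consistency\<close>

lemma vanishes_imp_bigo:
  assumes "vanishes n u"
  shows "(\<lambda>h. norm (u h)) \<in> O[at_right 0](\<lambda>h. h ^ n)"
proof -
  obtain K where "\<forall>\<^sub>F h in at_right 0. h > 0 \<and> norm (u h) \<le> K * h ^ n"
    using vanishesD[OF assms] by blast
  then have "\<forall>\<^sub>F h in at_right 0. norm (norm (u h)) \<le> K * norm (h ^ n)"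
    by eventually_elim simp
  then show ?thesis by (rule bigoI)
qed

lemma vanishes_eventually_le:
  assumes "vanishes (Suc n) u" "\<epsilon> > 0"
  shows "\<forall>\<^sub>F h in at_right 0. norm (u h) \<le> \<epsilon>"
  using tendstoD[OF vanishes_Suc_tendsto[OF assms(1)] assms(2)] by eventually_elim simp

context two_derivative_method
begin

text \<open>For small \<open>h\<close> the explicit part of each stage moves \<open>x\<close> only a
  little and the factors \<open>h\<^sup>2 *\<^sub>R a i j h\<close> are small, so
  \<open>diagonal_system\<close> applies.\<close>

lemma eventually_unique_stages:
  assumes r: "r > 0" "cball x r \<subseteq> U"
  shows "\<forall>\<^sub>F h in at_right 0. \<exists>!Y. stages_near r sc s c (\<lambda>i. \<xi> i h) (\<lambda>i j. a i j h) f h x Y"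
proof -
  have "Ck_on 1 g U" using p by (intro Ck_g) simp
  from Ck_on_lipschitz[OF this compact_cball convex_cball r(2)]
  obtain L where L: "L \<ge> 0" "\<And>y z. y \<in> cball x r \<Longrightarrow> z \<in> cball x r \<Longrightarrow> norm (g y - g z) \<le> L * norm (y - z)"
    by blast
  have "continuous_on (cball x r) g"
    using continuous_on_subset[OF Ck_on_continuous[OF Ck_g[of 0]] r(2)] by simp
  from compact_imp_bounded[OF compact_continuous_image[OF this]]
  obtain M where M: "\<And>y. y \<in> cball x r \<Longrightarrow> norm (g y) \<le> M" unfolding bounded_iff by fastforce
  have M0: "M \<ge> 0" using M[of x] r(1) norm_ge_zero[of "g x"] by (auto simp del: norm_ge_zero)
  obtain K where K: "K > 0" "\<And>z v. norm (sc z v) \<le> norm z * norm v * K" using pos_bounded by blast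
  \<comment> \<open>The first bound makes the diagonal maps contractions with constant 1/2, the
    second keeps the sum over the stages below r/4. The added ones keep all denominators
    positive.\<close>
  define \<kappa> where "\<kappa> = min (1 / (2 * (L + 1))) (r / (4 * (real s + 1) * (M + 1)))"
  have \<kappa>: "\<kappa> > 0" unfolding \<kappa>_def using L(1) M0 r(1) by (auto intro!: divide_pos_pos mult_pos_pos)
  have \<kappa>L: "\<kappa> * L \<le> 1 / 2"
  proof -
    have "\<kappa> * L \<le> 1 / (2 * (L + 1)) * (L + 1)" using L(1) by (intro mult_mono) (auto simp: \<kappa>_def)
    also have "\<dots> = 1 / 2" using L(1) by (simp add: field_simps)
    finally show ?thesis .
  qed
  have \<kappa>M: "s * (\<kappa> * M) \<le> r / 4"
  proof -
    have "\<kappa> * M \<le> r / (4 * (real s + 1) * (M + 1)) * (M + 1)" using M0 r(1) by (intro mult_mono) (auto simp: \<kappa>_def)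
    also have "\<dots> = r / (4 * (real s + 1))" using M0 by (simp add: divide_simps)
    finally have "s * (\<kappa> * M) \<le> (s + 1) * (r / (4 * (real s + 1)))"
      using \<kappa> M0 by (intro mult_mono) auto
    also have "\<dots> = r / 4" by (simp add: divide_simps)
    finally show ?thesis .
  qed
  have "\<forall>\<^sub>F h in at_right 0. norm (sc (\<xi> i h) ((c i * h) *\<^sub>R f x)) \<le> r / 4" if "i \<in> {1..s}" for i
  proof (rule vanishes_eventually_le)
    have "vanishes (0 + 0) (\<lambda>h. sc (\<xi> i h) (c i *\<^sub>R f x))"
      by (rule vanishes_bilinear[OF bounded_bilinear_axioms expands_vanishes_0[OF \<xi>[OF that]]
          expands_vanishes_0[OF expands_const[of 0]]])
    from vanishes_scale[OF this, of 1] show "vanishes (Suc 0) (\<lambda>h. sc (\<xi> i h) ((c i * h) *\<^sub>R f x))"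
      by (simp add: scaleR_right mult.commute)
  qed (use r in simp)
  then have \<xi>_small: "\<forall>\<^sub>F h in at_right 0. \<forall>i\<in>{1..s}. norm (sc (\<xi> i h) ((c i * h) *\<^sub>R f x)) \<le> r / 4"
    by (intro eventually_ball_finite) auto
  have "\<forall>\<^sub>F h in at_right 0. norm (h\<^sup>2 *\<^sub>R a i j h) \<le> \<kappa> / K" if "i \<in> {1..s}" "j \<in> {1..i}" for i j
  proof (rule vanishes_eventually_le)
    show "vanishes (Suc 1) (\<lambda>h. h\<^sup>2 *\<^sub>R a i j h)"
      using vanishes_scale[OF expands_vanishes_0[OF a[OF that]], of 2] by (simp add: numeral_2_eq_2)
  qed (use \<kappa> K in simp)
  then have a_small: "\<forall>\<^sub>F h in at_right 0. \<forall>i\<in>{1..s}. \<forall>j\<in>{1..i}. norm (h\<^sup>2 *\<^sub>R a i j h) \<le> \<kappa> / K"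
    by (intro eventually_ball_finite ballI) auto
  from \<xi>_small a_small show ?thesis
  proof eventually_elim
    case (elim h)
    have "\<exists>!Y. Y \<in> {1..s} \<rightarrow>\<^sub>E ball x r \<and> (\<forall>i\<in>{1..s}. Y i = (x + sc (\<xi> i h) ((c i * h) *\<^sub>R f x))
        + (\<Sum>j=1..i. h\<^sup>2 *\<^sub>R sc (a i j h) (g (Y j))))"
    proof (rule diagonal_system[OF r(1) L M _ _ _ _ \<kappa>L \<kappa>M])
      show "norm (h\<^sup>2 *\<^sub>R sc (a i j h) w) \<le> \<kappa> * norm w" if "i \<in> {1..s}" "j \<in> {1..i}" for i j w
      proof -
        have "norm (h\<^sup>2 *\<^sub>R sc (a i j h) w) = norm (sc (h\<^sup>2 *\<^sub>R a i j h) w)" by (simp only: scaleR_left)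
        also have "\<dots> \<le> norm (h\<^sup>2 *\<^sub>R a i j h) * norm w * K" by (rule K)
        also have "\<dots> \<le> \<kappa> / K * norm w * K"
          using elim(2) that K(1) by (intro mult_right_mono) auto
        finally show ?thesis using K(1) by simp
      qed
    qed (use elim \<kappa> in \<open>auto simp: diff_right scaleR_diff_right\<close>)
    then show ?case
      by (simp add: stages_near_def stage_equations_def second_derivative_field_eq scaleR_sum_right)
  qed
qed

text \<open>The equations connect the locale, whose coefficients depend on \<open>h\<close>, with
  the definition, whose coefficients depend on \<mu>; at each use they hold by reflexivity.\<close>

lemma consistent:
  assumes "\<xi> = (\<lambda>i h. \<xi>\<^sub>\<mu> i (freq_arg \<omega> h))" "a = (\<lambda>i j h. a\<^sub>\<mu> i j (freq_arg \<omega> h))"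
    "b = (\<lambda>i h. b\<^sub>\<mu> i (freq_arg \<omega> h))"
  shows "consistent_of_order sc p s \<omega> c \<xi>\<^sub>\<mu> a\<^sub>\<mu> b\<^sub>\<mu> U f"
  unfolding consistent_of_order_def Let_def
proof (intro allI impI)
  fix x0 X\<^sub>e y0 y xn
  assume sol: "solves_ivp f U x0 X\<^sub>e y0 y" and xn: "xn \<in> {x0..<X\<^sub>e}"
  let ?x = "y xn"
  let ?St = "\<lambda>r h. stages_near r sc s c (\<lambda>i. \<xi> i h) (\<lambda>i j. a i j h) f h ?x"
  have "?x \<in> U" using sol xn unfolding solves_ivp_def by auto
  then obtain r where r: "r > 0" "cball ?x r \<subseteq> U" using openU open_contains_cball by blast
  have ex1: "\<forall>\<^sub>F h in at_right 0. \<exists>!Y. ?St r h Y" by (rule eventually_unique_stages[OF r])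
  \<comment> \<open>The description operator yields the stages only when the solution is unique,
    that is for all small \<open>h\<close>; the locale \<open>method_step\<close> asks for no
    more.\<close>
  define Y where "Y h = (THE Y. ?St r h Y)" for h
  have "\<forall>\<^sub>F h in at_right 0. ?St r h (Y h)"
    using ex1
  proof eventually_elim
    case (elim h)
    show ?case unfolding Y_def by (rule theI'[OF elim])
  qed
  then have stages: "\<forall>\<^sub>F h in at_right 0. \<forall>i\<in>{1..s}. Y h i \<in> ball ?x r \<and>
      Y h i = ?x + sc (\<xi> i h) ((c i * h) *\<^sub>R f ?x) + h\<^sup>2 *\<^sub>R (\<Sum>j=1..i. sc (a i j h) (g (Y h j)))"
  proof eventually_elim
    case (elim h)
    then have "Y h i \<in> ball ?x r" if "i \<in> {1..s}" for i
      using PiE_mem that unfolding stages_near_def by blast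
    with elim show ?case
      unfolding stages_near_def stage_equations_def second_derivative_field_eq by blast
  qed
  interpret method_step sc U f p s c \<xi> b a X B A ?x r Y
    by unfold_locales (rule r stages)+
  have "expands (p + 1) (\<lambda>h. y (xn + h)) (\<lambda>k. (1 / fact k) *\<^sub>R d k)"
    using expands_flow[OF openU sol xn Ck_on_id, of "p + 1"] Ck_f by (simp add: d_def)
  from expands_vanishes_diff[OF this step_expands]
  have "(\<lambda>h. norm (y (xn + h) - (?x + h *\<^sub>R f ?x + h\<^sup>2 *\<^sub>R (\<Sum>i=1..s. sc (b i h) (g (Y h i))))))
      \<in> O[at_right 0](\<lambda>h. h ^ (p + 1))" by (rule vanishes_imp_bigo)
  then show "\<exists>r>0. ball ?x r \<subseteq> U \<and>
      (\<forall>\<^sub>F h in at_right 0. \<exists>!Y. stages_near r sc s c (\<lambda>i. \<xi>\<^sub>\<mu> i (freq_arg \<omega> h)) (\<lambda>i j. a\<^sub>\<mu> i j (freq_arg \<omega> h)) f h ?x Y) \<and>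
      (\<lambda>h. norm (y (xn + h) - next_value sc s (\<lambda>i. b\<^sub>\<mu> i (freq_arg \<omega> h)) f h ?x
          (THE Y. stages_near r sc s c (\<lambda>i. \<xi>\<^sub>\<mu> i (freq_arg \<omega> h)) (\<lambda>i j. a\<^sub>\<mu> i j (freq_arg \<omega> h)) f h ?x Y)))
      \<in> O[at_right 0](\<lambda>h. h ^ (p + 1))"
    using r ex1 ball_subset_cball[of ?x r] unfolding assms
    by (intro exI[of _ r]) (auto simp: next_value_def second_derivative_field_eq Y_def assms)
qed

end

section \<open>From analytic coefficient functions of \<mu> to expansions in
  \<open>h\<close>\<close>

text \<open>Taylor's theorem with a bound on the fifth derivative, evaluated along the ray in
  direction \<open>w\<close>.\<close>

lemma analytic_expands:
  assumes "F analytic_on {0}"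
  shows "expands 5 (\<lambda>h. F (w * of_real h)) (\<lambda>k. w ^ k * taylor_coeff k F)"
proof -
  obtain e where e: "e > 0" "F holomorphic_on ball 0 e"
    using assms by (auto simp: analytic_on_def)
  \<comment> \<open>Halving the radius gives a compact disc inside the domain, on which the fifth
    derivative is bounded.\<close>
  have sub: "cball (0::complex) (e / 2) \<subseteq> ball 0 e" using e(1) by auto
  have hol: "(deriv ^^ k) F holomorphic_on ball 0 e" for k
    by (rule holomorphic_higher_deriv[OF e(2)]) simp
  have "continuous_on (cball 0 (e / 2)) ((deriv ^^ 5) F)"
    by (rule continuous_on_subset[OF holomorphic_on_imp_continuous_on[OF hol] sub])
  from compact_imp_bounded[OF compact_continuous_image[OF this]]
  obtain M where M: "\<And>z. z \<in> cball 0 (e / 2) \<Longrightarrow> norm ((deriv ^^ 5) F z) \<le> M"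
    unfolding bounded_iff by fastforce
  have taylor: "norm (F z - (\<Sum>k<5. z ^ k * taylor_coeff k F)) \<le> M / 24 * norm z ^ 5" if z: "z \<in> cball 0 (e / 2)" for z
  proof -
    have "norm ((deriv ^^ 0) F z - (\<Sum>k\<le>4. (deriv ^^ k) F 0 * (z - 0) ^ k / fact k)) \<le> M * norm (z - 0) ^ Suc 4 / fact 4"
    proof (rule complex_Taylor[of "cball 0 (e / 2)"])
      show "((deriv ^^ k) F has_field_derivative (deriv ^^ Suc k) F u) (at u within cball 0 (e / 2))"
        if "u \<in> cball 0 (e / 2)" for k u
        using holomorphic_derivI[OF hol open_ball, of u k] sub that by auto
      show "norm ((deriv ^^ Suc 4) F u) \<le> M" if "u \<in> cball 0 (e / 2)" for u
        using M[OF that] by (simp add: eval_nat_numeral)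
    qed (use e z in auto)
    moreover have "{..4} = {..<5::nat}" by auto
    moreover have "fact 4 = (24::real)" by (simp add: eval_nat_numeral)
    ultimately show ?thesis by (simp add: taylor_coeff_def fps_expansion_def mult.commute)
  qed
  have "((\<lambda>h. w * of_real h) \<longlongrightarrow> w * of_real 0) (at_right 0)" by (intro tendsto_intros)
  from tendstoD[OF this, of "e / 2"] e(1)
  have "\<forall>\<^sub>F h in at_right 0. norm (w * of_real h) < e / 2" by simp
  then have "\<forall>\<^sub>F h in at_right 0. norm (F (w * of_real h) - (\<Sum>k<5. h ^ k *\<^sub>R (w ^ k * taylor_coeff k F))) \<le> M / 24 * norm w ^ 5 * h ^ 5"
    using eventually_small[of 1, simplified]
  proof eventually_elim
    case (elim h)
    then have "norm (F (w * of_real h) - (\<Sum>k<5. (w * of_real h) ^ k * taylor_coeff k F)) \<le> M / 24 * norm (w * of_real h) ^ 5"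
      by (intro taylor) simp
    then show ?case using elim
      by (simp add: norm_mult power_mult_distrib scaleR_conv_of_real mult_ac)
  qed
  then show ?thesis unfolding expands_def by (rule vanishesI)
qed

lemma even_analytic_expands:
  assumes "even_analytic_at_0 F"
  shows "expands 5 (\<lambda>h. F (freq_arg \<omega> h)) (\<lambda>k. (\<i> * of_real \<omega>) ^ k * taylor_coeff k F)"
  using analytic_expands[of F "\<i> * of_real \<omega>"] assms by (simp add: even_analytic_at_0_def freq_arg_def)

text \<open>The expansions along the positive and the negative real axis have difference zero, while
  their odd coefficients differ by twice the Taylor coefficient.\<close>

lemma even_analytic_odd_coeff:
  assumes "even_analytic_at_0 F" "odd k" "k < 5"
  shows "taylor_coeff k F = 0"
proof -
  have an: "F analytic_on {0}" and ev: "\<forall>\<^sub>F \<mu> in nhds 0. F (- \<mu>) = F \<mu>"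
    using assms(1) by (auto simp: even_analytic_at_0_def)
  have "((\<lambda>h. complex_of_real h) \<longlongrightarrow> of_real 0) (at_right 0)" by (intro tendsto_intros)
  then have "filterlim (\<lambda>h. complex_of_real h) (nhds 0) (at_right 0)" by simp
  from eventually_compose_filterlim[OF ev this]
  have "\<forall>\<^sub>F h in at_right 0. F (1 * of_real h) - F (- 1 * of_real h) = 0" by eventually_elim simp
  with expands_diff[OF analytic_expands[OF an, of 1] analytic_expands[OF an, of "- 1"]]
  have "expands 5 (\<lambda>h. 0) (\<lambda>k. 1 ^ k * taylor_coeff k F - (- 1) ^ k * taylor_coeff k F)"
    by (rule expands_eventually)
  from expands_unique[OF this assms(3)] assms(2) show ?thesis by simp
qed

text \<open>The imaginary part of F(i \<omega> h) is eventually zero, so by uniqueness all its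
  expansion coefficients vanish. Thus the coefficients of \<open>h ^ k\<close> are real, with the
  powers of i absorbed.\<close>

lemma real_at_freq_coeff:
  assumes "even_analytic_at_0 F" "real_at_freq \<omega> F" "k < 5"
  shows "Im ((\<i> * of_real \<omega>) ^ k * taylor_coeff k F) = 0"
proof -
  have "\<forall>\<^sub>F h in at_right 0. Im (F (freq_arg \<omega> h)) = 0"
    using assms(2) unfolding real_at_freq_def by eventually_elim (simp add: complex_is_Real_iff)
  with expands_bounded_linear[OF bounded_linear_Im even_analytic_expands[OF assms(1)]]
  have "expands 5 (\<lambda>h. 0) (\<lambda>k. Im ((\<i> * of_real \<omega>) ^ k * taylor_coeff k F))"
    by (rule expands_eventually)
  from expands_unique[OF this assms(3)] show ?thesis .
qed

text \<open>Each condition is a polynomial identity with real constants, and the embedding of the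
  reals into the complex numbers is an injective homomorphism.\<close>

lemma step_conditions_Re:
  fixes X B :: "nat \<Rightarrow> nat \<Rightarrow> complex" and A :: "nat \<Rightarrow> nat \<Rightarrow> nat \<Rightarrow> complex"
  assumes "step_conditions p s c X A B"
    and X: "\<And>i k. i \<in> {1..s} \<Longrightarrow> k < 5 \<Longrightarrow> Im (X i k) = 0"
    and A: "\<And>i j k. i \<in> {1..s} \<Longrightarrow> j \<in> {1..i} \<Longrightarrow> k < 5 \<Longrightarrow> Im (A i j k) = 0"
    and B: "\<And>i k. i \<in> {1..s} \<Longrightarrow> k < 5 \<Longrightarrow> Im (B i k) = 0"
  shows "step_conditions p s c (\<lambda>i k. Re (X i k)) (\<lambda>i j k. Re (A i j k)) (\<lambda>i k. Re (B i k))"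
proof -
  have re: "complex_of_real (Re (X i k)) = X i k" "complex_of_real (Re (B i k)) = B i k"
    if "i \<in> {1..s}" "k < 5" for i k
    using X[OF that] B[OF that] by (simp_all add: complex_eq_iff)
  have reA: "complex_of_real (Re (A i j k)) = A i j k" if "i \<in> {1..s}" "j \<in> {1..i}" "k < 5" for i j k
    using A[OF that] by (simp add: complex_eq_iff)
  have eq: "u = v \<longleftrightarrow> complex_of_real u = complex_of_real v" for u v by simp
  show ?thesis
    using assms(1)
    unfolding step_conditions_def eq of_real_sum of_real_mult of_real_add
    by (simp add: re reA cong: sum.cong_simp)
qed

lemma step_conditions_complex:
  fixes \<omega> :: real
  assumes xi_even: "\<And>i. i \<in> {1..s} \<Longrightarrow> even_analytic_at_0 (\<xi> i)"
    and b_even: "\<And>i. i \<in> {1..s} \<Longrightarrow> even_analytic_at_0 (b i)"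
    and a_even: "\<And>i j. i \<in> {1..s} \<Longrightarrow> j \<in> {1..i} \<Longrightarrow> even_analytic_at_0 (a i j)"
    and xi0: "\<And>i. i \<in> {1..s} \<Longrightarrow> vec_coeff 0 \<xi> i = 1"
    and A0e: "\<And>i. i \<in> {1..s} \<Longrightarrow>
      mat_vec s (mat_coeff 0 a) (\<lambda>_. 1) i = 1/2 * complex_of_real (c i) ^ 2"
    and p: "2 \<le> p"
    and conditions: "order_conditions p s c \<xi> a b"
  defines "w \<equiv> \<i> * complex_of_real \<omega>"
  shows "step_conditions p s c (\<lambda>i k. w ^ k * taylor_coeff k (\<xi> i)) (\<lambda>i j k. w ^ k * taylor_coeff k (a i j))
    (\<lambda>i k. w ^ k * taylor_coeff k (b i))"
proof -
  have odd: "taylor_coeff 1 (\<xi> i) = 0" "taylor_coeff 3 (\<xi> i) = 0" "taylor_coeff 1 (b i) = 0" "taylor_coeff 3 (b i) = 0"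
    if "i \<in> {1..s}" for i
    using even_analytic_odd_coeff[OF xi_even[OF that]] even_analytic_odd_coeff[OF b_even[OF that]] by simp_all
  have oddA: "taylor_coeff 1 (a i j) = 0" if "i \<in> {1..s}" "j \<in> {1..i}" for i j
    using even_analytic_odd_coeff[OF a_even[OF that]] by simp
  \<comment> \<open>\<open>mat_coeff\<close> is zero above the diagonal, so the full row sum
    collapses to the range used by the stage equations.\<close>
  have mv: "mat_vec s (mat_coeff k a) v i = (\<Sum>j=1..i. taylor_coeff k (a i j) * v j)" if "i \<in> {1..s}" for i k v
  proof -
    have "mat_vec s (mat_coeff k a) v i = (\<Sum>j=1..s. if j \<le> i then taylor_coeff k (a i j) * v j else 0)"
      unfolding mat_vec_def mat_coeff_def by (intro sum.cong) auto
    also have "\<dots> = (\<Sum>j | j \<in> {1..s} \<and> j \<le> i. taylor_coeff k (a i j) * v j)"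
      by (rule sum.inter_filter[symmetric]) simp
    also have "{j. j \<in> {1..s} \<and> j \<le> i} = {1..i}" using that by auto
    finally show ?thesis .
  qed
  have low: "(\<Sum>j=1..i. taylor_coeff 0 (a i j)) = of_real ((c i)\<^sup>2 / 2)" "taylor_coeff 0 (\<xi> i) = 1" if "i \<in> {1..s}" for i
    using A0e[OF that] xi0[OF that] by (simp_all add: mv[OF that] vec_coeff_def)
  note C = conditions[unfolded order_conditions_def Let_def dot_def vec_coeff_def]
  note C2 = C[THEN conjunct1, rule_format, OF p]
    and C3 = C[THEN conjunct2, THEN conjunct1, rule_format]
    and C4 = C[THEN conjunct2, THEN conjunct2, THEN conjunct1, rule_format]
    and C5 = C[THEN conjunct2, THEN conjunct2, THEN conjunct2, THEN conjunct1, rule_format]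
    and C6 = C[THEN conjunct2, THEN conjunct2, THEN conjunct2, THEN conjunct2, rule_format]
  \<comment> \<open>The terms of a mixed condition share the factor \<open>w\<^sup>2\<close>. Stated
    with this factor outside, the condition yields the required form by distributivity.\<close>
  have o5: "w\<^sup>2 * ((\<Sum>i=1..s. taylor_coeff 0 (b i) * (taylor_coeff 2 (\<xi> i) * of_real (c i)))
      + (\<Sum>i=1..s. taylor_coeff 2 (b i) * of_real (c i))) = 0" if "5 \<le> p"
    using C5[OF that] by simp
  have o6: "w\<^sup>2 * (2 * (\<Sum>i=1..s. taylor_coeff 0 (b i) * (\<Sum>j=1..i. taylor_coeff 2 (a i j)))
      + (\<Sum>i=1..s. taylor_coeff 2 (b i) * of_real (c i ^ 2))) = 0"
    "w\<^sup>2 * (2 * (\<Sum>i=1..s. taylor_coeff 0 (b i) * (taylor_coeff 2 (\<xi> i) * of_real (c i ^ 2)))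
      + (\<Sum>i=1..s. taylor_coeff 2 (b i) * of_real (c i ^ 2))) = 0" if "6 \<le> p"
    using C6[OF that] by (simp_all add: mv cong: sum.cong_simp)
  show ?thesis
    unfolding step_conditions_def
  proof (intro conjI impI)
    show "\<forall>i\<in>{1..s}. w ^ 0 * taylor_coeff 0 (\<xi> i) = 1 \<and> w ^ 1 * taylor_coeff 1 (\<xi> i) = 0 \<and>
        w ^ 3 * taylor_coeff 3 (\<xi> i) = 0 \<and> w ^ 1 * taylor_coeff 1 (b i) = 0 \<and> w ^ 3 * taylor_coeff 3 (b i) = 0 \<and>
        (\<forall>j\<in>{1..i}. w ^ 1 * taylor_coeff 1 (a i j) = 0) \<and>
        (\<Sum>j=1..i. w ^ 0 * taylor_coeff 0 (a i j)) = of_real ((c i)\<^sup>2 / 2)"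
      using odd oddA low by simp
    show "(\<Sum>i=1..s. w ^ 0 * taylor_coeff 0 (b i)) = of_real (1/2)" using C2 by simp
  next
    assume p: "3 \<le> p"
    show "(\<Sum>i=1..s. w ^ 0 * taylor_coeff 0 (b i) * of_real (c i)) = of_real (1/6)" using C3[OF p] by simp
  next
    assume p: "4 \<le> p"
    show "(\<Sum>i=1..s. w ^ 0 * taylor_coeff 0 (b i) * of_real (c i ^ 2)) = of_real (1/12)" using C4[OF p] by simp
    show "(\<Sum>i=1..s. w ^ 2 * taylor_coeff 2 (b i)) = 0"
      using C4[OF p] by (simp add: sum_distrib_left[symmetric])
  next
    assume p: "5 \<le> p"
    show "(\<Sum>i=1..s. w ^ 0 * taylor_coeff 0 (b i) * (\<Sum>j=1..i. w ^ 0 * taylor_coeff 0 (a i j) * of_real (c j)))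
        = of_real (1/120)"
      using C5[OF p] by (simp add: mv cong: sum.cong_simp)
    show "(\<Sum>i=1..s. w ^ 0 * taylor_coeff 0 (b i) * of_real (c i ^ 3)) = of_real (1/20)" using C5[OF p] by simp
    show "(\<Sum>i=1..s. w ^ 0 * taylor_coeff 0 (b i) * (w ^ 2 * taylor_coeff 2 (\<xi> i) * of_real (c i)))
      + (\<Sum>i=1..s. w ^ 2 * taylor_coeff 2 (b i) * of_real (c i)) = 0"
      using o5[OF p] by (simp add: distrib_left sum_distrib_left mult_ac)
  next
    assume p: "6 \<le> p"
    show "(\<Sum>i=1..s. w ^ 0 * taylor_coeff 0 (b i) * (\<Sum>j=1..i. w ^ 0 * taylor_coeff 0 (a i j) * of_real (c j ^ 2)))
        = of_real (1/360)"
      using C6[OF p] by (simp add: mv cong: sum.cong_simp)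
    show "(\<Sum>i=1..s. w ^ 0 * taylor_coeff 0 (b i) * (of_real (c i) * (\<Sum>j=1..i. w ^ 0 * taylor_coeff 0 (a i j) * of_real (c j))))
        = of_real (1/180)"
      using C6[OF p] by (simp add: mv cong: sum.cong_simp)
    show "(\<Sum>i=1..s. w ^ 0 * taylor_coeff 0 (b i) * of_real (c i ^ 4)) = of_real (1/30)" using C6[OF p] by simp
    show "(\<Sum>i=1..s. w ^ 4 * taylor_coeff 4 (b i)) = 0"
      using C6[OF p] by (simp add: sum_distrib_left[symmetric])
    show "2 * (\<Sum>i=1..s. w ^ 0 * taylor_coeff 0 (b i) * (\<Sum>j=1..i. w ^ 2 * taylor_coeff 2 (a i j)))
      + (\<Sum>i=1..s. w ^ 2 * taylor_coeff 2 (b i) * of_real (c i ^ 2)) = 0"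
      using o6(1)[OF p] by (simp add: distrib_left sum_distrib_left mult_ac)
    show "2 * (\<Sum>i=1..s. w ^ 0 * taylor_coeff 0 (b i) * (w ^ 2 * taylor_coeff 2 (\<xi> i) * of_real (c i ^ 2)))
      + (\<Sum>i=1..s. w ^ 2 * taylor_coeff 2 (b i) * of_real (c i ^ 2)) = 0"
      using o6(2)[OF p] by (simp add: distrib_left sum_distrib_left mult_ac)
  qed
qed

section \<open>The real and the complex state space\<close>

lemma scalar_action_real: "scalar_action ((*\<^sub>R) :: real \<Rightarrow> 'a::euclidean_space \<Rightarrow> 'a)"
  by (intro scalar_action.intro bounded_bilinear_scaleR scalar_action_axioms.intro) simp_all

lemma norm_vector_scalar_mult:
  fixes v :: "complex ^ 'm"
  shows "norm (z *s v) = norm z * norm v"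
  by (simp add: norm_vec_def vector_scalar_mult_def norm_mult L2_set_right_distrib)

lemma scalar_action_complex: "scalar_action ((*s) :: complex \<Rightarrow> complex ^ 'm \<Rightarrow> complex ^ 'm)"
proof (intro scalar_action.intro bounded_bilinear.intro scalar_action_axioms.intro)
  show "\<exists>K. \<forall>z v. norm (z *s (v :: complex ^ 'm)) \<le> norm z * norm v * K"
    by (intro exI[of _ 1]) (simp add: norm_vector_scalar_mult)
qed (simp_all add: vec_eq_iff algebra_simps scaleR_conv_of_real[where 'a = complex])

text \<open>Both conjuncts are instances of \<open>consistent\<close>. On a real state space the
  coefficients enter through \<open>Re\<close>, which by \<open>real_at_freq\<close> does not change
  their values at the frequency argument for small \<open>h\<close>.\<close>

theorem theorem2p1:
  fixes s p :: nat and \<omega> :: real and c :: "nat \<Rightarrow> real"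
    and \<xi> b :: "nat \<Rightarrow> complex \<Rightarrow> complex" and a :: "nat \<Rightarrow> nat \<Rightarrow> complex \<Rightarrow> complex"
    and U :: "'a::euclidean_space set" and f :: "'a \<Rightarrow> 'a"
    and V :: "(complex ^ 'm) set" and F :: "complex ^ 'm \<Rightarrow> complex ^ 'm"
  assumes omega: "\<omega> > 0"
    and xi_even: "\<And>i. i \<in> {1..s} \<Longrightarrow> even_analytic_at_0 (\<xi> i)"
    and b_even: "\<And>i. i \<in> {1..s} \<Longrightarrow> even_analytic_at_0 (b i)"
    and a_even: "\<And>i j. i \<in> {1..s} \<Longrightarrow> j \<in> {1..i} \<Longrightarrow> even_analytic_at_0 (a i j)"
    and xi0: "\<And>i. i \<in> {1..s} \<Longrightarrow> vec_coeff 0 \<xi> i = 1"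
    and A0e: "\<And>i. i \<in> {1..s} \<Longrightarrow>
      mat_vec s (mat_coeff 0 a) (\<lambda>_. 1) i = 1/2 * complex_of_real (c i) ^ 2"
    and p: "2 \<le> p" "p \<le> 6"
    and conditions: "order_conditions p s c \<xi> a b"
  shows
    "(smooth_field (*\<^sub>R) p U f \<and>
      (\<forall>i\<in>{1..s}. real_at_freq \<omega> (\<xi> i) \<and> real_at_freq \<omega> (b i) \<and>
         (\<forall>j\<in>{1..i}. real_at_freq \<omega> (a i j))) \<longrightarrow>
      consistent_of_order (*\<^sub>R) p s \<omega> c (\<lambda>i \<mu>. Re (\<xi> i \<mu>)) (\<lambda>i j \<mu>. Re (a i j \<mu>))
        (\<lambda>i \<mu>. Re (b i \<mu>)) U f) \<and>
     (smooth_field (*s) p V F \<longrightarrow> consistent_of_order (*s) p s \<omega> c \<xi> a b V F)"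
proof (intro conjI impI)
  let ?X = "\<lambda>i k. (\<i> * of_real \<omega>) ^ k * taylor_coeff k (\<xi> i)"
  let ?A = "\<lambda>i j k. (\<i> * of_real \<omega>) ^ k * taylor_coeff k (a i j)"
  let ?B = "\<lambda>i k. (\<i> * of_real \<omega>) ^ k * taylor_coeff k (b i)"
  have C: "step_conditions p s c ?X ?A ?B"
    by (rule step_conditions_complex[OF xi_even b_even a_even xi0 A0e p(1) conditions])
  \<comment> \<open>The block keeps the complex interpretation local, separate from the real
    interpretation of the same locale below.\<close>
  {
    assume "smooth_field (*s) p V F"
    then interpret two_derivative_method "(*s)" V F p s c "\<lambda>i h. \<xi> i (freq_arg \<omega> h)"
      "\<lambda>i h. b i (freq_arg \<omega> h)" "\<lambda>i j h. a i j (freq_arg \<omega> h)" ?X ?B ?A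
      by (intro two_derivative_method.intro scalar_action_complex two_derivative_method_axioms.intro
          even_analytic_expands xi_even b_even a_even C p)
    show "consistent_of_order (*s) p s \<omega> c \<xi> a b V F" by (rule consistent) (rule refl)+
  }
  assume asm: "smooth_field (*\<^sub>R) p U f \<and> (\<forall>i\<in>{1..s}. real_at_freq \<omega> (\<xi> i) \<and> real_at_freq \<omega> (b i) \<and>
      (\<forall>j\<in>{1..i}. real_at_freq \<omega> (a i j)))"
  \<comment> \<open>The complex conditions descend to real parts because the absorbed coefficients
    are real below order 5.\<close>
  have CR: "step_conditions p s c (\<lambda>i k. Re (?X i k)) (\<lambda>i j k. Re (?A i j k)) (\<lambda>i k. Re (?B i k))"
    using asm by (intro step_conditions_Re[OF C] real_at_freq_coeff xi_even b_even a_even) auto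
  interpret two_derivative_method "(*\<^sub>R)" U f p s c "\<lambda>i h. Re (\<xi> i (freq_arg \<omega> h))"
    "\<lambda>i h. Re (b i (freq_arg \<omega> h))" "\<lambda>i j h. Re (a i j (freq_arg \<omega> h))"
    "\<lambda>i k. Re (?X i k)" "\<lambda>i k. Re (?B i k)" "\<lambda>i j k. Re (?A i j k)"
    using asm by (intro two_derivative_method.intro scalar_action_real two_derivative_method_axioms.intro
        expands_bounded_linear[OF bounded_linear_Re] even_analytic_expands xi_even b_even a_even CR p) auto
  show "consistent_of_order (*\<^sub>R) p s \<omega> c (\<lambda>i \<mu>. Re (\<xi> i \<mu>)) (\<lambda>i j \<mu>. Re (a i j \<mu>)) (\<lambda>i \<mu>. Re (b i \<mu>)) U f"
    by (rule consistent) (rule refl)+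
qed

end
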